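(* Let $N\ge3$, $\lambda<\frac{(N-2)^2}{4}$, and let $\{a_n\}_{n\in\mathbb{N}}\subset\mathbb{R}^N$ satisfy $\sum_{n=1}^\infty|a_n|^{-(N-2)}<+\infty$, $\sup_{n}\sum_{k=1}^\infty|a_{n+k}-a_n|^{-(N-2)}<+\infty$, and $|a_n-a_m|\ge1$ for all $n\neq m$. Let $\delta\in(0,1/2)$ be such that, with $V(x)=\lambda\sum_{n=1}^\infty\frac{\chi_{B(a_n,\delta)}(x)}{|x-a_n|^2}$, $$\inf_{u\in\mathcal{D}^{1,2}(\mathbb{R}^N)\setminus\{0\}}\frac{\int_{\mathbb{R}^N}(|\nabla u|^2-Vu^2)dx}{\int_{\mathbb{R}^N}|\nabla u|^2dx}>0.$$ Then $-\Delta-V$, acting in $L^2(\mathbb{R}^N)$ with domain $C_c^\infty(\mathbb{R}^N\setminus\{a_n\}_{n\in\mathbb{N}})$, is essentially self-adjoint if and only if $\lambda\le\frac{(N-2)^2}{4}-1$.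
   Context: $\mathcal{D}^{1,2}(\mathbb{R}^N)$ is the completion of $C_c^\infty(\mathbb{R}^N)$ for the norm $(\int|\nabla u|^2)^{1/2}$. Under the stated assumptions on $\{a_n\}$, a $\delta>0$ with the stated positivity property exists (proved in the paper). *)

theory Defs
  imports "HOL-Analysis.Analysis"
begin

definition partial_deriv :: "'n::finite \<Rightarrow> (real^'n \<Rightarrow> 'a::real_normed_vector) \<Rightarrow> real^'n \<Rightarrow> 'a" where
  "partial_deriv i f x = vector_derivative (\<lambda>t. f (x + t *\<^sub>R axis i 1)) (at 0)"

fun iter_partial :: "'n::finite list \<Rightarrow> (real^'n \<Rightarrow> 'a::real_normed_vector) \<Rightarrow> real^'n \<Rightarrow> 'a" where
  "iter_partial [] f = f"
| "iter_partial (i # is) f = partial_deriv i (iter_partial is f)"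

definition smooth_fun :: "(real^'n::finite \<Rightarrow> 'a::real_normed_vector) \<Rightarrow> bool" where
  "smooth_fun f \<longleftrightarrow>
     (\<forall>is. continuous_on UNIV (iter_partial is f) \<and>
        (\<forall>i x. (\<lambda>t. iter_partial is f (x + t *\<^sub>R axis i 1)) differentiable (at 0)))"

definition tsupport :: "(real^'n::finite \<Rightarrow> 'a::zero) \<Rightarrow> (real^'n) set" where
  "tsupport f = closure {x. f x \<noteq> 0}"

definition Cc_inf :: "(real^'n::finite) set \<Rightarrow> (real^'n \<Rightarrow> 'a::real_normed_vector) set" where
  "Cc_inf \<Omega> = {f. smooth_fun f \<and> compact (tsupport f) \<and> tsupport f \<subseteq> \<Omega>}"

definition laplacian :: "(real^'n::finite \<Rightarrow> 'a::real_normed_vector) \<Rightarrow> real^'n \<Rightarrow> 'a" where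
  "laplacian f x = (\<Sum>i\<in>UNIV. iter_partial [i, i] f x)"

definition grad_sq :: "(real^'n::finite \<Rightarrow> real) \<Rightarrow> real^'n \<Rightarrow> real" where
  "grad_sq u x = (\<Sum>i\<in>UNIV. (partial_deriv i u x)\<^sup>2)"

definition potential :: "real \<Rightarrow> real \<Rightarrow> (nat \<Rightarrow> real^'n::finite) \<Rightarrow> real^'n \<Rightarrow> real" where
  "potential lam \<delta> a x = lam * (\<Sum>n. indicator (ball (a n) \<delta>) x / (norm (x - a n))\<^sup>2)"

definition L2 :: "(real^'n::finite \<Rightarrow> complex) set" where
  "L2 = {f. f \<in> borel_measurable lebesgue \<and> integrable lebesgue (\<lambda>x. (norm (f x))\<^sup>2)}"

definition L2_inner :: "(real^'n::finite \<Rightarrow> complex) \<Rightarrow> (real^'n \<Rightarrow> complex) \<Rightarrow> complex" where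
  "L2_inner f g = integral\<^sup>L lebesgue (\<lambda>x. f x * cnj (g x))"

definition L2_norm :: "(real^'n::finite \<Rightarrow> complex) \<Rightarrow> real" where
  "L2_norm f = sqrt (integral\<^sup>L lebesgue (\<lambda>x. (norm (f x))\<^sup>2))"

definition op_graph :: "((real^'n::finite \<Rightarrow> complex) \<Rightarrow> (real^'n \<Rightarrow> complex)) \<Rightarrow> (real^'n \<Rightarrow> complex) set
     \<Rightarrow> ((real^'n \<Rightarrow> complex) \<times> (real^'n \<Rightarrow> complex)) set" where
  "op_graph T D = {(u, T u) | u. u \<in> D}"

text \<open>Closure of a graph in L^2 x L^2 (elements identified a.e. automatically, since
  limits in L^2 are only determined a.e.).\<close>
definition graph_closure :: "((real^'n::finite \<Rightarrow> complex) \<times> (real^'n \<Rightarrow> complex)) set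
     \<Rightarrow> ((real^'n \<Rightarrow> complex) \<times> (real^'n \<Rightarrow> complex)) set" where
  "graph_closure S = {(u, v). u \<in> L2 \<and> v \<in> L2 \<and>
     (\<exists>s :: nat \<Rightarrow> _. (\<forall>k. s k \<in> S) \<and>
        (\<lambda>k. L2_norm (fst (s k) - u)) \<longlonglongrightarrow> 0 \<and>
        (\<lambda>k. L2_norm (snd (s k) - v)) \<longlonglongrightarrow> 0)}"

definition graph_adjoint :: "((real^'n::finite \<Rightarrow> complex) \<times> (real^'n \<Rightarrow> complex)) set
     \<Rightarrow> ((real^'n \<Rightarrow> complex) \<times> (real^'n \<Rightarrow> complex)) set" where
  "graph_adjoint S = {(g, h). g \<in> L2 \<and> h \<in> L2 \<and>
     (\<forall>(u, v)\<in>S. L2_inner v g = L2_inner u h)}"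

definition self_adjoint_graph :: "((real^'n::finite \<Rightarrow> complex) \<times> (real^'n \<Rightarrow> complex)) set \<Rightarrow> bool" where
  "self_adjoint_graph S \<longleftrightarrow> S = graph_adjoint S"

definition essentially_self_adjoint ::
  "((real^'n::finite \<Rightarrow> complex) \<Rightarrow> (real^'n \<Rightarrow> complex)) \<Rightarrow> (real^'n \<Rightarrow> complex) set \<Rightarrow> bool" where
  "essentially_self_adjoint T D \<longleftrightarrow> self_adjoint_graph (graph_closure (op_graph T D))"

definition schroedinger_op :: "(real^'n::finite \<Rightarrow> real) \<Rightarrow> (real^'n \<Rightarrow> complex) \<Rightarrow> real^'n \<Rightarrow> complex" where
  "schroedinger_op V u x = - laplacian u x - complex_of_real (V x) * u x"

end

theory Submission
  imports Defs "HOL-Computational_Algebra.Polynomial" "HOL-Real_Asymp.Real_Asymp"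
begin

text \<open>Put \<open>\<kappa> = (N - 2) / 2\<close> and let \<open>r\<close> be the distance to a pole.
  Since the operator \<open>T\<close> is nonnegative, it is essentially self-adjoint as soon as, for one \<open>b > 0\<close>, every square
  integrable \<open>g\<close> that is orthogonal to the range of \<open>T + b\<close> vanishes. Such a \<open>g\<close> solves
  \<open>- \<Delta> g - V g + b g = 0\<close> weakly off the poles. Testing the mollified equation with \<open>\<eta>\<^sup>2 g\<close> gives
  \<open>\<integral> (W - V + b) \<eta>\<^sup>2 g\<^sup>2 \<le> \<integral> |\<nabla>\<eta>|\<^sup>2 g\<^sup>2\<close> with the Hardy weight \<open>W = - div F - |F|\<^sup>2\<close>, where \<open>F = - \<kappa> (x - a n) / r\<^sup>2\<close> and
  hence \<open>W = \<kappa>\<^sup>2 / r\<^sup>2\<close> up to a bounded term near each pole. Choosing \<open>\<eta>\<close> comparable to \<open>r\<close> near the poles one has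
  \<open>|\<nabla>\<eta>|\<^sup>2 \<le> \<eta>\<^sup>2 / r\<^sup>2\<close>, so \<open>\<kappa>\<^sup>2 - lam - 1 \<ge> 0\<close> makes the left-hand side win for large \<open>b\<close>, even in the limiting
  case. As \<open>|\<nabla>\<eta>|\<close> is bounded and \<open>g\<close> is square integrable, the cutoffs at the poles and at infinity disappear by
  dominated convergence, and no regularity of \<open>g\<close> is needed.

  Conversely, for \<open>lam > \<kappa>\<^sup>2 - 1\<close> both solutions \<open>r\<close> to the power \<open>- \<kappa> \<plusminus> sqrt (\<kappa>\<^sup>2 - lam)\<close> of the equation near one pole are
  square integrable. Cut off, they lie in the domain of the adjoint, and their Wronskian shows that the adjoint is not
  symmetric.\<close>

section \<open>Partial derivatives and integration by parts\<close>

text \<open>\<open>F\<close> is the logarithmic gradient of r to the power - \<kappa>, the ground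
  state of the Hardy inequality, so its weight is minus the Laplacian of that state divided by the
  state. Cutting \<open>F\<close> off at distance \<delta> costs only a bounded term, uniformly over
  the poles, since the balls of radius \<delta> are disjoint translates of each other. The obstacle
  is the limiting case: the coefficients of 1 / r^2 coming from the Hardy weight, from V and from
  the cutoff then cancel exactly, so the gradient bound has to hold with constant 1. A cutoff rising
  from 0 to 1 between radii e and 2 e has squared gradient of order 1 / e^2, which is not dominated
  uniformly in e. A weight linear in r avoids this; composing it with a function of slope at most 1
  makes it vanish near the pole without spoiling the constant. The linear weight also explains the
  threshold: r times the critical solution r^(- \<kappa> - 1) is the Hardy ground state itself. In
  the converse direction both solutions carry the same radial cutoff, so that their Wronskian
  becomes the integral of a function of constant sign.\<close>

definition has_pd :: "'n::finite \<Rightarrow> (real^'n \<Rightarrow> 'a::real_normed_vector) \<Rightarrow> 'a \<Rightarrow> real^'n \<Rightarrow> bool" where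
  "has_pd i f d x \<longleftrightarrow> ((\<lambda>t. f (x + t *\<^sub>R axis i 1)) has_vector_derivative d) (at 0)"

lemma partial_deriv_eq: "has_pd i f d x \<Longrightarrow> partial_deriv i f x = d"
  by (simp add: has_pd_def partial_deriv_def vector_derivative_at)

lemma has_pd_const: "has_pd i (\<lambda>x. c) 0 x"
  by (simp add: has_pd_def)

lemma has_pd_add: "has_pd i f d x \<Longrightarrow> has_pd i g e x \<Longrightarrow> has_pd i (\<lambda>x. f x + g x) (d + e) x"
  by (auto simp: has_pd_def intro!: derivative_eq_intros)

lemma has_pd_diff: "has_pd i f d x \<Longrightarrow> has_pd i g e x \<Longrightarrow> has_pd i (\<lambda>x. f x - g x) (d - e) x"
  by (auto simp: has_pd_def intro!: derivative_eq_intros)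

lemma has_pd_minus: "has_pd i f d x \<Longrightarrow> has_pd i (\<lambda>x. - f x) (- d) x"
  by (auto simp: has_pd_def intro!: derivative_eq_intros)

lemma has_pd_mult:
  fixes f g :: "real^'n::finite \<Rightarrow> 'a::real_normed_algebra"
  shows "has_pd i f d x \<Longrightarrow> has_pd i g e x \<Longrightarrow> has_pd i (\<lambda>x. f x * g x) (f x * e + d * g x) x"
  unfolding has_pd_def by (drule (1) has_vector_derivative_mult) simp

lemma has_pd_sum:
  "(\<And>j. j \<in> J \<Longrightarrow> has_pd i (f j) (d j) x) \<Longrightarrow> has_pd i (\<lambda>x. \<Sum>j\<in>J. f j x) (\<Sum>j\<in>J. d j) x"
  unfolding has_pd_def by (rule has_vector_derivative_sum) auto

lemma has_pd_bounded_linear: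
  "bounded_linear h \<Longrightarrow> has_pd i f d x \<Longrightarrow> has_pd i (\<lambda>x. h (f x)) (h d) x"
  unfolding has_pd_def by (rule bounded_linear.has_vector_derivative)

lemma has_pd_of_real:
  "has_pd i f d x \<Longrightarrow> has_pd i (\<lambda>x. complex_of_real (f x)) (complex_of_real d) x"
  by (rule has_pd_bounded_linear[OF bounded_linear_of_real])

lemma has_pd_nth: "has_pd i (\<lambda>x :: real^'n::finite. x $ j) (if i = j then 1 else 0) x"
proof -
  have "((\<lambda>t. x $ j + t * (axis i 1 :: real^'n) $ j) has_real_derivative (axis i 1 :: real^'n) $ j) (at 0)"
    by (auto intro!: derivative_eq_intros)
  then show ?thesis
    by (auto simp: has_pd_def has_real_derivative_iff_has_vector_derivative axis_def if_distrib
        split: if_splits)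
qed

lemma has_pd_chain:
  fixes f :: "real^'n::finite \<Rightarrow> real"
  assumes "(g has_real_derivative g') (at (f x))" "has_pd i f d x"
  shows "has_pd i (\<lambda>x. g (f x)) (g' * d) x"
proof -
  have "((\<lambda>t. g (f (x + t *\<^sub>R axis i 1))) has_real_derivative g' * d) (at 0)"
    using assms by (intro DERIV_chain2[of g])
      (simp_all add: has_pd_def has_real_derivative_iff_has_vector_derivative)
  then show ?thesis
    by (simp add: has_pd_def has_real_derivative_iff_has_vector_derivative)
qed

lemma has_pd_norm_sq:
  fixes a :: "real^'n::finite"
  shows "has_pd i (\<lambda>x. (norm (x - a))\<^sup>2) (2 * (x - a) $ i) x"
proof -
  have n: "(norm (y - a))\<^sup>2 = (\<Sum>j\<in>UNIV. (y $ j - a $ j) * (y $ j - a $ j))" for y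
    by (simp add: power2_norm_eq_inner inner_vec_def)
  have "has_pd i (\<lambda>x. \<Sum>j\<in>UNIV. (x $ j - a $ j) * (x $ j - a $ j))
     (\<Sum>j\<in>UNIV. (x $ j - a $ j) * ((if i = j then 1 else 0) - 0) + ((if i = j then 1 else 0) - 0) * (x $ j - a $ j)) x"
    by (intro has_pd_sum has_pd_mult has_pd_diff has_pd_nth has_pd_const)
  also have "(\<Sum>j\<in>UNIV. (x $ j - a $ j) * ((if i = j then 1 else 0) - 0) + ((if i = j then 1 else 0) - 0) * (x $ j - a $ j))
     = 2 * (x - a) $ i"
    by (simp add: sum.distrib if_distrib if_distribR cong: if_cong)
  finally show ?thesis by (simp add: n)
qed

lemma tendsto_line: "((\<lambda>t. x + t *\<^sub>R axis i 1) \<longlongrightarrow> (x :: real^'n::finite)) (at (0::real))"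
  by (rule tendsto_eq_intros | simp)+

lemma has_pd_cong:
  assumes "eventually (\<lambda>y. f y = g y) (nhds x)" "has_pd i f d x"
  shows "has_pd i g d x"
proof -
  have "filterlim (\<lambda>t. x + t *\<^sub>R axis i 1) (nhds x) (nhds (0::real))"
    using tendsto_line[of x i] tendsto_at_iff_tendsto_nhds[of "\<lambda>t. x + t *\<^sub>R axis i 1" "0::real"] by simp
  then have ev: "eventually (\<lambda>t. f (x + t *\<^sub>R axis i 1) = g (x + t *\<^sub>R axis i 1)) (nhds (0::real))"
    using assms(1) by (auto simp: filterlim_iff)
  have "f x = g x" using eventually_nhds_x_imp_x[OF assms(1)] .
  then show ?thesis
    using assms(2) has_vector_derivative_cong_ev[where S = UNIV and x = 0 and f = "\<lambda>t. f (x + t *\<^sub>R axis i 1)"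
       and g = "\<lambda>t. g (x + t *\<^sub>R axis i 1)"] ev
    by (simp add: has_pd_def)
qed

text \<open>\<open>has_pd\<close> differentiates at parameter 0 only. Translating the base point
  gives the derivative along the entire line, which the mean value estimate requires.\<close>

lemma has_pd_line:
  assumes "has_pd i f d (x + s *\<^sub>R axis i 1)"
  shows "((\<lambda>t. f (x + t *\<^sub>R axis i 1)) has_vector_derivative d) (at s)"
proof -
  have "((\<lambda>t. f ((x + s *\<^sub>R axis i 1) + t *\<^sub>R axis i 1)) \<circ> (\<lambda>t. t - s) has_vector_derivative 1 *\<^sub>R d) (at s)"
    using assms unfolding has_pd_def
    by (intro vector_diff_chain_at) (auto intro!: derivative_eq_intros)
  then show ?thesis
    by (simp add: o_def scaleR_add_left[symmetric] add.assoc)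
qed

lemma has_pd_shift:
  "has_pd i (\<lambda>x. f (x + c)) d x \<longleftrightarrow> has_pd i f d (x + c)"
  by (simp add: has_pd_def algebra_simps)

section \<open>Compact supports, translations and integration by parts\<close>

lemma integrable_cont_compact_support:
  fixes f :: "'a::euclidean_space \<Rightarrow> 'b::{banach, second_countable_topology}"
  assumes "continuous_on UNIV f" "\<And>x. norm x > R \<Longrightarrow> f x = 0"
  shows "integrable lborel f"
proof -
  have "integrable lborel (\<lambda>x. indicator (cball 0 R) x *\<^sub>R f x)"
    using assms(1) by (intro borel_integrable_compact) (auto intro: continuous_on_subset)
  also have "(\<lambda>x. indicator (cball 0 R) x *\<^sub>R f x) = f"
    using assms(2) by (force simp: indicator_def)
  finally show ?thesis .
qed

lemma bounded_cont_compact_support: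
  fixes f :: "'a::euclidean_space \<Rightarrow> 'b::real_normed_vector"
  assumes "continuous_on UNIV f" "\<And>x. norm x > R \<Longrightarrow> f x = 0"
  obtains B where "B > 0" "\<And>x. norm (f x) \<le> B"
proof -
  have "bounded (f ` cball 0 R)"
    using assms(1) by (intro compact_imp_bounded compact_continuous_image) (auto intro: continuous_on_subset)
  then obtain B where "B > 0" "\<And>x. x \<in> cball 0 R \<Longrightarrow> norm (f x) \<le> B"
    by (auto simp: bounded_pos)
  then show ?thesis using assms(2) by (intro that[of B]) (auto, metis norm_zero not_le order_less_imp_le)
qed

lemma lborel_integral_shift:
  fixes f :: "'a::euclidean_space \<Rightarrow> 'b::{banach, second_countable_topology}"
  assumes [measurable]: "f \<in> borel_measurable borel"
  shows "(\<integral>x. f (x + c) \<partial>lborel) = integral\<^sup>L lborel f"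
    "integrable lborel (\<lambda>x. f (x + c)) \<longleftrightarrow> integrable lborel f"
proof -
  have d: "distr lborel borel ((+) c) = (lborel :: 'a measure)" by (rule lborel_distr_plus)
  show "(\<integral>x. f (x + c) \<partial>lborel) = integral\<^sup>L lborel f"
    by (subst d[symmetric], subst integral_distr) (auto simp: add.commute)
  show "integrable lborel (\<lambda>x. f (x + c)) \<longleftrightarrow> integrable lborel f"
    by (subst (2) d[symmetric], subst integrable_distr_eq) (auto simp: add.commute)
qed

lemma has_pd_lipschitz:
  fixes f :: "real^'n::finite \<Rightarrow> 'a::real_normed_vector"
  assumes "\<And>x. has_pd i f (f' x) x" "\<And>x. norm (f' x) \<le> B"
  shows "norm (f (x + t *\<^sub>R axis i 1) - f x) \<le> B * \<bar>t\<bar>"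
proof -
  have "norm (f (x + t *\<^sub>R axis i 1) - f (x + 0 *\<^sub>R axis i 1)) \<le> B * norm (t - 0)"
  proof (rule differentiable_bound[where S = UNIV and f' = "\<lambda>s h. h *\<^sub>R f' (x + s *\<^sub>R axis i 1)"])
    show "onorm (\<lambda>h. h *\<^sub>R f' (x + s *\<^sub>R axis i 1)) \<le> B" for s :: real
      using assms(2) by (intro onorm_le) (metis mult.commute mult_right_mono norm_ge_zero norm_scaleR real_norm_def)
  qed (use has_pd_line[OF assms(1)] in \<open>auto simp: has_vector_derivative_def intro: has_derivative_at_withinI\<close>)
  then show ?thesis by simp
qed

lemma has_pd_LIMSEQ:
  assumes "has_pd i f d x" "h \<longlonglongrightarrow> 0" "\<And>k. h k \<noteq> (0::real)"
  shows "(\<lambda>k. (f (x + h k *\<^sub>R axis i 1) - f x) /\<^sub>R h k) \<longlonglongrightarrow> d"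
proof -
  have "((\<lambda>t. (f (x + t *\<^sub>R axis i 1) - f x) /\<^sub>R t) \<longlongrightarrow> d) (at 0)"
  proof (rule LIM_zero_cancel, rule tendsto_norm_zero_cancel)
    have "((\<lambda>t. norm (f (x + t *\<^sub>R axis i 1) - f x - t *\<^sub>R d) / norm t) \<longlongrightarrow> 0) (at 0)"
      using assms(1) unfolding has_pd_def has_vector_derivative_def has_derivative_at by simp
    moreover have "norm (f (x + t *\<^sub>R axis i 1) - f x - t *\<^sub>R d) / norm t
        = norm ((f (x + t *\<^sub>R axis i 1) - f x) /\<^sub>R t - d)" if "t \<noteq> 0" for t
    proof -
      have "(f (x + t *\<^sub>R axis i 1) - f x) /\<^sub>R t - d = (f (x + t *\<^sub>R axis i 1) - f x - t *\<^sub>R d) /\<^sub>R t"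
        using that by (simp add: scaleR_diff_right)
      then show ?thesis by (simp add: divide_inverse mult.commute)
    qed
    ultimately show "((\<lambda>t. norm ((f (x + t *\<^sub>R axis i 1) - f x) /\<^sub>R t - d)) \<longlongrightarrow> 0) (at 0)"
      by (auto elim!: Lim_transform_eventually simp: eventually_at_filter)
  qed
  then show ?thesis
    using assms(2,3) by (auto simp: tendsto_at_iff_sequentially o_def)
qed

lemma has_pd_outside:
  assumes "\<And>x. norm x > R \<Longrightarrow> f x = 0" "has_pd i f d x" "norm x > R"
  shows "d = 0"
proof -
  have "eventually (\<lambda>y. f y = 0) (nhds x)"
    unfolding eventually_nhds using assms(1,3)
    by (intro exI[of _ "- cball 0 R"]) (auto simp: open_Compl)
  then have "has_pd i (\<lambda>_. 0) d x"
    using has_pd_cong assms(2) by fastforce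
  then show ?thesis using partial_deriv_eq has_pd_const by metis
qed

text \<open>The difference quotients of \<open>f\<close> in direction \<open>i\<close> have integral
  0 by translation invariance, and they converge boundedly on a fixed ball to \<open>f'\<close>.
  Every integration by parts below is this fact applied to a product.\<close>

lemma integral_pd_eq_0:
  fixes f :: "real^'n::finite \<Rightarrow> 'a::{banach, second_countable_topology}"
  assumes pd: "\<And>x. has_pd i f (f' x) x" and c: "continuous_on UNIV f" "continuous_on UNIV f'"
    and out: "\<And>x. norm x > R \<Longrightarrow> f x = 0"
  shows "integrable lborel f'" "integral\<^sup>L lborel f' = 0"
proof -
  have out': "f' x = 0" if "norm x > R" for x
    using has_pd_outside[OF out pd that] .
  have [measurable]: "f \<in> borel_measurable borel" "f' \<in> borel_measurable borel"
    using c by (auto intro: borel_measurable_continuous_onI)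
  obtain B where B: "B > 0" "\<And>x. norm (f' x) \<le> B"
    using bounded_cont_compact_support[OF c(2) out'] by blast
  have intf: "integrable lborel f" by (rule integrable_cont_compact_support[OF c(1) out])
  show "integrable lborel f'" by (rule integrable_cont_compact_support[OF c(2) out'])
  define h where "h k = inverse (real (Suc k))" for k
  have h: "h \<longlonglongrightarrow> 0" "h k \<noteq> 0" "0 < h k" "h k \<le> 1" for k
    using LIMSEQ_inverse_real_of_nat by (auto simp: h_def[abs_def] inverse_eq_divide)
  define D where "D k x = (f (x + h k *\<^sub>R axis i 1) - f x) /\<^sub>R h k" for k x
  have "(\<lambda>k. integral\<^sup>L lborel (D k)) \<longlonglongrightarrow> integral\<^sup>L lborel f'"
  \<comment> \<open>The steps \<open>h k\<close> are at most 1, so all difference quotients vanish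
    outside the ball of radius \<open>R + 1\<close>.\<close>
  proof (rule integral_dominated_convergence[where w = "\<lambda>x. B * indicator (cball 0 (R+1)) x"])
    show "integrable lborel (\<lambda>x. B * indicator (cball 0 (R+1)) x :: real)"
      by (intro integrable_mult_right integrable_real_indicator)
         (use emeasure_lborel_cball_finite in \<open>auto simp: top.not_eq_extremum[symmetric]\<close>)
    show "AE x in lborel. (\<lambda>k. D k x) \<longlonglongrightarrow> f' x"
      unfolding D_def using has_pd_LIMSEQ[OF pd h(1,2)] by auto
    show "AE x in lborel. norm (D k x) \<le> B * indicator (cball 0 (R+1)) x" for k
    proof (rule AE_I2)
      fix x
      show "norm (D k x) \<le> B * indicator (cball 0 (R+1)) x"
      proof (cases "norm x \<le> R + 1")
        case True
        have "norm (f (x + h k *\<^sub>R axis i 1) - f x) \<le> B * \<bar>h k\<bar>"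
          by (rule has_pd_lipschitz[OF pd B(2)])
        moreover have "norm (D k x) = norm (f (x + h k *\<^sub>R axis i 1) - f x) / h k"
          using h(3)[of k] by (simp add: D_def divide_inverse mult.commute)
        ultimately show ?thesis using True h(3)[of k] by (simp add: pos_divide_le_eq)
      next
        case False
        have "norm x \<le> norm (x + h k *\<^sub>R axis i 1) + norm (h k *\<^sub>R (axis i 1 :: real^'n))"
          by (metis add_diff_cancel norm_triangle_ineq4)
        also have "norm (h k *\<^sub>R (axis i 1 :: real^'n)) \<le> 1"
          using h(3,4)[of k] by simp
        finally show ?thesis using False out by (simp add: D_def)
      qed
    qed
  qed (unfold D_def, measurable)
  moreover have "integral\<^sup>L lborel (D k) = 0" for k
    unfolding D_def using intf lborel_integral_shift[of f "h k *\<^sub>R axis i 1"] by simp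
  ultimately show "integral\<^sup>L lborel f' = 0"
    by (simp add: LIMSEQ_const_iff)
qed

section \<open>The space of square integrable functions\<close>

lemma real_Cauchy_Schwarz_integral:
  fixes f g :: "'a \<Rightarrow> real"
  assumes [measurable]: "f \<in> borel_measurable M" "g \<in> borel_measurable M"
    and f: "integrable M (\<lambda>x. (f x)\<^sup>2)" and g: "integrable M (\<lambda>x. (g x)\<^sup>2)"
  shows "integrable M (\<lambda>x. f x * g x)"
    "\<bar>\<integral>x. f x * g x \<partial>M\<bar> \<le> sqrt (\<integral>x. (f x)\<^sup>2 \<partial>M) * sqrt (\<integral>x. (g x)\<^sup>2 \<partial>M)"
proof -
  show int: "integrable M (\<lambda>x. f x * g x)"
  proof (rule Bochner_Integration.integrable_bound[OF Bochner_Integration.integrable_add[OF f g]])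
    have "2 * \<bar>f x * g x\<bar> \<le> (f x)\<^sup>2 + (g x)\<^sup>2" for x
      using sum_squares_bound[of "\<bar>f x\<bar>" "\<bar>g x\<bar>"] by (simp add: abs_mult)
    then have "norm (f x * g x) \<le> norm ((f x)\<^sup>2 + (g x)\<^sup>2)" for x
      using abs_ge_zero[of "f x * g x"] by (smt (verit) real_norm_def)
    then show "AE x in M. norm (f x * g x) \<le> norm ((f x)\<^sup>2 + (g x)\<^sup>2)" by simp
  qed simp
  define C where "C = (\<integral>x. \<bar>f x\<bar> * \<bar>g x\<bar> \<partial>M)"
  have intC: "integrable M (\<lambda>x. \<bar>f x\<bar> * \<bar>g x\<bar>)"
    using integrable_abs[OF int] by (simp add: abs_mult)
  have C0: "0 \<le> C" unfolding C_def by simp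
  have "ennreal (C\<^sup>2) = (\<integral>\<^sup>+x. ennreal \<bar>f x\<bar> * ennreal \<bar>g x\<bar> \<partial>M)\<^sup>2"
    using intC C0 by (simp add: C_def nn_integral_eq_integral ennreal_mult[symmetric] ennreal_power)
  also have "\<dots> \<le> (\<integral>\<^sup>+x. (ennreal \<bar>f x\<bar>)\<^sup>2 \<partial>M) * (\<integral>\<^sup>+x. (ennreal \<bar>g x\<bar>)\<^sup>2 \<partial>M)"
    by (rule Cauchy_Schwarz_nn_integral) auto
  also have "\<dots> = ennreal ((\<integral>x. (f x)\<^sup>2 \<partial>M) * (\<integral>x. (g x)\<^sup>2 \<partial>M))"
    using f g by (simp add: nn_integral_eq_integral ennreal_mult[symmetric] ennreal_power)
  finally have "C\<^sup>2 \<le> (\<integral>x. (f x)\<^sup>2 \<partial>M) * (\<integral>x. (g x)\<^sup>2 \<partial>M)"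
    by (simp add: ennreal_le_iff)
  then have "C \<le> sqrt (\<integral>x. (f x)\<^sup>2 \<partial>M) * sqrt (\<integral>x. (g x)\<^sup>2 \<partial>M)"
    using real_le_rsqrt real_sqrt_mult by metis
  moreover have "\<bar>\<integral>x. f x * g x \<partial>M\<bar> \<le> C"
    unfolding C_def using integral_norm_bound[of M "\<lambda>x. f x * g x"] by (simp add: abs_mult)
  ultimately show "\<bar>\<integral>x. f x * g x \<partial>M\<bar> \<le> sqrt (\<integral>x. (f x)\<^sup>2 \<partial>M) * sqrt (\<integral>x. (g x)\<^sup>2 \<partial>M)"
    by simp
qed

lemma L2_measurable [measurable_dest]: "f \<in> L2 \<Longrightarrow> f \<in> borel_measurable lebesgue"
  and L2_integrable_sq: "f \<in> L2 \<Longrightarrow> integrable lebesgue (\<lambda>x. (norm (f x))\<^sup>2)"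
  by (auto simp: L2_def)

lemma L2_norm_nonneg [simp]: "0 \<le> L2_norm f"
  by (simp add: L2_norm_def)

lemma L2_norm_sq: "(L2_norm f)\<^sup>2 = (\<integral>x. (norm (f x))\<^sup>2 \<partial>lebesgue)"
  by (simp add: L2_norm_def)

lemma L2_integrable_norm_mult:
  assumes "f \<in> L2" "g \<in> L2"
  shows "integrable lebesgue (\<lambda>x. norm (f x) * norm (g x))"
proof (rule Bochner_Integration.integrable_bound[OF Bochner_Integration.integrable_add[OF L2_integrable_sq[OF assms(1)] L2_integrable_sq[OF assms(2)]]])
  show "AE x in lebesgue. norm (norm (f x) * norm (g x)) \<le> norm ((norm (f x))\<^sup>2 + (norm (g x))\<^sup>2)"
  proof (intro AE_I2)
    fix x
    have "2 * (norm (f x) * norm (g x)) \<le> (norm (f x))\<^sup>2 + (norm (g x))\<^sup>2"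
      using sum_squares_bound[of "norm (f x)" "norm (g x)"] by simp
    then have "norm (f x) * norm (g x) \<le> (norm (f x))\<^sup>2 + (norm (g x))\<^sup>2"
      using mult_nonneg_nonneg[of "norm (f x)" "norm (g x)"] norm_ge_zero[of "f x"] norm_ge_zero[of "g x"] by linarith
    then show "norm (norm (f x) * norm (g x)) \<le> norm ((norm (f x))\<^sup>2 + (norm (g x))\<^sup>2)"
      by simp
  qed
qed (use assms in measurable)

lemma borel_measurable_cnj [measurable (raw)]:
  "f \<in> borel_measurable M \<Longrightarrow> (\<lambda>x. cnj (f x)) \<in> borel_measurable M"
  by (rule borel_measurable_continuous_on[OF continuous_on_cnj[OF continuous_on_id]])

lemma L2_integrable_mult:
  assumes "f \<in> L2" "g \<in> L2"
  shows "integrable lebesgue (\<lambda>x. f x * cnj (g x))"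
  by (rule Bochner_Integration.integrable_bound[OF L2_integrable_norm_mult[OF assms]])
     (use assms in \<open>auto simp: norm_mult\<close>)

lemma L2_lincomb:
  assumes "f \<in> L2" "g \<in> L2"
  shows "(\<lambda>x. f x + c * g x) \<in> L2"
proof -
  have "integrable lebesgue (\<lambda>x. 2 * (norm (f x))\<^sup>2 + 2 * (norm c)\<^sup>2 * (norm (g x))\<^sup>2)"
    by (intro Bochner_Integration.integrable_add integrable_mult_right L2_integrable_sq assms)
  then have "integrable lebesgue (\<lambda>x. (norm (f x + c * g x))\<^sup>2)"
  proof (rule Bochner_Integration.integrable_bound)
    show "AE x in lebesgue. norm ((norm (f x + c * g x))\<^sup>2) \<le> norm (2 * (norm (f x))\<^sup>2 + 2 * (norm c)\<^sup>2 * (norm (g x))\<^sup>2)"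
    proof (intro AE_I2)
      fix x
      have "(norm (f x + c * g x))\<^sup>2 \<le> (norm (f x) + norm c * norm (g x))\<^sup>2"
        by (metis norm_ge_zero norm_mult norm_triangle_ineq power_mono)
      also have "\<dots> \<le> 2 * (norm (f x))\<^sup>2 + 2 * (norm c * norm (g x))\<^sup>2"
        using sum_squares_bound[of "norm (f x)" "norm c * norm (g x)"] unfolding power2_sum by linarith
      finally show "norm ((norm (f x + c * g x))\<^sup>2) \<le> norm (2 * (norm (f x))\<^sup>2 + 2 * (norm c)\<^sup>2 * (norm (g x))\<^sup>2)"
        by (simp add: power_mult_distrib)
    qed
  qed (use assms in measurable)
  then show ?thesis using assms by (auto simp: L2_def)
qed

lemma L2_zero: "(\<lambda>x. 0) \<in> L2"
  by (simp add: L2_def)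

lemma L2_scale: "f \<in> L2 \<Longrightarrow> (\<lambda>x. c * f x) \<in> L2"
  using L2_lincomb[OF L2_zero, of f c] by simp

lemma L2_diff: "f \<in> L2 \<Longrightarrow> g \<in> L2 \<Longrightarrow> f - g \<in> L2"
  using L2_lincomb[of f g "-1"] by (simp add: fun_diff_def)

lemma L2_inner_lincomb_left:
  assumes "f \<in> L2" "g \<in> L2" "h \<in> L2"
  shows "L2_inner (\<lambda>x. f x + c * g x) h = L2_inner f h + c * L2_inner g h"
  using L2_integrable_mult[OF assms(1,3)] L2_integrable_mult[OF assms(2,3)]
  by (simp add: L2_inner_def distrib_right mult.assoc)

lemma L2_inner_cnj: "L2_inner g f = cnj (L2_inner f g)"
proof -
  have "(\<integral>x. cnj (f x * cnj (g x)) \<partial>lebesgue) = cnj (\<integral>x. f x * cnj (g x) \<partial>lebesgue)"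
    by (rule Bochner_Integration.integral_cnj)
  then show ?thesis by (simp add: L2_inner_def mult.commute)
qed

lemma L2_inner_lincomb_right:
  assumes "f \<in> L2" "g \<in> L2" "h \<in> L2"
  shows "L2_inner h (\<lambda>x. f x + c * g x) = L2_inner h f + cnj c * L2_inner h g"
  using L2_inner_lincomb_left[OF assms, of c] L2_inner_cnj[of h] by simp

lemma L2_inner_self: "L2_inner f f = complex_of_real ((L2_norm f)\<^sup>2)"
  unfolding L2_inner_def L2_norm_sq complex_norm_square[symmetric] integral_complex_of_real[symmetric] by simp

lemma L2_inner_diff_left:
  assumes "f \<in> L2" "g \<in> L2" "h \<in> L2"
  shows "L2_inner (f - g) h = L2_inner f h - L2_inner g h"
  using L2_inner_lincomb_left[OF assms, of "-1"] by (simp add: fun_diff_def)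

lemma L2_inner_diff_right:
  assumes "f \<in> L2" "g \<in> L2" "h \<in> L2"
  shows "L2_inner h (f - g) = L2_inner h f - L2_inner h g"
  using L2_inner_lincomb_right[OF assms, of "-1"] by (simp add: fun_diff_def)

lemma L2_Cauchy_Schwarz:
  assumes "f \<in> L2" "g \<in> L2"
  shows "norm (L2_inner f g) \<le> L2_norm f * L2_norm g"
proof -
  have [measurable]: "f \<in> borel_measurable lebesgue" "g \<in> borel_measurable lebesgue"
    using assms by (auto simp: L2_def)
  have "norm (L2_inner f g) \<le> (\<integral>x. norm (f x) * norm (g x) \<partial>lebesgue)"
    unfolding L2_inner_def by (rule order_trans[OF integral_norm_bound]) (simp add: norm_mult)
  also have "\<dots> \<le> L2_norm f * L2_norm g"
    using real_Cauchy_Schwarz_integral(2)[OF _ _ L2_integrable_sq[OF assms(1)] L2_integrable_sq[OF assms(2)]]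
    by (simp add: L2_norm_def)
  finally show ?thesis .
qed

text \<open>With \<open>c\<close> equal to 1 and -1 this yields the parallelogram law, and with
  small \<open>c\<close> the first variation of the distance; the projection lemma uses
  both.\<close>

lemma L2_norm_lincomb_sq:
  assumes "f \<in> L2" "g \<in> L2"
  shows "(L2_norm (\<lambda>x. f x + c * g x))\<^sup>2 =
    (L2_norm f)\<^sup>2 + 2 * Re (cnj c * L2_inner f g) + (norm c)\<^sup>2 * (L2_norm g)\<^sup>2"
proof -
  let ?h = "\<lambda>x. f x + c * g x"
  have h: "?h \<in> L2" using assms by (rule L2_lincomb)
  have "complex_of_real ((L2_norm ?h)\<^sup>2) = L2_inner f ?h + c * L2_inner g ?h"
    unfolding L2_inner_self[symmetric] by (rule L2_inner_lincomb_left[OF assms h])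
  also have "\<dots> = L2_inner f f + cnj c * L2_inner f g + c * (L2_inner g f + cnj c * L2_inner g g)"
    using assms by (simp add: L2_inner_lincomb_right)
  also have "\<dots> = L2_inner f f + (cnj c * L2_inner f g + cnj (cnj c * L2_inner f g)) + (c * cnj c) * L2_inner g g"
    by (simp add: algebra_simps L2_inner_cnj[of g f])
  also have "\<dots> = complex_of_real ((L2_norm f)\<^sup>2 + 2 * Re (cnj c * L2_inner f g) + (norm c)\<^sup>2 * (L2_norm g)\<^sup>2)"
    unfolding complex_add_cnj complex_norm_square[symmetric] L2_inner_self by simp
  finally show ?thesis by (simp only: of_real_eq_iff)
qed

lemma L2_norm_triangle:
  assumes "f \<in> L2" "g \<in> L2"
  shows "L2_norm (\<lambda>x. f x + g x) \<le> L2_norm f + L2_norm g"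
proof (rule power2_le_imp_le)
  have "Re (L2_inner f g) \<le> L2_norm f * L2_norm g"
    using L2_Cauchy_Schwarz[OF assms] complex_Re_le_cmod order_trans by blast
  then show "(L2_norm (\<lambda>x. f x + g x))\<^sup>2 \<le> (L2_norm f + L2_norm g)\<^sup>2"
    using L2_norm_lincomb_sq[OF assms, of 1] by (simp add: power2_sum)
qed simp

lemma L2_norm_scale: "L2_norm (\<lambda>x. c * f x) = norm c * L2_norm f"
  by (simp add: L2_norm_def norm_mult power_mult_distrib real_sqrt_mult)

lemma L2_norm_diff_commute: "L2_norm (f - g) = L2_norm (g - f)"
  by (simp add: L2_norm_def norm_minus_commute)

lemma L2_norm_triangle_diff:
  assumes "f \<in> L2" "g \<in> L2" "h \<in> L2"
  shows "L2_norm (f - h) \<le> L2_norm (f - g) + L2_norm (g - h)"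
  using L2_norm_triangle[OF L2_diff[OF assms(1,2)] L2_diff[OF assms(2,3)]]
  by (simp add: fun_diff_def)

lemma L2_norm_cong_AE:
  assumes "f \<in> borel_measurable lebesgue" "g \<in> borel_measurable lebesgue" "AE x in lebesgue. f x = g x"
  shows "L2_norm f = L2_norm g"
proof -
  have "(\<integral>x. (norm (f x))\<^sup>2 \<partial>lebesgue) = (\<integral>x. (norm (g x))\<^sup>2 \<partial>lebesgue)"
    using assms by (intro integral_cong_AE) auto
  then show ?thesis by (simp add: L2_norm_def)
qed

lemma L2_inner_tendsto_left:
  assumes "\<And>k. f k \<in> L2" "u \<in> L2" "g \<in> L2" "(\<lambda>k. L2_norm (f k - u)) \<longlonglongrightarrow> 0"
  shows "(\<lambda>k. L2_inner (f k) g) \<longlonglongrightarrow> L2_inner u g"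
proof (rule LIM_zero_cancel, rule tendsto_norm_zero_cancel)
  have "(\<lambda>k. L2_norm (f k - u) * L2_norm g) \<longlonglongrightarrow> 0 * L2_norm g"
    using assms(4) by (intro tendsto_intros)
  moreover have "norm (L2_inner (f k) g - L2_inner u g) \<le> L2_norm (f k - u) * L2_norm g" for k
    using L2_Cauchy_Schwarz[OF L2_diff[OF assms(1)[of k] assms(2)] assms(3)]
      L2_inner_diff_left[OF assms(1)[of k] assms(2,3)] by simp
  ultimately show "(\<lambda>k. norm (L2_inner (f k) g - L2_inner u g)) \<longlonglongrightarrow> 0"
    using tendsto_sandwich[of "\<lambda>_. 0" "\<lambda>k. norm (L2_inner (f k) g - L2_inner u g)" sequentially "\<lambda>k. L2_norm (f k - u) * L2_norm g" 0]
    by simp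
qed

lemma L2_inner_tendsto_right:
  assumes "\<And>k. f k \<in> L2" "u \<in> L2" "g \<in> L2" "(\<lambda>k. L2_norm (f k - u)) \<longlonglongrightarrow> 0"
  shows "(\<lambda>k. L2_inner g (f k)) \<longlonglongrightarrow> L2_inner g u"
  using tendsto_cnj[OF L2_inner_tendsto_left[OF assms]] by (simp add: L2_inner_cnj[of g])

section \<open>A criterion for essential self-adjointness\<close>

lemma L2_Fatou:
  assumes f: "\<And>j. f j \<in> L2" and [measurable]: "u \<in> borel_measurable lebesgue"
    and lim: "AE x in lebesgue. (\<lambda>j. f j x) \<longlonglongrightarrow> u x"
    and bd: "\<And>j. L2_norm (f j) \<le> c"
  shows "u \<in> L2" "L2_norm u \<le> c"
proof -
  have [measurable]: "f j \<in> borel_measurable lebesgue" for j using f by (auto simp: L2_def)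
  have c0: "0 \<le> c" using bd[of 0] L2_norm_nonneg order_trans by blast
  have "(\<integral>\<^sup>+x. ennreal ((norm (u x))\<^sup>2) \<partial>lebesgue) = (\<integral>\<^sup>+x. liminf (\<lambda>j. ennreal ((norm (f j x))\<^sup>2)) \<partial>lebesgue)"
  proof (rule nn_integral_cong_AE, use lim in eventually_elim)
    fix x assume "(\<lambda>j. f j x) \<longlonglongrightarrow> u x"
    then have "(\<lambda>j. ennreal ((norm (f j x))\<^sup>2)) \<longlonglongrightarrow> ennreal ((norm (u x))\<^sup>2)"
      by (intro tendsto_intros)
    then show "ennreal ((norm (u x))\<^sup>2) = liminf (\<lambda>j. ennreal ((norm (f j x))\<^sup>2))"
      using lim_imp_Liminf[OF trivial_limit_sequentially] by metis
  qed
  also have "\<dots> \<le> liminf (\<lambda>j. \<integral>\<^sup>+x. ennreal ((norm (f j x))\<^sup>2) \<partial>lebesgue)"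
    by (rule nn_integral_liminf) auto
  also have "\<dots> \<le> liminf (\<lambda>j. ennreal (c\<^sup>2))"
  proof (intro Liminf_mono always_eventually allI)
    fix j
    have "(\<integral>\<^sup>+x. ennreal ((norm (f j x))\<^sup>2) \<partial>lebesgue) = ennreal ((L2_norm (f j))\<^sup>2)"
      unfolding L2_norm_sq by (rule nn_integral_eq_integral[OF L2_integrable_sq[OF f]]) simp
    also have "\<dots> \<le> ennreal (c\<^sup>2)"
      by (intro ennreal_leI power_mono bd L2_norm_nonneg)
    finally show "(\<integral>\<^sup>+x. ennreal ((norm (f j x))\<^sup>2) \<partial>lebesgue) \<le> ennreal (c\<^sup>2)" .
  qed
  also have "\<dots> = ennreal (c\<^sup>2)" by (rule Liminf_const) simp
  finally have le: "(\<integral>\<^sup>+x. ennreal ((norm (u x))\<^sup>2) \<partial>lebesgue) \<le> ennreal (c\<^sup>2)" .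
  have int: "integrable lebesgue (\<lambda>x. (norm (u x))\<^sup>2)"
    by (rule integrableI_bounded) (use le in \<open>auto intro: le_less_trans\<close>)
  then show "u \<in> L2" by (simp add: L2_def)
  have "ennreal ((L2_norm u)\<^sup>2) \<le> ennreal (c\<^sup>2)"
    using le nn_integral_eq_integral[OF int] unfolding L2_norm_sq by simp
  then have "(L2_norm u)\<^sup>2 \<le> c\<^sup>2" by (subst (asm) ennreal_le_iff) auto
  then show "L2_norm u \<le> c" using c0 by (rule power2_le_imp_le)
qed

(* The weights 2^k make the sum of 2^k |f_(k+1) - f_k|^2 integrable, so |f_(k+1) - f_k| decays geometrically at almost every point. *)
lemma L2_fast_Cauchy_AE_convergent:
  assumes d: "\<And>k. f k \<in> L2" and bd: "\<And>k. L2_norm (f (Suc k) - f k) \<le> (1/2) ^ k"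
  shows "AE x in lebesgue. convergent (\<lambda>k. f k x)"
proof -
  have [measurable]: "f j \<in> borel_measurable lebesgue" for j using d by (auto simp: L2_def)
  define D where "D k x = norm (f (Suc k) x - f k x)" for k x
  have dk: "f (Suc k) - f k \<in> L2" for k by (rule L2_diff[OF d d])
  have "(\<integral>\<^sup>+x. (\<Sum>k. ennreal (2 ^ k * (D k x)\<^sup>2)) \<partial>lebesgue) = (\<Sum>k. \<integral>\<^sup>+x. ennreal (2 ^ k * (D k x)\<^sup>2) \<partial>lebesgue)"
    unfolding D_def by (rule nn_integral_suminf) measurable
  also have "\<dots> \<le> (\<Sum>k. ennreal ((1/2) ^ k))"
  proof (rule suminf_le)
    fix k
    have i: "integrable lebesgue (\<lambda>x. (D k x)\<^sup>2)"
      using L2_integrable_sq[OF dk[of k]] by (simp add: D_def)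
    have "(\<integral>\<^sup>+x. ennreal (2 ^ k * (D k x)\<^sup>2) \<partial>lebesgue) = ennreal (2 ^ k * (\<integral>x. (D k x)\<^sup>2 \<partial>lebesgue))"
      using nn_integral_eq_integral[of lebesgue "\<lambda>x. 2 ^ k * (D k x)\<^sup>2"] i by simp
    also have "(\<integral>x. (D k x)\<^sup>2 \<partial>lebesgue) = (L2_norm (f (Suc k) - f k))\<^sup>2"
      by (simp add: L2_norm_sq D_def)
    also have "2 ^ k * (L2_norm (f (Suc k) - f k))\<^sup>2 \<le> 2 ^ k * ((1/2) ^ k)\<^sup>2"
      by (intro mult_left_mono power_mono bd) auto
    also have "2 ^ k * ((1/2) ^ k)\<^sup>2 = (1/2 :: real) ^ k"
      by (simp add: power2_eq_square power_one_over)
    finally show "(\<integral>\<^sup>+x. ennreal (2 ^ k * (D k x)\<^sup>2) \<partial>lebesgue) \<le> ennreal ((1/2) ^ k)"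
      by (simp add: ennreal_leI)
  qed auto
  also have "\<dots> = ennreal (\<Sum>k. (1/2) ^ k)"
    by (rule suminf_ennreal2) (auto simp: summable_geometric)
  finally have "(\<integral>\<^sup>+x. (\<Sum>k. ennreal (2 ^ k * (D k x)\<^sup>2)) \<partial>lebesgue) \<noteq> \<infinity>"
    using ennreal_less_top infinity_ennreal_def le_less_trans by (metis order.irrefl)
  then have "AE x in lebesgue. (\<Sum>k. ennreal (2 ^ k * (D k x)\<^sup>2)) \<noteq> \<infinity>"
    by (intro nn_integral_PInf_AE) (auto simp: D_def)
  then show ?thesis
  proof eventually_elim
    fix x assume fin: "(\<Sum>k. ennreal (2 ^ k * (D k x)\<^sup>2)) \<noteq> \<infinity>"
    define C where "C = enn2real (\<Sum>k. ennreal (2 ^ k * (D k x)\<^sup>2))"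
    have C: "ennreal C = (\<Sum>k. ennreal (2 ^ k * (D k x)\<^sup>2))" "0 \<le> C"
      using fin by (auto simp: C_def top.not_eq_extremum)
    have "D k x \<le> sqrt C * (sqrt (1/2)) ^ k" for k
    proof -
      have "sum (\<lambda>k. ennreal (2 ^ k * (D k x)\<^sup>2)) {k} \<le> ennreal C"
        unfolding C by (rule sum_le_suminf) auto
      then have "2 ^ k * (D k x)\<^sup>2 \<le> C" using C(2) by (simp add: ennreal_le_iff)
      then have "(D k x)\<^sup>2 \<le> C * (1/2) ^ k"
        by (simp add: power_one_over field_simps)
      also have "\<dots> = (sqrt C * (sqrt (1/2)) ^ k)\<^sup>2"
        using C(2) by (simp add: power_mult_distrib power_mult[symmetric] mult.commute[of _ 2] power_mult[of _ 2] real_sqrt_divide power_divide)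
      finally show ?thesis by (rule power2_le_imp_le) (use C(2) in auto)
    qed
    then have "norm (f (Suc k) x - f k x) \<le> sqrt C * (sqrt (1/2)) ^ k" for k
      by (simp add: D_def)
    moreover have "summable (\<lambda>k. sqrt C * (sqrt (1/2)) ^ k)"
      by (intro summable_mult summable_geometric) (use real_sqrt_lt_1_iff[of "1/2"] in simp)
    ultimately have "summable (\<lambda>k. f (Suc k) x - f k x)"
      by (rule summable_comparison_test'[where N = 0, rotated])
    then have "convergent (\<lambda>n. \<Sum>k<n. f (Suc k) x - f k x)"
      by (simp add: summable_iff_convergent)
    then have "convergent (\<lambda>n. f n x - f 0 x)" by (simp add: sum_lessThan_telescope[of "\<lambda>n. f n x"])
    then show "convergent (\<lambda>n. f n x)"
      by (simp add: convergent_diff_const_right_iff)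
  qed
qed

text \<open>A subsequence with geometrically small steps converges almost everywhere. Fatou's lemma,
  applied to the differences of a fixed \<open>f m\<close> with this subsequence, bounds the
  distance from \<open>f m\<close> to the pointwise limit, so the whole sequence converges in
  norm.\<close>

lemma L2_complete:
  assumes f: "\<And>k. f k \<in> L2"
    and cauchy: "\<And>e. 0 < e \<Longrightarrow> \<exists>M. \<forall>m\<ge>M. \<forall>n\<ge>M. L2_norm (f m - f n) < e"
  obtains u where "u \<in> L2" "(\<lambda>k. L2_norm (f k - u)) \<longlonglongrightarrow> 0"
proof -
  have [measurable]: "f j \<in> borel_measurable lebesgue" for j using f by (auto simp: L2_def)
  have "\<forall>k. \<exists>M. \<forall>m\<ge>M. \<forall>n\<ge>M. L2_norm (f m - f n) < (1/2) ^ k"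
    using cauchy by simp
  then obtain N where N: "\<And>k m n. m \<ge> N k \<Longrightarrow> n \<ge> N k \<Longrightarrow> L2_norm (f m - f n) < (1/2) ^ k"
    by metis
  \<comment> \<open>Summing the thresholds makes \<open>r\<close> nondecreasing with
    \<open>r k\<close> at least \<open>N k\<close>; consecutive terms of the subsequence then differ
    by less than \<open>(1/2) ^ k\<close>.\<close>
  define r where "r k = (\<Sum>i\<le>k. N i) + k" for k
  have rN: "r k \<ge> N k" for k
    using member_le_sum[of k "{..k}" N] by (simp add: r_def trans_le_add1)
  have rS: "r (Suc k) \<ge> r k" for k by (simp add: r_def)
  have "AE x in lebesgue. convergent (\<lambda>k. f (r k) x)"
  proof (rule L2_fast_Cauchy_AE_convergent[OF f])
    show "L2_norm (f (r (Suc k)) - f (r k)) \<le> (1/2) ^ k" for k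
      using N[of k "r (Suc k)" "r k"] rN[of k] rS[of k] by simp
  qed
  then have conv: "AE x in lebesgue. (\<lambda>k. f (r k) x) \<longlonglongrightarrow> lim (\<lambda>k. f (r k) x)"
    by (simp add: convergent_LIMSEQ_iff)
  define u where "u x = lim (\<lambda>k. f (r k) x)" for x
  have [measurable]: "u \<in> borel_measurable lebesgue"
    unfolding u_def by measurable
  have key: "f m - u \<in> L2 \<and> L2_norm (f m - u) \<le> (1/2) ^ k" if "m \<ge> N k" for m k
  proof -
    have *: "AE x in lebesgue. (\<lambda>j. (f m - f (r (j + k))) x) \<longlonglongrightarrow> (f m - u) x"
      using conv
    proof eventually_elim
      fix x assume "(\<lambda>k. f (r k) x) \<longlonglongrightarrow> lim (\<lambda>k. f (r k) x)"
      then have "(\<lambda>j. f (r (j + k)) x) \<longlonglongrightarrow> u x"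
        unfolding u_def by (rule LIMSEQ_ignore_initial_segment)
      then show "(\<lambda>j. (f m - f (r (j + k))) x) \<longlonglongrightarrow> (f m - u) x"
        by (auto intro!: tendsto_intros)
    qed
    have "r (j + k) \<ge> N k" for j
      using rN[of k] lift_Suc_mono_le[of r k "j + k", OF rS] by simp
    then have **: "L2_norm (f m - f (r (j + k))) \<le> (1/2) ^ k" for j
      using N[of k m] that less_imp_le by blast
    have "f m - u \<in> borel_measurable lebesgue"
      by (simp add: fun_diff_def)
    from L2_Fatou[OF L2_diff[OF f f] this * **] show ?thesis by blast
  qed
  have "f (N 0) - (f (N 0) - u) \<in> L2" using key[of 0 "N 0"] f by (simp add: L2_diff del: minus_apply)
  moreover have "f (N 0) - (f (N 0) - u) = u" by auto
  ultimately have "u \<in> L2" by simp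
  moreover have "(\<lambda>k. L2_norm (f k - u)) \<longlonglongrightarrow> 0"
  proof (rule LIMSEQ_I)
    fix e :: real assume "0 < e"
    then obtain k where "(1/2) ^ k < e" using real_arch_pow_inv[of e "1/2"] by auto
    then show "\<exists>no. \<forall>n\<ge>no. norm (L2_norm (f n - u) - 0) < e"
      using key[where k = k] by (intro exI[of _ "N k"]) (auto intro: le_less_trans)
  qed
  ultimately show ?thesis by (rule that)
qed


text \<open>\<open>R\<close> is a subspace that may fail to be closed, so the projection
  \<open>p\<close> of \<open>f\<close> belongs to its closure and comes with a minimising sequence
  \<open>r\<close> inside \<open>R\<close>. This sequence will supply the approximating elements of
  the operator domain.\<close>

lemma L2_projection:
  assumes R: "R \<subseteq> L2" "R \<noteq> {}" and lin: "\<And>v w c. v \<in> R \<Longrightarrow> w \<in> R \<Longrightarrow> (\<lambda>x. v x + c * w x) \<in> R"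
    and f: "f \<in> L2"
  obtains r p where "\<And>k::nat. r k \<in> R" "p \<in> L2" "(\<lambda>k. L2_norm (r k - p)) \<longlonglongrightarrow> 0"
    "\<And>w. w \<in> R \<Longrightarrow> L2_inner w (f - p) = 0"
proof -
  define d where "d = (INF v\<in>R. L2_norm (f - v))"
  have bb: "bdd_below ((\<lambda>v. L2_norm (f - v)) ` R)" by (intro bdd_belowI[of _ 0]) auto
  have d0: "0 \<le> d" unfolding d_def using R(2) by (intro cINF_greatest) auto
  have dle: "d \<le> L2_norm (f - v)" if "v \<in> R" for v
    unfolding d_def by (rule cINF_lower[OF bb that])
  have "\<exists>v\<in>R. L2_norm (f - v) < d + inverse (real (Suc k))" for k
    using cINF_less_iff[OF R(2) bb, of "d + inverse (real (Suc k))"] by (simp add: d_def)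
  then obtain r where r: "\<And>k. r k \<in> R" "\<And>k. L2_norm (f - r k) < d + inverse (real (Suc k))"
    by metis
  have rL: "r k \<in> L2" for k using r(1) R(1) by blast
  have fr: "f - r k \<in> L2" for k using f rL by (rule L2_diff)
  have "(\<lambda>k. d + inverse (real (Suc k))) \<longlonglongrightarrow> d + 0"
    by (intro tendsto_intros LIMSEQ_inverse_real_of_nat)
  then have lim: "(\<lambda>k. L2_norm (f - r k)) \<longlonglongrightarrow> d"
    using tendsto_sandwich[of "\<lambda>_. d" "\<lambda>k. L2_norm (f - r k)" sequentially "\<lambda>k. d + inverse (real (Suc k))" d]
      r dle by (simp add: less_imp_le)
  have par: "(L2_norm (r m - r n))\<^sup>2 \<le> 2 * ((L2_norm (f - r m))\<^sup>2 - d\<^sup>2) + 2 * ((L2_norm (f - r n))\<^sup>2 - d\<^sup>2)" for m n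
  proof -
    let ?a = "f - r m" and ?b = "f - r n"
    \<comment> \<open>The midpoint of \<open>r m\<close> and \<open>r n\<close>, written with the
      single closure operation that \<open>R\<close> is assumed to have, is at distance at least
      \<open>d\<close> from \<open>f\<close>; the parallelogram law turns this into the Cauchy
      property.\<close>
    have half: "(\<lambda>x. r m x + (1/2) * (\<lambda>x. r n x + (-1) * r m x) x) \<in> R"
      using r(1) by (intro lin)
    have "f - (\<lambda>x. r m x + (1/2) * (r n x + (-1) * r m x)) = (\<lambda>x. (1/2) * (?a x + 1 * ?b x))"
      by (auto simp: fun_eq_iff field_simps)
    then have "d \<le> 1/2 * L2_norm (\<lambda>x. ?a x + 1 * ?b x)"
      using dle[OF half] L2_norm_scale[of "1/2" "\<lambda>x. ?a x + 1 * ?b x"] by simp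
    then have "(2 * d)\<^sup>2 \<le> (L2_norm (\<lambda>x. ?a x + 1 * ?b x))\<^sup>2"
      using d0 by (intro power_mono) auto
    moreover have "r m - r n = (\<lambda>x. ?b x + (-1) * ?a x)" by auto
    ultimately show ?thesis
      using L2_norm_lincomb_sq[OF fr[of m] fr[of n], of 1] L2_norm_lincomb_sq[OF fr[of n] fr[of m], of "-1"]
        L2_inner_cnj[of "f - r m" "f - r n"]
      by (simp add: power_mult_distrib)
  qed
  have cauchy: "\<exists>M. \<forall>m\<ge>M. \<forall>n\<ge>M. L2_norm (r m - r n) < e" if "0 < e" for e
  proof -
    have "(\<lambda>k. (L2_norm (f - r k))\<^sup>2) \<longlonglongrightarrow> d\<^sup>2"
      using lim by (intro tendsto_intros)
    then have "eventually (\<lambda>k. (L2_norm (f - r k))\<^sup>2 < d\<^sup>2 + e\<^sup>2 / 4) sequentially"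
      by (rule order_tendstoD) (use that in simp)
    then obtain M where M: "\<And>k. k \<ge> M \<Longrightarrow> (L2_norm (f - r k))\<^sup>2 < d\<^sup>2 + e\<^sup>2 / 4"
      by (auto simp: eventually_sequentially)
    have "L2_norm (r m - r n) < e" if "m \<ge> M" "n \<ge> M" for m n
    proof -
      have "(L2_norm (r m - r n))\<^sup>2 < e\<^sup>2"
      proof -
        have *: "2 * (X - D) + 2 * (Y - D) < E" if "X < D + E / 4" "Y < D + E / 4" for X Y D E :: real
          using that by (simp add: field_simps)
        show ?thesis
          using le_less_trans[OF par[of m n] *[OF M[OF that(1)] M[OF that(2)]]] .
      qed
      then show ?thesis using \<open>0 < e\<close> by (auto intro: power2_less_imp_less)
    qed
    then show ?thesis by blast
  qed
  obtain p where p: "p \<in> L2" "(\<lambda>k. L2_norm (r k - p)) \<longlonglongrightarrow> 0"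
    using L2_complete[OF rL cauchy] by blast
  \<comment> \<open>As \<open>p\<close> may lie outside \<open>R\<close>, the lower bound
    \<open>d\<close> is first used for \<open>r k - c * w\<close> and then passed to the
    limit.\<close>
  have min: "d \<le> L2_norm (\<lambda>x. (f - p) x + c * w x)" if w: "w \<in> R" for c w
  proof -
    have wL: "w \<in> L2" using w R by blast
    let ?v = "\<lambda>k x. r k x + (- c) * w x"
    have "d \<le> L2_norm (\<lambda>x. (f - p) x + c * w x) + L2_norm (r k - p)" for k
    proof -
      have "d \<le> L2_norm (f - ?v k)" by (intro dle lin r(1) w)
      also have "f - ?v k = (\<lambda>x. (\<lambda>x. (f - p) x + c * w x) x + (p - r k) x)"
        by (auto simp: fun_eq_iff)
      also have "L2_norm \<dots> \<le> L2_norm (\<lambda>x. (f - p) x + c * w x) + L2_norm (p - r k)"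
        by (intro L2_norm_triangle L2_lincomb L2_diff f p(1) wL rL)
      finally show ?thesis by (simp only: L2_norm_diff_commute[of p])
    qed
    moreover have "(\<lambda>k. L2_norm (\<lambda>x. (f - p) x + c * w x) + L2_norm (r k - p)) \<longlonglongrightarrow> L2_norm (\<lambda>x. (f - p) x + c * w x) + 0"
      by (intro tendsto_intros p(2))
    ultimately show ?thesis
      using LIMSEQ_le_const[of _ _ d] by force
  qed
  have fpd: "L2_norm (f - p) \<le> d"
  proof -
    have "L2_norm (f - p) \<le> L2_norm (f - r k) + L2_norm (r k - p)" for k
      by (rule L2_norm_triangle_diff[OF f rL p(1)])
    moreover have "(\<lambda>k. L2_norm (f - r k) + L2_norm (r k - p)) \<longlonglongrightarrow> d + 0"
      by (intro tendsto_intros lim p(2))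
    ultimately show ?thesis using LIMSEQ_le_const[of _ _ "L2_norm (f - p)"] by force
  qed
  have orth: "L2_inner w (f - p) = 0" if w: "w \<in> R" for w
  proof (rule ccontr)
    have wL: "w \<in> L2" using w R by blast
    define z where "z = L2_inner (f - p) w"
    assume "L2_inner w (f - p) \<noteq> 0"
    then have z: "(norm z)\<^sup>2 > 0" by (simp add: z_def L2_inner_cnj[of w])
    \<comment> \<open>The optimal step would be the inverse of the squared norm of \<open>w\<close>.
      The added 1 keeps it finite for \<open>w\<close> of norm 0 and still leaves
      \<open>2 - t * (L2_norm w)\<^sup>2\<close> positive.\<close>
    define t where "t = inverse ((L2_norm w)\<^sup>2 + 1)"
    have pos: "(L2_norm w)\<^sup>2 + 1 > 0" by (simp add: add_nonneg_pos)
    have t: "t > 0" "t * (L2_norm w)\<^sup>2 < 1"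
      using pos by (auto simp: t_def field_simps)
    define c where "c = - (complex_of_real t * z)"
    have "cnj c * z = - complex_of_real (t * (norm z)\<^sup>2)"
      using complex_norm_square[of z] by (simp add: c_def mult.commute mult.left_commute)
    then have re: "Re (cnj c * z) = - (t * (norm z)\<^sup>2)" by simp
    have nc: "(norm c)\<^sup>2 = t\<^sup>2 * (norm z)\<^sup>2"
      using t by (simp add: c_def norm_mult power_mult_distrib)
    have "d\<^sup>2 \<le> (L2_norm (\<lambda>x. (f - p) x + c * w x))\<^sup>2"
      by (intro power_mono min w d0)
    also have "\<dots> = (L2_norm (f - p))\<^sup>2 + 2 * Re (cnj c * z) + (norm c)\<^sup>2 * (L2_norm w)\<^sup>2"
      unfolding z_def by (rule L2_norm_lincomb_sq[OF L2_diff[OF f p(1)] wL])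
    also have "\<dots> = (L2_norm (f - p))\<^sup>2 - t * (norm z)\<^sup>2 * (2 - t * (L2_norm w)\<^sup>2)"
      unfolding re nc by (simp add: algebra_simps power2_eq_square)
    also have "\<dots> < (L2_norm (f - p))\<^sup>2"
      using z t by (simp add: zero_less_mult_iff)
    also have "\<dots> \<le> d\<^sup>2" by (intro power_mono fpd) simp
    finally show False by simp
  qed
  show ?thesis by (rule that[OF r(1) p orth])
qed

text \<open>Passing to the closure does not change the adjoint, because both sides of the defining
  identity are continuous in the graph element.\<close>

lemma graph_closure_symmetric_adjoint:
  assumes S: "S \<subseteq> L2 \<times> L2" and gh: "(g, h) \<in> graph_adjoint S"
  shows "(g, h) \<in> graph_adjoint (graph_closure S)"
proof -
  have gL: "g \<in> L2" "h \<in> L2" and eq: "\<And>u v. (u, v) \<in> S \<Longrightarrow> L2_inner v g = L2_inner u h"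
    using gh by (auto simp: graph_adjoint_def)
  have "L2_inner v g = L2_inner u h" if uvS: "(u, v) \<in> graph_closure S" for u v
  proof -
    obtain s where s: "\<And>k. s k \<in> S" "(\<lambda>k. L2_norm (fst (s k) - u)) \<longlonglongrightarrow> 0" "(\<lambda>k. L2_norm (snd (s k) - v)) \<longlonglongrightarrow> 0"
      and uv: "u \<in> L2" "v \<in> L2"
      using uvS unfolding graph_closure_def by blast
    have sL: "fst (s k) \<in> L2" "snd (s k) \<in> L2" for k
      using s(1)[of k] S by (auto simp: mem_Times_iff)
    have "(\<lambda>k. L2_inner (snd (s k)) g) \<longlonglongrightarrow> L2_inner v g"
      by (rule L2_inner_tendsto_left) (use sL uv gL s in auto)
    moreover have "(\<lambda>k. L2_inner (fst (s k)) h) \<longlonglongrightarrow> L2_inner u h"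
      by (rule L2_inner_tendsto_left) (use sL uv gL s in auto)
    moreover have "L2_inner (snd (s k)) g = L2_inner (fst (s k)) h" for k
      using eq[of "fst (s k)" "snd (s k)"] s(1)[of k] by simp
    ultimately show ?thesis using LIMSEQ_unique by simp
  qed
  then show ?thesis using gL by (auto simp: graph_adjoint_def)
qed

lemma L2_norm_diff_self [simp]: "L2_norm (f - f) = 0"
  by (simp add: L2_norm_def)

lemma graph_closure_self:
  assumes "S \<subseteq> L2 \<times> L2" shows "S \<subseteq> graph_closure S"
proof
  fix z assume z: "z \<in> S"
  then show "z \<in> graph_closure S"
    using z assms unfolding graph_closure_def by (auto intro!: exI[of _ "\<lambda>_. z"] simp del: minus_apply)
qed

text \<open>If the closure is self-adjoint, it coincides with the adjoint of the original graph, and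
  pairing two elements of the adjoint gives the symmetry relation. Two elements violating it
  therefore refute essential self-adjointness.\<close>

lemma essentially_self_adjoint_adjoint_symmetric:
  assumes esa: "essentially_self_adjoint T D" and S: "op_graph T D \<subseteq> L2 \<times> L2"
    and 1: "(g, h) \<in> graph_adjoint (op_graph T D)" and 2: "(g', h') \<in> graph_adjoint (op_graph T D)"
  shows "L2_inner h' g = L2_inner g' h"
proof -
  have eq: "graph_closure (op_graph T D) = graph_adjoint (graph_closure (op_graph T D))"
    using esa by (simp add: essentially_self_adjoint_def self_adjoint_graph_def)
  have "(g, h) \<in> graph_adjoint (graph_closure (op_graph T D))"
    by (rule graph_closure_symmetric_adjoint[OF S 1])
  moreover have "(g', h') \<in> graph_closure (op_graph T D)"
    by (subst eq) (rule graph_closure_symmetric_adjoint[OF S 2])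
  ultimately show ?thesis by (auto simp: graph_adjoint_def)
qed

text \<open>Symmetry puts the closure inside its adjoint. Conversely, for \<open>(g, h)\<close> in
  the adjoint the vector \<open>h + b g\<close> is a limit of values of \<open>T + b\<close> on
  \<open>D\<close>; by coercivity the preimages converge, and their limit must be \<open>g\<close>.
  The kernel condition enters twice: for the density of the range and for the identification of the
  limit.\<close>

lemma essentially_self_adjointI:
  fixes T :: "(real^'n::finite \<Rightarrow> complex) \<Rightarrow> real^'n \<Rightarrow> complex" and b :: real
  assumes D: "\<And>u. u \<in> D \<Longrightarrow> u \<in> L2" "\<And>u. u \<in> D \<Longrightarrow> T u \<in> L2" "D \<noteq> {}"
    and linD: "\<And>u v c. u \<in> D \<Longrightarrow> v \<in> D \<Longrightarrow> (\<lambda>x. u x + c * v x) \<in> D"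
    and linT: "\<And>u v c. u \<in> D \<Longrightarrow> v \<in> D \<Longrightarrow> T (\<lambda>x. u x + c * v x) = (\<lambda>x. T u x + c * T v x)"
    and sym: "\<And>u v. u \<in> D \<Longrightarrow> v \<in> D \<Longrightarrow> L2_inner (T u) v = L2_inner u (T v)"
    and b: "b > 0" and coer: "\<And>u. u \<in> D \<Longrightarrow> 0 \<le> Re (L2_inner (T u) u)"
    and ker: "\<And>g. g \<in> L2 \<Longrightarrow> (\<And>u. u \<in> D \<Longrightarrow> L2_inner (\<lambda>x. T u x + complex_of_real b * u x) g = 0) \<Longrightarrow> AE x in lebesgue. g x = 0"
  shows "essentially_self_adjoint T D"
proof -
  let ?S = "op_graph T D" and ?b = "complex_of_real b"
  define A where "A u = (\<lambda>x. T u x + ?b * u x)" for u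
  have SL: "?S \<subseteq> L2 \<times> L2" using D by (auto simp: op_graph_def)
  have AL: "A u \<in> L2" if "u \<in> D" for u
    unfolding A_def by (intro L2_lincomb D that)
  have Alin: "A (\<lambda>x. u x + c * v x) = (\<lambda>x. A u x + c * A v x)" if "u \<in> D" "v \<in> D" for u v c
    by (simp add: A_def linT[OF that] algebra_simps)
  \<comment> \<open>Coercivity as a lower norm bound: it turns convergence of the images into a
    Cauchy property of the preimages \<open>U k\<close>.\<close>
  have Abd: "b * L2_norm u \<le> L2_norm (A u)" if u: "u \<in> D" for u
  proof -
    have "b * (L2_norm u)\<^sup>2 \<le> Re (L2_inner (A u) u)"
      using coer[OF u] L2_inner_lincomb_left[OF D(2)[OF u] D(1)[OF u] D(1)[OF u], of ?b]
      by (simp add: A_def L2_inner_self)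
    also have "\<dots> \<le> L2_norm (A u) * L2_norm u"
      using L2_Cauchy_Schwarz[OF AL[OF u] D(1)[OF u]] complex_Re_le_cmod order_trans by blast
    finally have "(b * L2_norm u) * L2_norm u \<le> L2_norm (A u) * L2_norm u"
      by (simp add: power2_eq_square)
    then show ?thesis
      using L2_norm_nonneg[of u] L2_norm_nonneg[of "A u"] mult_right_le_imp_le[of "b * L2_norm u" "L2_norm u" "L2_norm (A u)"]
      by (cases "L2_norm u = 0") auto
  qed
  have sub: "graph_closure ?S \<subseteq> graph_adjoint (graph_closure ?S)"
  proof clarify
    fix u v assume uv: "(u, v) \<in> graph_closure ?S"
    have uvL: "u \<in> L2" "v \<in> L2" using uv by (auto simp: graph_closure_def)
    have "(u, v) \<in> graph_adjoint ?S"
    proof -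
      have "L2_inner (T w) u = L2_inner w v" if w: "w \<in> D" for w
      proof -
        have "(w, T w) \<in> graph_adjoint ?S" using w D sym by (auto simp: op_graph_def graph_adjoint_def)
        then have "(w, T w) \<in> graph_adjoint (graph_closure ?S)"
          by (rule graph_closure_symmetric_adjoint[OF SL])
        then have "L2_inner v w = L2_inner u (T w)" using uv by (auto simp: graph_adjoint_def)
        then show ?thesis by (metis L2_inner_cnj)
      qed
      then show ?thesis using uvL by (auto simp: graph_adjoint_def op_graph_def)
    qed
    then show "(u, v) \<in> graph_adjoint (graph_closure ?S)"
      by (rule graph_closure_symmetric_adjoint[OF SL])
  qed
  have sup: "(g, h) \<in> graph_closure ?S" if "(g, h) \<in> graph_adjoint (graph_closure ?S)" for g h
  proof -
    have gh: "g \<in> L2" "h \<in> L2" using that by (auto simp: graph_adjoint_def)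
    have adj: "L2_inner (T w) g = L2_inner w h" if w: "w \<in> D" for w
    proof -
      have "(w, T w) \<in> graph_closure ?S"
        using graph_closure_self[OF SL] w by (auto simp: op_graph_def)
      then show ?thesis using \<open>(g, h) \<in> _\<close> by (auto simp: graph_adjoint_def)
    qed
    define f where "f = (\<lambda>x. h x + ?b * g x)"
    have fL: "f \<in> L2" unfolding f_def using gh by (intro L2_lincomb)
    have RL: "A ` D \<subseteq> L2" "A ` D \<noteq> {}" using AL D(3) by auto
    have Rlin: "(\<lambda>x. v x + c * w x) \<in> A ` D" if vw: "v \<in> A ` D" "w \<in> A ` D" for v w c
    proof -
      obtain v' w' where v'w': "v' \<in> D" "w' \<in> D" and eq: "v = A v'" "w = A w'" using vw by blast
      have "A (\<lambda>x. v' x + c * w' x) \<in> A ` D" by (rule imageI[OF linD[OF v'w']])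
      then show ?thesis unfolding Alin[OF v'w'] eq .
    qed
    obtain r p where r: "\<And>k::nat. r k \<in> A ` D" and p: "p \<in> L2" "(\<lambda>k. L2_norm (r k - p)) \<longlonglongrightarrow> 0"
      and orth: "\<And>w. w \<in> A ` D \<Longrightarrow> L2_inner w (f - p) = 0"
      by (rule L2_projection[OF RL _ fL]) (erule (1) Rlin, rule that)
    \<comment> \<open>\<open>f - p\<close> is orthogonal to the range of \<open>T + b\<close> and
      hence vanishes; so \<open>f\<close> itself is the limit of the \<open>r k\<close>.\<close>
    have "AE x in lebesgue. (f - p) x = 0"
      by (rule ker[OF L2_diff[OF fL p(1)]]) (use orth A_def in auto)
    then have fp: "AE x in lebesgue. f x = p x" by simp
    have "\<forall>k. \<exists>u. u \<in> D \<and> r k = A u" using r by blast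
    from choice[OF this] obtain U where U0: "\<forall>k. U k \<in> D \<and> r k = A (U k)" ..
    have U: "U k \<in> D" "r k = A (U k)" for k using U0 by simp_all
    have rL: "r k \<in> L2" for k using r RL by blast
    have limf: "(\<lambda>k. L2_norm (r k - f)) \<longlonglongrightarrow> 0"
    proof -
      have "L2_norm (r k - f) = L2_norm (r k - p)" for k
        
      proof (rule L2_norm_cong_AE)
        show "AE x in lebesgue. (r k - f) x = (r k - p) x" using fp by eventually_elim simp
      qed (use L2_diff[OF rL fL] L2_diff[OF rL p(1)] in \<open>auto simp: L2_def\<close>)
      then show ?thesis using p(2) by simp
    qed
    have UL: "U k \<in> L2" for k using U D by blast
    have diffU: "b * L2_norm (U m - U n) \<le> L2_norm (r m - r n)" for m n
    proof -
      have e: "(\<lambda>x. U m x + (-1) * U n x) = U m - U n" "(\<lambda>x. r m x + (-1) * r n x) = r m - r n" by auto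
      show ?thesis
        using Abd[OF linD[OF U(1)[of m] U(1)[of n], of "-1"]] Alin[OF U(1)[of m] U(1)[of n], of "-1"]
        unfolding U(2)[symmetric] e by simp
    qed
    have cauchy: "\<exists>M. \<forall>m\<ge>M. \<forall>n\<ge>M. L2_norm (U m - U n) < e" if e: "0 < e" for e
    proof -
      have "eventually (\<lambda>k. L2_norm (r k - f) < b * e / 2) sequentially"
        by (rule order_tendstoD[OF limf]) (use b e in simp)
      then obtain M where M: "\<And>k. k \<ge> M \<Longrightarrow> L2_norm (r k - f) < b * e / 2"
        by (auto simp: eventually_sequentially)
      have "L2_norm (U m - U n) < e" if mn: "m \<ge> M" "n \<ge> M" for m n
      proof -
        have "L2_norm (r m - r n) \<le> L2_norm (r m - f) + L2_norm (f - r n)"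
          by (rule L2_norm_triangle_diff[OF rL fL rL])
        then have "b * L2_norm (U m - U n) < b * e"
          using M[OF mn(1)] M[OF mn(2)] diffU[of m n] L2_norm_diff_commute[of f "r n"] by linarith
        then show ?thesis using b by simp
      qed
      then show ?thesis by blast
    qed
    obtain u where u: "u \<in> L2" "(\<lambda>k. L2_norm (U k - u)) \<longlonglongrightarrow> 0"
      using L2_complete[OF UL cauchy] by blast
    \<comment> \<open>Both \<open>g\<close> and the limit \<open>u\<close> of the preimages solve
      the adjoint equation with right-hand side \<open>f\<close>, so their difference is orthogonal
      to the range.\<close>
    have "AE x in lebesgue. (g - u) x = 0"
    proof (rule ker[OF L2_diff[OF gh(1) u(1)]])
      fix w assume w: "w \<in> D"
      have wL: "w \<in> L2" "T w \<in> L2" using w D by auto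
      have "(\<lambda>k. L2_inner (A w) (U k)) \<longlonglongrightarrow> L2_inner (A w) u"
        by (rule L2_inner_tendsto_right[OF UL u(1) AL[OF w] u(2)])
      moreover have "(\<lambda>k. L2_inner w (r k)) \<longlonglongrightarrow> L2_inner w f"
        by (rule L2_inner_tendsto_right[OF rL fL wL(1) limf])
      moreover have "L2_inner (A w) (U k) = L2_inner w (r k)" for k
        unfolding U(2) A_def
        by (simp add: L2_inner_lincomb_left[OF wL(2,1) UL] L2_inner_lincomb_right[OF D(2)[OF U(1)] UL wL(1)] sym[OF w U(1)])
      ultimately have "L2_inner (A w) u = L2_inner w f" using LIMSEQ_unique by simp
      moreover have "L2_inner (A w) g = L2_inner w f"
        unfolding f_def A_def
        by (simp add: L2_inner_lincomb_left[OF wL(2,1) gh(1)] L2_inner_lincomb_right[OF gh(2,1) wL(1)] adj[OF w])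
      ultimately show "L2_inner (\<lambda>x. T w x + ?b * w x) (g - u) = 0"
        using L2_inner_diff_right[OF gh(1) u(1) AL[OF w]] by (simp add: A_def)
    qed
    then have gu: "AE x in lebesgue. g x = u x" by simp
    have limU: "(\<lambda>k. L2_norm (U k - g)) \<longlonglongrightarrow> 0"
    proof -
      have "L2_norm (U k - g) = L2_norm (U k - u)" for k
        
      proof (rule L2_norm_cong_AE)
        show "AE x in lebesgue. (U k - g) x = (U k - u) x" using gu by eventually_elim simp
      qed (use L2_diff[OF UL gh(1)] L2_diff[OF UL u(1)] in \<open>auto simp: L2_def\<close>)
      then show ?thesis using u(2) by simp
    qed
    have "(\<lambda>k. L2_norm (T (U k) - h)) \<longlonglongrightarrow> 0"
    proof (rule tendsto_sandwich[of "\<lambda>_. 0" _ _ "\<lambda>k. L2_norm (r k - f) + b * L2_norm (U k - g)"])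
      have "L2_norm (T (U k) - h) \<le> L2_norm (r k - f) + b * L2_norm (U k - g)" for k
      proof -
        have "T (U k) - h = (\<lambda>x. (r k - f) x + (- ?b * (U k - g) x))"
          by (auto simp: U(2) A_def f_def fun_eq_iff algebra_simps)
        then have "L2_norm (T (U k) - h) \<le> L2_norm (r k - f) + L2_norm (\<lambda>x. - ?b * (U k - g) x)"
          using L2_norm_triangle[OF L2_diff[OF rL fL] L2_scale[OF L2_diff[OF UL gh(1)]], of k "- ?b" k] by (simp only:)
        moreover have "L2_norm (\<lambda>x. - ?b * (U k - g) x) = b * L2_norm (U k - g)"
          using L2_norm_scale[of "- ?b" "U k - g"] b by (simp del: minus_apply)
        ultimately show ?thesis by (simp only:)
      qed
      then show "\<forall>\<^sub>F k in sequentially. L2_norm (T (U k) - h) \<le> L2_norm (r k - f) + b * L2_norm (U k - g)" by simp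
      show "(\<lambda>k. L2_norm (r k - f) + b * L2_norm (U k - g)) \<longlonglongrightarrow> 0"
        using tendsto_add[OF limf tendsto_mult_left[OF limU, of b]] by simp
    qed auto
    moreover have "\<forall>k. (U k, T (U k)) \<in> ?S"
      using U(1) by (auto simp: op_graph_def)
    ultimately have "\<exists>s. (\<forall>k. s k \<in> ?S) \<and> (\<lambda>k. L2_norm (fst (s k) - g)) \<longlonglongrightarrow> 0
        \<and> (\<lambda>k. L2_norm (snd (s k) - h)) \<longlonglongrightarrow> 0"
      using limU by (intro exI[of _ "\<lambda>k. (U k, T (U k))"]) (simp only: fst_conv snd_conv simp_thms)
    then show ?thesis using gh unfolding graph_closure_def by blast
  qed
  show ?thesis
    unfolding essentially_self_adjoint_def self_adjoint_graph_def using sub sup by auto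
qed

section \<open>Smooth bump functions\<close>

lemma power_div_fact_le_exp:
  fixes x :: real
  assumes "0 \<le> x"
  shows "x ^ n / fact n \<le> exp x"
proof -
  have "(\<Sum>k\<in>{n}. x ^ k /\<^sub>R fact k) \<le> (\<Sum>k. x ^ k /\<^sub>R fact k)"
    using assms sums_summable[OF exp_converges[of x]] by (intro sum_le_suminf) auto
  also have "\<dots> = exp x" using exp_converges[of x] by (rule sums_unique[symmetric])
  finally show ?thesis by (simp add: divide_inverse mult.commute)
qed

text \<open>Carrying a polynomial and a power of \<open>1 - t\<^sup>2\<close> in the denominator
  makes the family closed under differentiation. One derivative formula then gives smoothness of
  every order.\<close>

definition bump :: "real poly \<Rightarrow> nat \<Rightarrow> real \<Rightarrow> real" where
  "bump p m t = (if \<bar>t\<bar> < 1 then poly p t / (1 - t\<^sup>2) ^ m * exp (- (1 / (1 - t\<^sup>2))) else 0)"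

text \<open>The exponential beats every power of the denominator. The remaining factor
  \<open>(1 - t\<^sup>2)\<^sup>2\<close> is what makes the function differentiable with derivative 0
  at both endpoints.\<close>

lemma bump_bound: obtains C where "C \<ge> 0" "\<And>t. \<bar>bump p m t\<bar> \<le> C * (1 - t\<^sup>2)\<^sup>2"
proof -
  have "compact (poly p ` {-1..1})"
    by (intro compact_continuous_image continuous_intros) auto
  then obtain B where B: "B > 0" "\<And>t. t \<in> {-1..1} \<Longrightarrow> \<bar>poly p t\<bar> \<le> B"
    using compact_imp_bounded by (force simp: bounded_pos)
  define C where "C = B * fact (m + 2)"
  have "\<bar>bump p m t\<bar> \<le> C * (1 - t\<^sup>2)\<^sup>2" for t
  proof (cases "\<bar>t\<bar> < 1")
    case True
    define q where "q = 1 - t\<^sup>2"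
    have q: "q > 0" using True by (simp add: q_def abs_square_less_1)
    have "(1 / q) ^ (m + 2) / fact (m + 2) \<le> exp (1 / q)"
      using q by (intro power_div_fact_le_exp) simp
    then have "1 \<le> exp (1 / q) * (fact (m + 2) * q ^ (m + 2))"
      using q by (simp add: power_divide pos_divide_le_eq mult.commute mult.left_commute del: power_add fact_Suc power_Suc add_2_eq_Suc')
    then have e: "exp (- (1 / q)) \<le> fact (m + 2) * q ^ (m + 2)"
      by (simp add: exp_minus field_simps del: power_add fact_Suc power_Suc add_2_eq_Suc')
    have "\<bar>bump p m t\<bar> = \<bar>poly p t\<bar> / q ^ m * exp (- (1 / q))"
      using True q by (simp add: bump_def q_def[symmetric] abs_mult)
    also have "\<bar>poly p t\<bar> \<le> B" using True by (intro B) auto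
    then have "\<bar>poly p t\<bar> / q ^ m * exp (- (1 / q)) \<le> B / q ^ m * (fact (m + 2) * q ^ (m + 2))"
      using q e B by (intro mult_mono divide_right_mono) auto
    also have "\<dots> = C * q\<^sup>2" using q by (simp add: C_def power_add power2_eq_square)
    finally show ?thesis by (simp add: q_def)
  qed (use B in \<open>auto simp: bump_def C_def\<close>)
  then show ?thesis using B that[of C] by (simp add: C_def)
qed

lemma has_real_derivative_0_quadratic:
  fixes f :: "real \<Rightarrow> real"
  assumes "\<And>s. \<bar>f s\<bar> \<le> C * (s - t)\<^sup>2"
  shows "(f has_real_derivative 0) (at t)"
proof -
  have ft: "f t = 0" using assms[of t] by simp
  have "((\<lambda>h. (f (t + h) - f t) / h) \<longlongrightarrow> 0) (at 0)"
  proof (rule Lim_null_comparison)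
    show "\<forall>\<^sub>F h in at 0. norm ((f (t + h) - f t) / h) \<le> C * \<bar>h\<bar>"
    proof (rule eventually_at_filter[THEN iffD2], rule always_eventually, safe)
      fix h :: real assume "h \<noteq> 0"
      moreover have "\<bar>f (t + h)\<bar> \<le> C * \<bar>h\<bar> * \<bar>h\<bar>"
        using assms[of "t + h"] by (simp add: power2_eq_square abs_mult_self_eq mult.assoc)
      ultimately show "norm ((f (t + h) - f t) / h) \<le> C * \<bar>h\<bar>"
        by (simp add: ft pos_divide_le_eq)
    qed
    show "((\<lambda>h. C * \<bar>h\<bar>) \<longlongrightarrow> 0) (at 0)"
      by (rule tendsto_eq_intros | simp)+
  qed
  then show ?thesis by (simp add: DERIV_def)
qed

text \<open>Inside the interval this is the quotient and chain rule, with
  \<open>[:1, 0, -1:]\<close> standing for \<open>1 - t\<^sup>2\<close>; outside the function is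
  locally 0, and at the endpoints a quadratic bound forces derivative 0.\<close>

lemma bump_has_derivative:
  "(bump p m has_real_derivative
     bump (pderiv p * [:1, 0, -1:]\<^sup>2 + smult (2 * real m) ([:0, 1:] * p * [:1, 0, -1:]) - smult 2 ([:0, 1:] * p)) (m + 2) t) (at t)"
    (is "(_ has_real_derivative bump ?p' _ t) _")
proof -
  consider "\<bar>t\<bar> < 1" | "\<bar>t\<bar> = 1" | "\<bar>t\<bar> > 1" by linarith
  then show ?thesis
  proof cases
    case 1
    define q where "q = 1 - t\<^sup>2"
    have q: "q > 0" using 1 by (simp add: q_def abs_square_less_1)
    have pq: "poly [:1, 0, -1:] t = q" by (simp add: q_def power2_eq_square)
    have q0: "1 - t\<^sup>2 \<noteq> 0" using q by (simp add: q_def)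
    have d1: "((\<lambda>t. poly p t / (1 - t\<^sup>2) ^ m) has_real_derivative
      (poly (pderiv p) t * q ^ m - poly p t * (of_nat m * (- 2 * t) * q ^ (m - 1))) / (q ^ m * q ^ m)) (at t)"
      using q0 unfolding q_def by (auto intro!: derivative_eq_intros)
    have d2: "((\<lambda>t. exp (- (1 / (1 - t\<^sup>2)))) has_real_derivative exp (- (1 / q)) * (- (2 * t / (q * q)))) (at t)"
      using q0 unfolding q_def by (auto intro!: derivative_eq_intros)
    have "((\<lambda>t. poly p t / (1 - t\<^sup>2) ^ m * exp (- (1 / (1 - t\<^sup>2)))) has_real_derivative
      (poly (pderiv p) t * q ^ m - poly p t * (of_nat m * (- 2 * t) * q ^ (m - 1))) / (q ^ m * q ^ m) * exp (- (1 / q))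
       + exp (- (1 / q)) * (- (2 * t / (q * q))) * (poly p t / q ^ m)) (at t)"
      using DERIV_mult[OF d1 d2] by (simp only: q_def)
    also have "(poly (pderiv p) t * q ^ m - poly p t * (of_nat m * (- 2 * t) * q ^ (m - 1))) / (q ^ m * q ^ m) * exp (- (1 / q))
       + exp (- (1 / q)) * (- (2 * t / (q * q))) * (poly p t / q ^ m) = bump ?p' (m + 2) t"
    proof -
      have e: "(poly (pderiv p) t * q ^ m - poly p t * (of_nat m * (- 2 * t) * q ^ (m - 1))) / (q ^ m * q ^ m)
         = poly (pderiv p) t / q ^ m + 2 * t * poly p t * real m / (q * q ^ m)"
        by (cases m) (use q in \<open>auto simp: field_simps\<close>)
      have "poly ?p' t = poly (pderiv p) t * q\<^sup>2 + 2 * real m * (t * poly p t * q) - 2 * (t * poly p t)"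
        unfolding poly_diff poly_add poly_mult poly_power poly_smult pq by simp
      then have b: "bump ?p' (m + 2) t = (poly (pderiv p) t * q\<^sup>2 + 2 * real m * (t * poly p t * q) - 2 * (t * poly p t)) / (q ^ m * q\<^sup>2) * exp (- (1 / q))"
        using 1 unfolding bump_def q_def[symmetric] power_add by simp
      show ?thesis unfolding e b using q by (simp add: field_simps power2_eq_square)
    qed
    finally show ?thesis
    proof (rule DERIV_cong_ev[THEN iffD1, rotated -1, OF _ refl _ refl])
      have "eventually (\<lambda>s. s \<in> {-1<..<1}) (nhds t)"
        using 1 by (intro eventually_nhds_in_open) auto
      then show "\<forall>\<^sub>F s in nhds t. poly p s / (1 - s\<^sup>2) ^ m * exp (- (1 / (1 - s\<^sup>2))) = bump p m s"
        by eventually_elim (auto simp: bump_def)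
    qed
  next
    case 2
    obtain C where C: "C \<ge> 0" "\<And>s. \<bar>bump p m s\<bar> \<le> C * (1 - s\<^sup>2)\<^sup>2" using bump_bound by blast
    have tt: "t\<^sup>2 = 1" using 2 by (simp add: abs_square_eq_1)
    \<comment> \<open>Since \<open>t\<^sup>2 = 1\<close>, the factor \<open>1 - s\<^sup>2\<close> is
      up to sign \<open>(s - t) * (s + t)\<close>, and \<open>\<bar>s + t\<bar> \<le> 2\<close>
      produces the constant 4.\<close>
    have "\<bar>bump p m s\<bar> \<le> (4 * C) * (s - t)\<^sup>2" for s
    proof (cases "\<bar>s\<bar> < 1")
      case True
      have "(1 - s\<^sup>2)\<^sup>2 = (s - t)\<^sup>2 * (s + t)\<^sup>2"
        using tt by (simp add: power_mult_distrib[symmetric] algebra_simps power2_eq_square)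
      also have "(s + t)\<^sup>2 \<le> 2\<^sup>2" using True 2 by (subst abs_le_square_iff[symmetric]) auto
      then have "(s - t)\<^sup>2 * (s + t)\<^sup>2 \<le> (s - t)\<^sup>2 * 2\<^sup>2" by (intro mult_left_mono) auto
      finally have "C * (1 - s\<^sup>2)\<^sup>2 \<le> C * ((s - t)\<^sup>2 * 2\<^sup>2)" using C by (intro mult_left_mono) auto
      then show ?thesis using C(2)[of s] by (simp add: algebra_simps)
    qed (use C in \<open>auto simp: bump_def\<close>)
    then have "(bump p m has_real_derivative 0) (at t)"
      by (rule has_real_derivative_0_quadratic)
    then show ?thesis using 2 by (simp add: bump_def)
  next
    case 3
    have "((\<lambda>_. 0) has_real_derivative bump ?p' (m + 2) t) (at t)"
      using 3 by (simp add: bump_def)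
    then show ?thesis
    proof (rule DERIV_cong_ev[THEN iffD1, rotated -1, OF _ refl _ refl])
      have "open (- {-1..1::real})" by (intro open_Compl closed_atLeastAtMost)
      then have "eventually (\<lambda>s. s \<in> - {-1..1}) (nhds t)"
        using 3 by (intro eventually_nhds_in_open) auto
      then show "\<forall>\<^sub>F s in nhds t. 0 = bump p m s"
        by eventually_elim (auto simp: bump_def)
    qed
  qed
qed

definition bumps :: "real \<Rightarrow> (real \<Rightarrow> real) set" where
  "bumps e = {f. \<exists>p m. f = (\<lambda>t. bump p m (t / e))}"

lemma bumps_derivative:
  assumes "f \<in> bumps e" "e > 0"
  shows "\<exists>f'\<in>bumps e. \<forall>t. (f has_real_derivative f' t) (at t)"
proof -
  obtain p m where f: "f = (\<lambda>t. bump p m (t / e))" using assms by (auto simp: bumps_def)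
  obtain p' m' where d: "\<And>t. (bump p m has_real_derivative bump p' m' t) (at t)"
    using bump_has_derivative by blast
  have "(f has_real_derivative bump p' m' (t / e) * (1 / e)) (at t)" for t
    unfolding f by (rule DERIV_chain2[OF d]) (use assms(2) in \<open>auto intro!: derivative_eq_intros\<close>)
  moreover have "bump p' m' (t / e) * (1 / e) = bump (smult (1 / e) p') m' (t / e)" for t
    by (simp add: bump_def)
  ultimately show ?thesis unfolding bumps_def by auto
qed

lemma bumps_outside: "f \<in> bumps e \<Longrightarrow> e > 0 \<Longrightarrow> \<bar>t\<bar> \<ge> e \<Longrightarrow> f t = 0"
  by (auto simp: bumps_def bump_def)

section \<open>Products of one-dimensional bumps in several variables\<close>

lemma has_pd_prod:
  fixes F :: "'n::finite \<Rightarrow> real \<Rightarrow> real"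
  assumes "\<And>t. (F i has_real_derivative F' t) (at t)"
  shows "has_pd i (\<lambda>x. \<Prod>j\<in>UNIV. F j (x $ j)) (\<Prod>j\<in>UNIV. (F(i := F')) j (x $ j)) x"
proof -
  have split: "(\<Prod>j\<in>UNIV. G j (y $ j)) = G i (y $ i) * (\<Prod>j\<in>UNIV - {i}. G j (y $ j))"
    for G :: "'n \<Rightarrow> real \<Rightarrow> real" and y :: "real^'n"
    by (rule prod.remove) auto
  have "has_pd i (\<lambda>x. F i (x $ i)) (F' (x $ i) * (if i = i then 1 else 0)) x"
    by (rule has_pd_chain[OF assms has_pd_nth])
  moreover have "has_pd i (\<lambda>x. \<Prod>j\<in>UNIV - {i}. F j (x $ j)) 0 x"
  proof -
    have "(\<Prod>j\<in>UNIV - {i}. F j ((x + t *\<^sub>R axis i 1) $ j)) = (\<Prod>j\<in>UNIV - {i}. F j (x $ j))" for t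
      by (intro prod.cong) (auto simp: axis_def)
    then show ?thesis by (simp only: has_pd_def) simp
  qed
  ultimately have "has_pd i (\<lambda>x. F i (x $ i) * (\<Prod>j\<in>UNIV - {i}. F j (x $ j)))
     (F i (x $ i) * 0 + (F' (x $ i) * (if i = i then 1 else 0)) * (\<Prod>j\<in>UNIV - {i}. F j (x $ j))) x"
    by (rule has_pd_mult)
  moreover have "(\<Prod>j\<in>UNIV - {i}. F j (x $ j)) = (\<Prod>j\<in>UNIV - {i}. (F(i := F')) j (x $ j))"
    by (intro prod.cong) auto
  moreover have "(\<lambda>x. \<Prod>j\<in>UNIV. F j (x $ j)) = (\<lambda>x. F i (x $ i) * (\<Prod>j\<in>UNIV - {i}. F j (x $ j)))"
    using split[of F] by (rule ext)
  ultimately show ?thesis using split[of "F(i := F')" x] by (simp only: mult_1_right mult_zero_right add_0_left if_True refl fun_upd_same)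
qed

text \<open>A partial derivative changes one factor only, so products with factors from a class
  closed under differentiation are stable. The factors have to be allowed to depend on the
  coordinate even if they start out equal.\<close>

lemma iter_partial_prod:
  fixes F :: "'n::finite \<Rightarrow> real \<Rightarrow> real"
  assumes S: "\<And>f. f \<in> S \<Longrightarrow> \<exists>f'\<in>S. \<forall>t. (f has_real_derivative f' t) (at t)" and F: "\<And>j. F j \<in> S"
  shows "\<exists>G. (\<forall>j. G j \<in> S) \<and>
    iter_partial is (\<lambda>x. complex_of_real (\<Prod>j\<in>UNIV. F j ((x - y) $ j))) = (\<lambda>x. complex_of_real (\<Prod>j\<in>UNIV. G j ((x - y) $ j)))"
proof (induction "is")
  case Nil
  then show ?case using F by auto
next
  case (Cons i "is")
  then obtain G where G: "\<And>j. G j \<in> S"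
    "iter_partial is (\<lambda>x. complex_of_real (\<Prod>j\<in>UNIV. F j ((x - y) $ j))) = (\<lambda>x. complex_of_real (\<Prod>j\<in>UNIV. G j ((x - y) $ j)))"
    by auto
  obtain G' where G': "G' \<in> S" "\<And>t. (G i has_real_derivative G' t) (at t)" using S[OF G(1)] by blast
  have "has_pd i (\<lambda>x. complex_of_real (\<Prod>j\<in>UNIV. G j ((x - y) $ j))) (complex_of_real (\<Prod>j\<in>UNIV. (G(i := G')) j ((x - y) $ j))) x" for x
    using has_pd_shift[of i "\<lambda>x. \<Prod>j\<in>UNIV. G j (x $ j)" "-y" _ x] has_pd_prod[of G i G' "x - y", OF G'(2)]
    by (intro has_pd_of_real) simp
  then have "iter_partial (i # is) (\<lambda>x. complex_of_real (\<Prod>j\<in>UNIV. F j ((x - y) $ j))) = (\<lambda>x. complex_of_real (\<Prod>j\<in>UNIV. (G(i := G')) j ((x - y) $ j)))"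
    unfolding iter_partial.simps G(2) using partial_deriv_eq by blast
  then show ?case using G(1) G'(1) by (intro exI[of _ "G(i := G')"]) auto
qed

lemma smooth_fun_prod:
  fixes F :: "'n::finite \<Rightarrow> real \<Rightarrow> real"
  assumes S: "\<And>f. f \<in> S \<Longrightarrow> \<exists>f'\<in>S. \<forall>t. (f has_real_derivative f' t) (at t)" and F: "\<And>j. F j \<in> S"
  shows "smooth_fun (\<lambda>x. complex_of_real (\<Prod>j\<in>UNIV. F j ((x - y) $ j)))"
  unfolding smooth_fun_def
proof (intro allI conjI)
  fix "is" :: "'n list"
  obtain G where G: "\<And>j. G j \<in> S"
    "iter_partial is (\<lambda>x. complex_of_real (\<Prod>j\<in>UNIV. F j ((x - y) $ j))) = (\<lambda>x. complex_of_real (\<Prod>j\<in>UNIV. G j ((x - y) $ j)))"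
  proof -
    have "\<exists>G. (\<forall>j. G j \<in> S) \<and> iter_partial is (\<lambda>x. complex_of_real (\<Prod>j\<in>UNIV. F j ((x - y) $ j)))
        = (\<lambda>x. complex_of_real (\<Prod>j\<in>UNIV. G j ((x - y) $ j)))"
      by (rule iter_partial_prod[where S = S]) (fact S, fact F)
    then show ?thesis using that by blast
  qed
  have cG: "continuous_on UNIV (G j)" for j
    using S[OF G(1)[of j]] by (metis DERIV_isCont continuous_at_imp_continuous_on)
  show "continuous_on UNIV (iter_partial is (\<lambda>x. complex_of_real (\<Prod>j\<in>UNIV. F j ((x - y) $ j))))"
    unfolding G(2) by (intro continuous_intros continuous_on_compose2[OF cG]) auto
  fix i x
  obtain G' where G': "G' \<in> S" "\<And>t. (G i has_real_derivative G' t) (at t)" using S[OF G(1)] by blast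
  have "has_pd i (\<lambda>x. complex_of_real (\<Prod>j\<in>UNIV. G j ((x - y) $ j))) (complex_of_real (\<Prod>j\<in>UNIV. (G(i := G')) j ((x - y) $ j))) x"
    using has_pd_shift[of i "\<lambda>x. \<Prod>j\<in>UNIV. G j (x $ j)" "-y" _ x] has_pd_prod[of G i G' "x - y", OF G'(2)]
    by (intro has_pd_of_real) simp
  then show "(\<lambda>t. iter_partial is (\<lambda>x. complex_of_real (\<Prod>j\<in>UNIV. F j ((x - y) $ j))) (x + t *\<^sub>R axis i 1)) differentiable (at 0)"
    unfolding G(2) has_pd_def has_vector_derivative_def differentiable_def by blast
qed

section \<open>Mollification in the mean square\<close>

(* With this sign convention x |-> K (x - y) is itself a test function, and derivatives in y change sign. *)
definition conv :: "('a::euclidean_space \<Rightarrow> real) \<Rightarrow> ('a \<Rightarrow> real) \<Rightarrow> 'a \<Rightarrow> real" where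
  "conv K g y = (\<integral>x. K (x - y) * g x \<partial>lborel)"

lemma integrable_sq_locally:
  fixes g :: "'a::euclidean_space \<Rightarrow> real"
  assumes [measurable]: "g \<in> borel_measurable borel" and "integrable lborel (\<lambda>x. (g x)\<^sup>2)"
  shows "integrable lborel (\<lambda>x. indicator (cball 0 R) x * \<bar>g x\<bar>)"
proof -
  have "integrable lborel (\<lambda>x. (indicator (cball (0::'a) R) x)\<^sup>2 :: real)"
    using emeasure_lborel_cball_finite[of "0::'a" R]
    by (auto simp: power2_eq_square indicator_inter_arith[symmetric] intro!: integrable_real_indicator)
  from real_Cauchy_Schwarz_integral(1)[OF _ _ this, of "\<lambda>x. \<bar>g x\<bar>"] assms show ?thesis
    by (simp add: borel_measurable_indicator)
qed

lemma integrable_shift_mult: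
  fixes g :: "'a::euclidean_space \<Rightarrow> real"
  assumes g[measurable]: "g \<in> borel_measurable borel" "integrable lborel (\<lambda>x. (g x)\<^sup>2)"
    and K: "continuous_on UNIV K" "\<And>x. norm x > R \<Longrightarrow> K x = 0"
  shows "integrable lborel (\<lambda>x. K (x - y) * g x)"
proof -
  have [measurable]: "K \<in> borel_measurable borel" using K by (intro borel_measurable_continuous_onI)
  obtain B where B: "B > 0" "\<And>x. \<bar>K x\<bar> \<le> B"
    using bounded_cont_compact_support[OF K] by (auto simp: )
  show ?thesis
  proof (rule Bochner_Integration.integrable_bound[OF integrable_mult_right[OF integrable_sq_locally[OF g, of "R + norm y"], of B]])
    have "norm (K (x - y) * g x) \<le> norm (B * (indicator (cball 0 (R + norm y)) x * \<bar>g x\<bar>))" for x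
    proof (cases "norm x \<le> R + norm y")
      case True then show ?thesis using B(2)[of "x - y"] B(1) by (simp add: abs_mult mult_right_mono)
    next
      case False
      then have "norm (x - y) > R" using norm_triangle_ineq2[of x y] by linarith
      then show ?thesis using K by simp
    qed
    then show "AE x in lborel. norm (K (x - y) * g x) \<le> norm (B * (indicator (cball 0 (R + norm y)) x * \<bar>g x\<bar>))" by simp
  qed measurable
qed

text \<open>On a fixed ball the square integrable \<open>g\<close> is integrable, which provides the
  majorant. Continuity and differentiability of \<open>conv\<close> both follow from this with
  different choices of \<open>Q\<close>.\<close>

lemma conv_tendsto:
  fixes g :: "'a::euclidean_space \<Rightarrow> real" and Q :: "nat \<Rightarrow> 'a \<Rightarrow> real"
  assumes g[measurable]: "g \<in> borel_measurable borel" "integrable lborel (\<lambda>x. (g x)\<^sup>2)"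
    and [measurable]: "\<And>k. Q k \<in> borel_measurable borel" "q \<in> borel_measurable borel"
    and lim: "\<And>x. (\<lambda>k. Q k x) \<longlonglongrightarrow> q x"
    and bd: "\<And>k x. \<bar>Q k x\<bar> \<le> B" and out: "\<And>k x. norm x > R \<Longrightarrow> Q k x = 0"
  shows "(\<lambda>k. \<integral>x. Q k x * g x \<partial>lborel) \<longlonglongrightarrow> (\<integral>x. q x * g x \<partial>lborel)"
proof (rule integral_dominated_convergence[where w = "\<lambda>x. B * (indicator (cball 0 R) x * \<bar>g x\<bar>)"])
  show "integrable lborel (\<lambda>x. B * (indicator (cball 0 R) x * \<bar>g x\<bar>))"
    by (intro integrable_mult_right integrable_sq_locally g)
  show "AE x in lborel. (\<lambda>k. Q k x * g x) \<longlonglongrightarrow> q x * g x"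
    by (intro AE_I2 tendsto_intros lim)
  have B0: "0 \<le> B" using bd[of 0 0] by linarith
  have "norm (Q k x * g x) \<le> B * (indicator (cball 0 R) x * \<bar>g x\<bar>)" for k x
    using bd[of k x] out[where k = k and x = x] B0 by (cases "norm x \<le> R") (auto simp: abs_mult mult_right_mono)
  then show "AE x in lborel. norm (Q k x * g x) \<le> B * (indicator (cball 0 R) x * \<bar>g x\<bar>)" for k by simp
qed measurable

lemma continuous_on_conv:
  fixes g :: "'a::euclidean_space \<Rightarrow> real"
  assumes g[measurable]: "g \<in> borel_measurable borel" "integrable lborel (\<lambda>x. (g x)\<^sup>2)"
    and K: "continuous_on UNIV K" "\<And>x. norm x > R \<Longrightarrow> K x = 0"
  shows "continuous_on UNIV (conv K g)"
proof (rule continuous_on_sequentiallyI)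
  have [measurable]: "K \<in> borel_measurable borel" using K by (intro borel_measurable_continuous_onI)
  fix u and y :: 'a assume u: "u \<longlonglongrightarrow> y"
  obtain B where B: "B > 0" "\<And>x. \<bar>K x\<bar> \<le> B"
    using bounded_cont_compact_support[OF K] by auto
  obtain H where H: "\<And>k. norm (u k) \<le> H"
    using convergent_imp_Bseq[OF convergentI[OF u]] by (auto simp: Bseq_def)
  show "(\<lambda>k. conv K g (u k)) \<longlonglongrightarrow> conv K g y"
    unfolding conv_def
  proof (rule conv_tendsto[OF g])
    show "(\<lambda>k. K (x - u k)) \<longlonglongrightarrow> K (x - y)" for x
    proof -
      have "(\<lambda>k. x - u k) \<longlonglongrightarrow> x - y" by (intro tendsto_intros u)
      then show ?thesis using continuous_on_tendsto_compose[OF K(1)] by force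
    qed
    show "\<bar>K (x - u k)\<bar> \<le> B" for x k by (rule B)
    show "K (x - u k) = 0" if "norm x > R + H" for x k
      using K(2)[of "x - u k"] that H[of k] norm_triangle_ineq2[of x "u k"] by linarith
  qed measurable
qed

lemma has_pd_LIMSEQ_I:
  fixes f :: "real^'n::finite \<Rightarrow> real"
  assumes "\<And>h. h \<longlonglongrightarrow> 0 \<Longrightarrow> (\<And>k. h k \<noteq> (0::real)) \<Longrightarrow> (\<lambda>k. (f (x + h k *\<^sub>R axis i 1) - f x) / h k) \<longlonglongrightarrow> d"
  shows "has_pd i f d x"
proof -
  have "((\<lambda>h. (f (x + h *\<^sub>R axis i 1) - f x) / h) \<longlongrightarrow> d) (at 0)"
    using assms by (auto simp: tendsto_at_iff_sequentially o_def)
  then have "((\<lambda>t. f (x + t *\<^sub>R axis i 1)) has_real_derivative d) (at 0)"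
    by (simp add: DERIV_def)
  then show ?thesis by (simp add: has_pd_def has_real_derivative_iff_has_vector_derivative)
qed

lemma has_pd_conv:
  fixes g :: "real^'n::finite \<Rightarrow> real"
  assumes g[measurable]: "g \<in> borel_measurable borel" "integrable lborel (\<lambda>x. (g x)\<^sup>2)"
    and K: "continuous_on UNIV K" "\<And>x. norm x > R \<Longrightarrow> K x = 0"
    and K': "continuous_on UNIV K'" "\<And>x. has_pd i K (K' x) x"
  shows "has_pd i (conv K g) (- conv K' g y) y"
proof (rule has_pd_LIMSEQ_I)
  have out': "K' x = 0" if "norm x > R" for x
    using has_pd_outside[OF K(2) K'(2) that] .
  have [measurable]: "K \<in> borel_measurable borel" "K' \<in> borel_measurable borel"
    using K K' by (auto intro: borel_measurable_continuous_onI)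
  fix h :: "nat \<Rightarrow> real" assume h: "h \<longlonglongrightarrow> 0" "\<And>k. h k \<noteq> 0"
  obtain B where B: "B > 0" "\<And>x. norm (K' x) \<le> B"
    using bounded_cont_compact_support[OF K'(1) out'] by blast
  obtain H where H: "\<And>k. norm (h k) \<le> H"
    using convergent_imp_Bseq[OF convergentI[OF h(1)]] by (auto simp: Bseq_def)
  define Q where "Q k x = (K (x - (y + h k *\<^sub>R axis i 1)) - K (x - y)) / h k" for k x
  \<comment> \<open>Moving \<open>y\<close> forward by \<open>h k\<close> moves \<open>x - y\<close>
    backward, so \<open>Q k\<close> is minus a difference quotient of \<open>K\<close> with step
    \<open>- h k\<close>.\<close>
  have Qe: "Q k x = - ((K ((x - y) + (- h k) *\<^sub>R axis i 1) - K (x - y)) / (- h k))" for k x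
    by (simp add: Q_def algebra_simps)
  have "(\<lambda>k. \<integral>x. Q k x * g x \<partial>lborel) \<longlonglongrightarrow> (\<integral>x. - K' (x - y) * g x \<partial>lborel)"
  proof (rule conv_tendsto[OF g])
    show "Q k \<in> borel_measurable borel" for k unfolding Q_def by measurable
    show "(\<lambda>k. Q k x) \<longlonglongrightarrow> - K' (x - y)" for x
    proof -
      have "(\<lambda>k. - h k) \<longlonglongrightarrow> 0" using tendsto_minus[OF h(1)] by simp
      then have "(\<lambda>k. (K ((x - y) + (- h k) *\<^sub>R axis i 1) - K (x - y)) /\<^sub>R (- h k)) \<longlonglongrightarrow> K' (x - y)"
        using h(2) by (intro has_pd_LIMSEQ[OF K'(2)]) auto
      then show ?thesis unfolding Qe by (intro tendsto_minus) (simp add: divide_inverse mult.commute)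
    qed
    show "\<bar>Q k x\<bar> \<le> B" for k x
      using has_pd_lipschitz[of i K K' B "x - y" "- h k", OF K'(2) B(2)] h(2)[of k]
      unfolding Qe by (simp add: pos_divide_le_eq)
    show "Q k x = 0" if "norm x > R + norm y + H" for k x
    proof -
      have "norm (x - y) \<ge> norm x - norm y" by (rule norm_triangle_ineq2)
      moreover have "norm (x - (y + h k *\<^sub>R axis i 1)) \<ge> norm x - (norm y + H)"
        using norm_triangle_ineq2[of x "y + h k *\<^sub>R axis i 1"] norm_triangle_ineq[of y "h k *\<^sub>R axis i 1"] H[of k] by simp
      moreover have "0 \<le> H" using H[of 0] norm_ge_zero order_trans by blast
      ultimately show ?thesis using K(2) that by (simp add: Q_def)
    qed
  qed measurable
  moreover have "(\<integral>x. - K' (x - y) * g x \<partial>lborel) = - conv K' g y"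
    by (simp add: conv_def)
  moreover have "(\<integral>x. Q k x * g x \<partial>lborel) = (conv K g (y + h k *\<^sub>R axis i 1) - conv K g y) / h k" for k
  proof -
    have "(\<integral>x. Q k x * g x \<partial>lborel) = (\<integral>x. (K (x - (y + h k *\<^sub>R axis i 1)) * g x - K (x - y) * g x) / h k \<partial>lborel)"
      by (simp add: Q_def algebra_simps diff_divide_distrib)
    also have "\<dots> = (conv K g (y + h k *\<^sub>R axis i 1) - conv K g y) / h k"
      unfolding conv_def using integrable_shift_mult[OF g K] by simp
    finally show ?thesis .
  qed
  ultimately show "(\<lambda>k. (conv K g (y + h k *\<^sub>R axis i 1) - conv K g y) / h k) \<longlonglongrightarrow> - conv K' g y"
    by simp
qed

section \<open>Continuity of translations in the mean and in the mean square\<close>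

definition shift_dist :: "('a::euclidean_space \<Rightarrow> real) \<Rightarrow> 'a \<Rightarrow> real" where
  "shift_dist f h = (\<integral>x. \<bar>f (x + h) - f x\<bar> \<partial>lborel)"

lemma shift_dist_triangle:
  assumes "integrable lborel f" "integrable lborel f'"
  shows "shift_dist f h \<le> 2 * (\<integral>x. \<bar>f x - f' x\<bar> \<partial>lborel) + shift_dist f' h"
proof -
  have m[measurable]: "f \<in> borel_measurable borel" "f' \<in> borel_measurable borel"
    using assms by auto
  have i: "integrable lborel (\<lambda>x. f (x + h))" "integrable lborel (\<lambda>x. f' (x + h))"
    using assms lborel_integral_shift(2)[OF m(1), of h] lborel_integral_shift(2)[OF m(2), of h] by auto
  have "shift_dist f h \<le> (\<integral>x. \<bar>f (x + h) - f' (x + h)\<bar> + \<bar>f' (x + h) - f' x\<bar> + \<bar>f x - f' x\<bar> \<partial>lborel)"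
    unfolding shift_dist_def
    by (intro integral_mono Bochner_Integration.integrable_add integrable_abs Bochner_Integration.integrable_diff i assms) linarith
  also have "\<dots> = (\<integral>x. \<bar>f (x + h) - f' (x + h)\<bar> \<partial>lborel) + shift_dist f' h + (\<integral>x. \<bar>f x - f' x\<bar> \<partial>lborel)"
    unfolding shift_dist_def
    by (subst Bochner_Integration.integral_add; (intro Bochner_Integration.integrable_add integrable_abs Bochner_Integration.integrable_diff i assms)?)
       (subst Bochner_Integration.integral_add; (intro Bochner_Integration.integrable_add integrable_abs Bochner_Integration.integrable_diff i assms refl)?)
  also have "(\<integral>x. \<bar>f (x + h) - f' (x + h)\<bar> \<partial>lborel) = (\<integral>x. \<bar>f x - f' x\<bar> \<partial>lborel)"
    using lborel_integral_shift(1)[of "\<lambda>x. \<bar>f x - f' x\<bar>" h] by simp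
  finally show ?thesis by simp
qed

text \<open>The functions with continuous translations form a closed set for the integral norm. This
  is applied when measurable sets are approximated by open ones and when integrable functions are
  approximated by simple ones.\<close>

lemma shift_dist_approx:
  assumes f: "integrable lborel f"
    and ap: "\<And>e. 0 < e \<Longrightarrow> \<exists>f'. integrable lborel f' \<and> (\<lambda>k. shift_dist f' (h k)) \<longlonglongrightarrow> 0 \<and> (\<integral>x. \<bar>f x - f' x\<bar> \<partial>lborel) < e"
  shows "(\<lambda>k. shift_dist f (h k)) \<longlonglongrightarrow> 0"
proof (rule LIMSEQ_I)
  fix e :: real assume e: "0 < e"
  then obtain f' where f': "integrable lborel f'" "(\<lambda>k. shift_dist f' (h k)) \<longlonglongrightarrow> 0" "(\<integral>x. \<bar>f x - f' x\<bar> \<partial>lborel) < e / 4"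
    using ap[of "e / 4"] by auto
  obtain N where N: "\<And>k. k \<ge> N \<Longrightarrow> \<bar>shift_dist f' (h k)\<bar> < e / 2"
    using LIMSEQ_D[OF f'(2), of "e / 2"] e by auto
  have "norm (shift_dist f (h k) - 0) < e" if "k \<ge> N" for k
  proof -
    have "0 \<le> shift_dist f (h k)" by (simp add: shift_dist_def)
    then show ?thesis using shift_dist_triangle[OF f f'(1), of "h k"] N[OF that] f'(3) by simp
  qed
  then show "\<exists>no. \<forall>n\<ge>no. norm (shift_dist f (h n) - 0) < e" by blast
qed

text \<open>For an indicator the absolute difference is the sum of the two values minus twice their
  product, so it suffices to treat the product. By openness it converges pointwise to the indicator
  of \<open>U\<close>, which also dominates it.\<close>

lemma shift_dist_open:
  assumes U: "open U" "emeasure lborel U < \<infinity>" and h: "h \<longlonglongrightarrow> (0 :: 'a::euclidean_space)"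
  shows "(\<lambda>k. shift_dist (indicator U) (h k)) \<longlonglongrightarrow> 0"
proof -
  have [measurable]: "U \<in> sets borel" using U by simp
  have iU: "integrable lborel (indicator U :: 'a \<Rightarrow> real)"
    using U by (intro integrable_real_indicator) auto
  have iUh: "integrable lborel (\<lambda>x. indicator U (x + c) :: real)" for c
    using iU lborel_integral_shift(2)[of "indicator U :: 'a \<Rightarrow> real" c] by simp
  have iP: "integrable lborel (\<lambda>x. indicator U x * indicator U (x + c) :: real)" for c
    by (rule Bochner_Integration.integrable_bound[OF iU]) (auto simp: indicator_def)
  have "(\<lambda>k. \<integral>x. indicator U x * indicator U (x + h k) \<partial>lborel) \<longlonglongrightarrow> (\<integral>x. indicator U x \<partial>lborel :: real)"
  proof (rule integral_dominated_convergence[where w = "indicator U"])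
    show "AE x in lborel. (\<lambda>k. indicator U x * indicator U (x + h k)) \<longlonglongrightarrow> (indicator U x :: real)"
    proof (rule AE_I2)
      fix x :: 'a
      show "(\<lambda>k. indicator U x * indicator U (x + h k)) \<longlonglongrightarrow> (indicator U x :: real)"
      proof (cases "x \<in> U")
        case True
        have "(\<lambda>k. x + h k) \<longlonglongrightarrow> x + 0" by (intro tendsto_intros h)
        then have "eventually (\<lambda>k. x + h k \<in> U) sequentially"
          using topological_tendstoD[OF _ U(1)] True by fastforce
        then have "eventually (\<lambda>k. indicator U x * indicator U (x + h k) = (indicator U x :: real)) sequentially"
          by eventually_elim (use True in simp)
        then show ?thesis by (rule tendsto_eventually)
      qed simp
    qed
  qed (use iU in \<open>auto simp: indicator_def\<close>)
  then have "(\<lambda>k. 2 * (\<integral>x. indicator U x \<partial>lborel) - 2 * (\<integral>x. indicator U x * indicator U (x + h k) \<partial>lborel)) \<longlonglongrightarrow>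
      2 * (\<integral>x. indicator U x \<partial>lborel) - 2 * (\<integral>x. indicator U x \<partial>lborel :: real)"
    by (intro tendsto_intros)
  moreover have "shift_dist (indicator U) c = 2 * (\<integral>x. indicator U x \<partial>lborel) - 2 * (\<integral>x. indicator U x * indicator U (x + c) \<partial>lborel)" for c
  proof -
    have "shift_dist (indicator U) c = (\<integral>x. (indicator U (x + c) + indicator U x) - 2 * (indicator U x * indicator U (x + c)) \<partial>lborel)"
      unfolding shift_dist_def by (intro Bochner_Integration.integral_cong) (auto simp: indicator_def)
    also have "\<dots> = (\<integral>x. indicator U (x + c) \<partial>lborel) + (\<integral>x. indicator U x \<partial>lborel) - 2 * (\<integral>x. indicator U x * indicator U (x + c) \<partial>lborel)"
      using iU iUh iP by (simp del: integral_indicator)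
    also have "(\<integral>x. indicator U (x + c) \<partial>lborel) = (\<integral>x. indicator U x \<partial>lborel :: real)"
      using lborel_integral_shift(1)[of "indicator U :: 'a \<Rightarrow> real" c] by simp
    finally show ?thesis by simp
  qed
  ultimately show ?thesis by simp
qed

text \<open>Measurable sets reduce to open ones by outer regularity; linear combinations and
  dominated limits of simple functions then reach every integrable function.\<close>

lemma shift_dist_tendsto_0:
  assumes f: "integrable lborel f" and h: "h \<longlonglongrightarrow> (0 :: 'a::euclidean_space)"
  shows "(\<lambda>k. shift_dist f (h k)) \<longlonglongrightarrow> 0"
  using f
proof (induction rule: integrable_induct)
  case (base A c)
  then have [measurable]: "A \<in> sets borel" by simp
  have iA: "integrable lborel (indicator A :: 'a \<Rightarrow> real)"
    using base by (intro integrable_real_indicator) auto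
  have "(\<lambda>k. shift_dist (indicator A) (h k)) \<longlonglongrightarrow> 0"
  proof (rule shift_dist_approx[OF iA])
    fix e :: real assume e: "0 < e"
    obtain U where U: "open U" "A \<subseteq> U" "emeasure lborel (U - A) < ennreal e"
      using outer_regular_lborel[OF \<open>A \<in> sets borel\<close> e] by auto
    have [measurable]: "U \<in> sets borel" using U by simp
    have "emeasure lborel U \<le> emeasure lborel A + emeasure lborel (U - A)"
      using emeasure_subadditive[of A lborel "U - A"] U(2) by (simp add: Un_absorb1)
    also have "\<dots> < \<infinity>" using base(2) U(3) by (simp add: less_top[symmetric] ennreal_add_eq_top) (metis ennreal_less_top less_trans neq_iff)
    finally have fU: "emeasure lborel U < \<infinity>" .
    have "(\<integral>x. \<bar>indicator A x - indicator U x\<bar> \<partial>lborel) = (\<integral>x. indicator (U - A) x \<partial>lborel :: real)"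
      using U(2) by (intro Bochner_Integration.integral_cong) (auto simp: indicator_def)
    also have "\<dots> = measure lborel (U - A)" by simp
    also have "\<dots> < e" using U(3) e by (simp add: measure_def enn2real_less_iff) (metis enn2real_ennreal enn2real_less_iff ennreal_less_top less_imp_le less_trans)
    finally show "\<exists>f'. integrable lborel f' \<and> (\<lambda>k. shift_dist f' (h k)) \<longlonglongrightarrow> 0 \<and> (\<integral>x. \<bar>indicator A x - f' x\<bar> \<partial>lborel) < e"
      using shift_dist_open[OF U(1) fU h] fU by (intro exI[of _ "indicator U"]) auto
  qed
  then have "(\<lambda>k. \<bar>c\<bar> * shift_dist (indicator A) (h k)) \<longlonglongrightarrow> \<bar>c\<bar> * 0" by (intro tendsto_intros)
  moreover have "shift_dist (\<lambda>x. indicator A x *\<^sub>R c) b = \<bar>c\<bar> * shift_dist (indicator A) b" for b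
    unfolding shift_dist_def integral_mult_right_zero[symmetric]
    by (intro Bochner_Integration.integral_cong) (auto simp: indicator_def)
  ultimately show ?case by simp
next
  case (add f g)
  have "(\<lambda>k. shift_dist f (h k) + shift_dist g (h k)) \<longlonglongrightarrow> 0 + 0"
    by (intro tendsto_intros add)
  moreover have "norm (shift_dist (\<lambda>x. f x + g x) b) \<le> shift_dist f b + shift_dist g b" for b
  proof -
    have m[measurable]: "f \<in> borel_measurable borel" "g \<in> borel_measurable borel" using add by auto
    have i: "integrable lborel (\<lambda>x. f (x + b))" "integrable lborel (\<lambda>x. g (x + b))"
      using add lborel_integral_shift(2)[OF m(1), of b] lborel_integral_shift(2)[OF m(2), of b] by auto
    have "shift_dist (\<lambda>x. f x + g x) b \<le> (\<integral>x. \<bar>f (x + b) - f x\<bar> + \<bar>g (x + b) - g x\<bar> \<partial>lborel)"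
      unfolding shift_dist_def
      by (intro integral_mono Bochner_Integration.integrable_add integrable_abs Bochner_Integration.integrable_diff i add) linarith
    also have "\<dots> = shift_dist f b + shift_dist g b"
      unfolding shift_dist_def
      by (intro Bochner_Integration.integral_add integrable_abs Bochner_Integration.integrable_diff i add)
    finally show ?thesis by (simp add: shift_dist_def)
  qed
  ultimately show ?case
    using Lim_null_comparison[of "\<lambda>k. shift_dist (\<lambda>x. f x + g x) (h k)" "\<lambda>k. shift_dist f (h k) + shift_dist g (h k)" sequentially]
    by simp
next
  case (lim f s)
  show ?case
  proof (rule shift_dist_approx[OF lim.hyps(4)])
    fix e :: real assume e: "0 < e"
    have [measurable]: "f \<in> borel_measurable borel" "s i \<in> borel_measurable borel" for i
      using lim by auto
    have "(\<lambda>i. \<integral>x. \<bar>f x - s i x\<bar> \<partial>lborel) \<longlonglongrightarrow> (\<integral>x. 0 \<partial>(lborel :: 'a measure) :: real)"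
    proof (rule integral_dominated_convergence[where w = "\<lambda>x. 3 * \<bar>f x\<bar>"])
      show "AE x in lborel. (\<lambda>i. \<bar>f x - s i x\<bar>) \<longlonglongrightarrow> 0"
      proof (rule AE_I2)
        fix x
        have "(\<lambda>i. \<bar>f x - s i x\<bar>) \<longlonglongrightarrow> \<bar>f x - f x\<bar>" using lim.hyps(2)[of x] by (intro tendsto_intros) auto
        then show "(\<lambda>i. \<bar>f x - s i x\<bar>) \<longlonglongrightarrow> 0" by simp
      qed
      show "AE x in lborel. norm \<bar>f x - s i x\<bar> \<le> 3 * \<bar>f x\<bar>" for i
      proof (rule AE_I2)
        fix x show "norm \<bar>f x - s i x\<bar> \<le> 3 * \<bar>f x\<bar>" using lim.hyps(3)[of x i] by simp
      qed
    qed (use lim.hyps(4) in auto)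
    then obtain i where "\<bar>\<integral>x. \<bar>f x - s i x\<bar> \<partial>lborel\<bar> < e"
      using LIMSEQ_D[of _ 0 e] e by fastforce
    then show "\<exists>f'. integrable lborel f' \<and> (\<lambda>k. shift_dist f' (h k)) \<longlonglongrightarrow> 0 \<and> (\<integral>x. \<bar>f x - f' x\<bar> \<partial>lborel) < e"
      using lim.hyps(1) lim.IH by (intro exI[of _ "s i"]) auto
  qed
qed


(* Continuity of translations in the mean square reduces to the integrable case through (a - b)^2 <= 2 |a|a| - b|b||. *)
lemma shift_L2_small:
  fixes g :: "'a::euclidean_space \<Rightarrow> real"
  assumes g[measurable]: "g \<in> borel_measurable borel" "integrable lborel (\<lambda>x. (g x)\<^sup>2)" and e: "0 < e"
  obtains d where "d > 0" "\<And>h. norm h < d \<Longrightarrow> (\<integral>\<^sup>+x. ennreal ((g (x + h) - g x)\<^sup>2) \<partial>lborel) \<le> ennreal e"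
proof -
  define G where "G x = g x * \<bar>g x\<bar>" for x
  have Gm[measurable]: "G \<in> borel_measurable borel" unfolding G_def by measurable
  have iG: "integrable lborel G"
    by (rule Bochner_Integration.integrable_bound[OF g(2)]) (auto simp: G_def power2_eq_square abs_mult)
  have sq: "(a - b)\<^sup>2 \<le> 2 * \<bar>a * \<bar>a\<bar> - b * \<bar>b\<bar>\<bar>" for a b :: real
  proof -
    have pos: "(a - b)\<^sup>2 \<le> 2 * \<bar>a * a - b * b\<bar>" if "a \<ge> 0" "b \<ge> 0" for a b :: real
    proof -
      have "(a - b)\<^sup>2 = \<bar>a - b\<bar> * \<bar>a - b\<bar>" by (simp add: power2_eq_square)
      also have "\<dots> \<le> \<bar>a - b\<bar> * \<bar>a + b\<bar>" using that by (intro mult_left_mono) auto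
      also have "\<dots> = \<bar>a * a - b * b\<bar>" 
        unfolding square_diff_square_factored abs_mult by (rule mult.commute)
      also have "\<dots> = 1 * \<bar>a * a - b * b\<bar>" by simp
      also have "\<dots> \<le> 2 * \<bar>a * a - b * b\<bar>" by (rule mult_right_mono) simp_all
      finally show ?thesis .
    qed
    have neg: "(a + b)\<^sup>2 \<le> 2 * (a * a + b * b)" for a b :: real
      using sum_squares_bound[of a b] by (simp add: power2_eq_square algebra_simps)
    consider "a \<ge> 0" "b \<ge> 0" | "a \<le> 0" "b \<le> 0" | "a \<ge> 0" "b \<le> 0" | "a \<le> 0" "b \<ge> 0" by linarith
    then show ?thesis
    proof cases
      case 1 then show ?thesis using pos[of a b] by simp
    next
      case 2 then show ?thesis using pos[of "-a" "-b"] by (simp add: power2_commute abs_minus_commute)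
    next
      case 3 then show ?thesis using neg[of a "-b"] by (simp add: add_nonneg_nonneg)
    next
      case 4
      have "- (a * a) - b * b = - (a * a + b * b)" by simp
      then have "\<bar>- (a * a) - b * b\<bar> = a * a + b * b" by (simp only: abs_minus_cancel) simp
      then show ?thesis using 4 neg[of "-a" b] by (simp add: power2_commute)
    qed
  qed
  have "(shift_dist G \<longlongrightarrow> 0) (at 0)"
    using shift_dist_tendsto_0[OF iG] by (auto simp: tendsto_at_iff_sequentially o_def)
  then have "eventually (\<lambda>h. shift_dist G h < e / 2) (at 0)"
    by (rule order_tendstoD) (use e in simp)
  then obtain d where d: "d > 0" "\<And>h. h \<noteq> 0 \<Longrightarrow> norm h < d \<Longrightarrow> shift_dist G h < e / 2"
    by (auto simp: eventually_at)
  have "(\<integral>\<^sup>+x. ennreal ((g (x + h) - g x)\<^sup>2) \<partial>lborel) \<le> ennreal e" if h: "norm h < d" for h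
  proof -
    have "shift_dist G h \<le> e / 2"
      using d(2)[of h] h e by (cases "h = 0") (auto simp: shift_dist_def)
    have i: "integrable lborel (\<lambda>x. 2 * \<bar>G (x + h) - G x\<bar>)"
      using iG lborel_integral_shift(2)[OF Gm, of h] by auto
    have "(\<integral>\<^sup>+x. ennreal ((g (x + h) - g x)\<^sup>2) \<partial>lborel) \<le> (\<integral>\<^sup>+x. ennreal (2 * \<bar>G (x + h) - G x\<bar>) \<partial>lborel)"
      unfolding G_def by (intro nn_integral_mono ennreal_leI sq)
    also have "\<dots> = ennreal (2 * shift_dist G h)"
      unfolding shift_dist_def by (subst nn_integral_eq_integral[OF i]) auto
    also have "\<dots> \<le> ennreal e" using \<open>shift_dist G h \<le> e / 2\<close> by (intro ennreal_leI) simp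
    finally show ?thesis .
  qed
  then show ?thesis using d(1) that by blast
qed

text \<open>\<open>conv K g y\<close> is a weighted mean of \<open>g\<close> near \<open>y\<close>,
  so Jensen's inequality bounds its squared deviation from \<open>g y\<close> by the mean of the
  squared deviations. Exchanging the integrals leaves an average of squared translation errors over
  \<open>\<bar>h\<bar> < d\<close>.\<close>

lemma conv_L2_close:
  fixes g :: "'a::euclidean_space \<Rightarrow> real"
  assumes g[measurable]: "g \<in> borel_measurable borel" "integrable lborel (\<lambda>x. (g x)\<^sup>2)"
    and d: "\<And>h. norm h < d \<Longrightarrow> (\<integral>\<^sup>+x. ennreal ((g (x + h) - g x)\<^sup>2) \<partial>lborel) \<le> ennreal e" and e: "0 \<le> e"
    and K: "continuous_on UNIV K" "\<And>x. norm x \<ge> d \<Longrightarrow> K x = 0" "\<And>x. 0 \<le> K x" "integral\<^sup>L lborel K = 1"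
  shows "integrable lborel (\<lambda>y. (conv K g y - g y)\<^sup>2)" "(\<integral>y. (conv K g y - g y)\<^sup>2 \<partial>lborel) \<le> e"
proof -
  have [measurable]: "K \<in> borel_measurable borel" using K by (intro borel_measurable_continuous_onI)
  have Ko: "\<And>x. norm x > d \<Longrightarrow> K x = 0" using K(2) by simp
  have [measurable]: "conv K g \<in> borel_measurable borel"
    by (intro borel_measurable_continuous_onI continuous_on_conv[OF g K(1) Ko])
  obtain B where B: "B > 0" "\<And>x. \<bar>K x\<bar> \<le> B"
    using bounded_cont_compact_support[OF K(1) Ko] by auto
  have iK: "integrable lborel K" by (rule integrable_cont_compact_support[OF K(1) Ko])
  have pt: "ennreal ((conv K g y - g y)\<^sup>2) \<le> (\<integral>\<^sup>+h. ennreal (K h * (g (y + h) - g y)\<^sup>2) \<partial>lborel)" for y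
  proof -
    have iKy: "integrable lborel (\<lambda>x. K (x - y))" "(\<integral>x. K (x - y) \<partial>lborel) = 1"
      using lborel_integral_shift[of K "- y"] iK K(4) by auto
    have iKg: "integrable lborel (\<lambda>x. K (x - y) * g x)"
      by (rule integrable_shift_mult[OF g K(1) Ko])
    have iKg2: "integrable lborel (\<lambda>x. K (x - y) * (g x)\<^sup>2)"
      by (rule Bochner_Integration.integrable_bound[OF integrable_mult_right[OF g(2), of B]])
         (use B in \<open>auto simp: abs_mult intro!: mult_right_mono\<close>)
    define m where "m = conv K g y"
    \<comment> \<open>This quadratic polynomial in \<open>c\<close> is minimal at the mean
      \<open>m\<close>. Its nonnegativity at \<open>m\<close>, inserted into its value at
      \<open>g y\<close>, is Jensen's inequality.\<close>
    have exp: "(\<integral>x. K (x - y) * (g x - c)\<^sup>2 \<partial>lborel) = (\<integral>x. K (x - y) * (g x)\<^sup>2 \<partial>lborel) - 2 * c * m + c\<^sup>2"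
      and iexp: "integrable lborel (\<lambda>x. K (x - y) * (g x - c)\<^sup>2)" for c
    proof -
      have eq: "K (x - y) * (g x - c)\<^sup>2 = K (x - y) * (g x)\<^sup>2 - 2 * c * (K (x - y) * g x) + c\<^sup>2 * K (x - y)" for x
        by (simp add: power2_eq_square algebra_simps)
      show "integrable lborel (\<lambda>x. K (x - y) * (g x - c)\<^sup>2)"
        unfolding eq using iKy iKg iKg2 by auto
      show "(\<integral>x. K (x - y) * (g x - c)\<^sup>2 \<partial>lborel) = (\<integral>x. K (x - y) * (g x)\<^sup>2 \<partial>lborel) - 2 * c * m + c\<^sup>2"
        unfolding eq m_def conv_def using iKy iKg iKg2 by simp
    qed
    have "0 \<le> (\<integral>x. K (x - y) * (g x - m)\<^sup>2 \<partial>lborel)" using K(3) by simp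
    then have "(m - g y)\<^sup>2 \<le> (\<integral>x. K (x - y) * (g x - g y)\<^sup>2 \<partial>lborel)"
      unfolding exp by (simp add: power2_eq_square algebra_simps)
    then have "ennreal ((conv K g y - g y)\<^sup>2) \<le> ennreal (\<integral>x. K (x - y) * (g x - g y)\<^sup>2 \<partial>lborel)"
      unfolding m_def by (rule ennreal_leI)
    also have "(\<integral>x. K (x - y) * (g x - g y)\<^sup>2 \<partial>lborel) = (\<integral>h. K h * (g (y + h) - g y)\<^sup>2 \<partial>lborel)"
      using lborel_integral_shift(1)[of "\<lambda>x. K (x - y) * (g x - g y)\<^sup>2" y] by (simp add: add.commute)
    also have "ennreal \<dots> = (\<integral>\<^sup>+h. ennreal (K h * (g (y + h) - g y)\<^sup>2) \<partial>lborel)"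
    proof (rule nn_integral_eq_integral[symmetric])
      show "integrable lborel (\<lambda>h. K h * (g (y + h) - g y)\<^sup>2)"
        using lborel_integral_shift(2)[of "\<lambda>x. K (x - y) * (g x - g y)\<^sup>2" y] iexp by (simp add: add.commute)
    qed (use K(3) in simp)
    finally show ?thesis .
  qed
  have "(\<integral>\<^sup>+y. ennreal ((conv K g y - g y)\<^sup>2) \<partial>lborel) \<le> (\<integral>\<^sup>+y. \<integral>\<^sup>+h. ennreal (K h * (g (y + h) - g y)\<^sup>2) \<partial>lborel \<partial>lborel)"
    by (intro nn_integral_mono pt)
  also have "\<dots> = (\<integral>\<^sup>+h. \<integral>\<^sup>+y. ennreal (K h * (g (y + h) - g y)\<^sup>2) \<partial>lborel \<partial>lborel)"
    by (rule lborel_pair.Fubini'[symmetric]) measurable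
  also have "\<dots> \<le> (\<integral>\<^sup>+h. ennreal (K h) * ennreal e \<partial>lborel)"
  proof (rule nn_integral_mono)
    fix h
    have "(\<integral>\<^sup>+y. ennreal (K h * (g (y + h) - g y)\<^sup>2) \<partial>lborel) = ennreal (K h) * (\<integral>\<^sup>+y. ennreal ((g (y + h) - g y)\<^sup>2) \<partial>lborel)"
      using K(3) by (subst nn_integral_cmult[symmetric]) (auto simp: ennreal_mult)
    also have "\<dots> \<le> ennreal (K h) * ennreal e"
      using K(2)[of h] d[of h] by (cases "norm h < d") (auto intro: mult_left_mono)
    finally show "(\<integral>\<^sup>+y. ennreal (K h * (g (y + h) - g y)\<^sup>2) \<partial>lborel) \<le> ennreal (K h) * ennreal e" .
  qed
  also have "\<dots> = (\<integral>\<^sup>+h. ennreal (K h) \<partial>lborel) * ennreal e"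
    by (rule nn_integral_multc) auto
  also have "(\<integral>\<^sup>+h. ennreal (K h) \<partial>lborel) = 1"
    using nn_integral_eq_integral[OF iK] K(3,4) by simp
  finally have le: "(\<integral>\<^sup>+y. ennreal ((conv K g y - g y)\<^sup>2) \<partial>lborel) \<le> ennreal e" by simp
  show int: "integrable lborel (\<lambda>y. (conv K g y - g y)\<^sup>2)"
    by (rule integrableI_bounded) (use le in \<open>auto intro: le_less_trans\<close>)
  have "ennreal (\<integral>y. (conv K g y - g y)\<^sup>2 \<partial>lborel) \<le> ennreal e"
    using nn_integral_eq_integral[OF int] le by simp
  then show "(\<integral>y. (conv K g y - g y)\<^sup>2 \<partial>lborel) \<le> e" using e by (simp add: ennreal_le_iff)
qed

text \<open>Square integrability of the error is asserted for large \<open>k\<close> only: the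
  estimate applies once the kernel radius has dropped below the translation radius of
  \<open>g\<close>.\<close>

lemma conv_L2_tendsto:
  fixes g :: "'a::euclidean_space \<Rightarrow> real"
  assumes g: "g \<in> borel_measurable borel" "integrable lborel (\<lambda>x. (g x)\<^sup>2)"
    and K: "\<And>k. continuous_on UNIV (K k)" "\<And>k x. norm x \<ge> r k \<Longrightarrow> K k x = 0" "\<And>k x. 0 \<le> K k x"
       "\<And>k. integral\<^sup>L lborel (K k) = 1" and r: "r \<longlonglongrightarrow> (0::real)"
  shows "\<forall>\<^sub>F k in sequentially. integrable lborel (\<lambda>y. (conv (K k) g y - g y)\<^sup>2)"
    "(\<lambda>k. \<integral>y. (conv (K k) g y - g y)\<^sup>2 \<partial>lborel) \<longlonglongrightarrow> 0"
proof -
  have key: "\<forall>\<^sub>F k in sequentially. integrable lborel (\<lambda>y. (conv (K k) g y - g y)\<^sup>2) \<and> (\<integral>y. (conv (K k) g y - g y)\<^sup>2 \<partial>lborel) \<le> e"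
    if e: "0 < e" for e
  proof -
    obtain d where d: "d > 0" "\<And>h. norm h < d \<Longrightarrow> (\<integral>\<^sup>+x. ennreal ((g (x + h) - g x)\<^sup>2) \<partial>lborel) \<le> ennreal e"
      using shift_L2_small[OF g e] by blast
    have "\<forall>\<^sub>F k in sequentially. r k < d" by (rule order_tendstoD(2)[OF r d(1)])
    then show ?thesis
    proof eventually_elim
      fix k assume k: "r k < d"
      then have out: "K k x = 0" if "norm x \<ge> d" for x using K(2)[where k = k and x = x] that by simp
      show "integrable lborel (\<lambda>y. (conv (K k) g y - g y)\<^sup>2) \<and> (\<integral>y. (conv (K k) g y - g y)\<^sup>2 \<partial>lborel) \<le> e"
        using conv_L2_close[OF g d(2) less_imp_le[OF e] K(1) out K(3) K(4)] by blast
    qed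
  qed
  show "\<forall>\<^sub>F k in sequentially. integrable lborel (\<lambda>y. (conv (K k) g y - g y)\<^sup>2)"
    using key[OF zero_less_one] by eventually_elim simp
  show "(\<lambda>k. \<integral>y. (conv (K k) g y - g y)\<^sup>2 \<partial>lborel) \<longlonglongrightarrow> 0"
  proof (rule tendstoI)
    fix e :: real assume "0 < e"
    then have "\<forall>\<^sub>F k in sequentially. integrable lborel (\<lambda>y. (conv (K k) g y - g y)\<^sup>2) \<and> (\<integral>y. (conv (K k) g y - g y)\<^sup>2 \<partial>lborel) \<le> e / 2"
      by (intro key) simp
    then show "\<forall>\<^sub>F k in sequentially. dist (\<integral>y. (conv (K k) g y - g y)\<^sup>2 \<partial>lborel) 0 < e"
      by eventually_elim (use \<open>0 < e\<close> in simp)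
  qed
qed

text \<open>The difference v w - g f equals (v - g)(w - f) + f (v - g) + g (w - f), and
  Cauchy-Schwarz makes every term small; the weight is merely bounded. The three terms form the
  error \<open>E\<close>.\<close>

lemma L2_tendsto_weighted_product:
  fixes v w :: "nat \<Rightarrow> 'a \<Rightarrow> real"
  assumes m[measurable]: "g \<in> borel_measurable M" "f \<in> borel_measurable M" "A \<in> borel_measurable M"
      "\<And>k. v k \<in> borel_measurable M" "\<And>k. w k \<in> borel_measurable M"
    and sq: "integrable M (\<lambda>x. (g x)\<^sup>2)" "integrable M (\<lambda>x. (f x)\<^sup>2)"
    and A: "\<And>x. \<bar>A x\<bar> \<le> B"
    and v: "\<forall>\<^sub>F k in sequentially. integrable M (\<lambda>x. (v k x - g x)\<^sup>2)" "(\<lambda>k. \<integral>x. (v k x - g x)\<^sup>2 \<partial>M) \<longlonglongrightarrow> 0"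
    and w: "\<forall>\<^sub>F k in sequentially. integrable M (\<lambda>x. (w k x - f x)\<^sup>2)" "(\<lambda>k. \<integral>x. (w k x - f x)\<^sup>2 \<partial>M) \<longlonglongrightarrow> 0"
  shows "\<forall>\<^sub>F k in sequentially. integrable M (\<lambda>x. A x * (v k x * w k x))"
    "(\<lambda>k. \<integral>x. A x * (v k x * w k x) \<partial>M) \<longlonglongrightarrow> (\<integral>x. A x * (g x * f x) \<partial>M)"
proof -
  have Asq: "integrable M (\<lambda>x. (A x * u x)\<^sup>2)" "(\<integral>x. (A x * u x)\<^sup>2 \<partial>M) \<le> B\<^sup>2 * (\<integral>x. (u x)\<^sup>2 \<partial>M)"
    if [measurable]: "u \<in> borel_measurable M" and u: "integrable M (\<lambda>x. (u x)\<^sup>2)" for u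
  proof -
    have le: "(A x * u x)\<^sup>2 \<le> B\<^sup>2 * (u x)\<^sup>2" for x
      using power_mono[OF A[of x], of 2] by (simp add: power_mult_distrib mult_right_mono)
    show "integrable M (\<lambda>x. (A x * u x)\<^sup>2)"
      by (rule Bochner_Integration.integrable_bound[OF integrable_mult_right[OF u, of "B\<^sup>2"]]) (use le in auto)
    then show "(\<integral>x. (A x * u x)\<^sup>2 \<partial>M) \<le> B\<^sup>2 * (\<integral>x. (u x)\<^sup>2 \<partial>M)"
      using u le by (subst integral_mult_right_zero[symmetric]) (intro integral_mono integrable_mult_right)
  qed
  let ?V = "\<lambda>k. \<integral>x. (v k x - g x)\<^sup>2 \<partial>M" and ?W = "\<lambda>k. \<integral>x. (w k x - f x)\<^sup>2 \<partial>M"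
  let ?G = "\<integral>x. (A x * g x)\<^sup>2 \<partial>M" and ?F = "\<integral>x. (A x * f x)\<^sup>2 \<partial>M"
  define E where "E k = sqrt (B\<^sup>2 * ?V k) * sqrt (?W k) + sqrt ?F * sqrt (?V k) + sqrt ?G * sqrt (?W k)" for k
  have E: "E \<longlonglongrightarrow> 0"
  proof -
    have "E \<longlonglongrightarrow> sqrt (B\<^sup>2 * 0) * sqrt 0 + sqrt ?F * sqrt 0 + sqrt ?G * sqrt 0"
      unfolding E_def by (intro tendsto_intros v(2) w(2))
    then show ?thesis by simp
  qed
  have key: "\<forall>\<^sub>F k in sequentially. integrable M (\<lambda>x. A x * (v k x * w k x)) \<and>
     norm ((\<integral>x. A x * (v k x * w k x) \<partial>M) - (\<integral>x. A x * (g x * f x) \<partial>M)) \<le> E k"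
    using v(1) w(1)
  proof eventually_elim
    fix k assume vk: "integrable M (\<lambda>x. (v k x - g x)\<^sup>2)" and wk: "integrable M (\<lambda>x. (w k x - f x)\<^sup>2)"
    have 1: "integrable M (\<lambda>x. (A x * (v k x - g x)) * (w k x - f x))"
      "\<bar>\<integral>x. (A x * (v k x - g x)) * (w k x - f x) \<partial>M\<bar> \<le> sqrt (\<integral>x. (A x * (v k x - g x))\<^sup>2 \<partial>M) * sqrt (?W k)"
      by (rule real_Cauchy_Schwarz_integral; use Asq(1)[OF _ vk] wk in simp)+
    have i1: "sqrt (\<integral>x. (A x * (v k x - g x))\<^sup>2 \<partial>M) * sqrt (?W k) \<le> sqrt (B\<^sup>2 * ?V k) * sqrt (?W k)"
      using Asq(2)[OF _ vk] by (intro mult_right_mono) auto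
    have 2: "integrable M (\<lambda>x. (A x * f x) * (v k x - g x))"
      "\<bar>\<integral>x. (A x * f x) * (v k x - g x) \<partial>M\<bar> \<le> sqrt ?F * sqrt (?V k)"
      by (rule real_Cauchy_Schwarz_integral; use Asq(1)[OF _ sq(2)] vk in simp)+
    have 3: "integrable M (\<lambda>x. (A x * g x) * (w k x - f x))"
      "\<bar>\<integral>x. (A x * g x) * (w k x - f x) \<partial>M\<bar> \<le> sqrt ?G * sqrt (?W k)"
      by (rule real_Cauchy_Schwarz_integral; use Asq(1)[OF _ sq(1)] wk in simp)+
    have 4: "integrable M (\<lambda>x. (A x * g x) * f x)"
      by (rule real_Cauchy_Schwarz_integral(1); use Asq(1)[OF _ sq(1)] sq(2) in simp)
    have eq: "A x * (v k x * w k x) = (A x * (v k x - g x)) * (w k x - f x) + (A x * f x) * (v k x - g x) + (A x * g x) * (w k x - f x) + (A x * g x) * f x" for x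
      by (simp add: algebra_simps)
    have i: "integrable M (\<lambda>x. A x * (v k x * w k x))"
      unfolding eq by (intro Bochner_Integration.integrable_add 1 2 3 4)
    have "(\<integral>x. A x * (v k x * w k x) \<partial>M) = (\<integral>x. (A x * (v k x - g x)) * (w k x - f x) \<partial>M) + (\<integral>x. (A x * f x) * (v k x - g x) \<partial>M)
       + (\<integral>x. (A x * g x) * (w k x - f x) \<partial>M) + (\<integral>x. (A x * g x) * f x \<partial>M)"
      unfolding eq using 1(1) 2(1) 3(1) 4
      by (simp only: Bochner_Integration.integral_add Bochner_Integration.integrable_add)
    then have "norm ((\<integral>x. A x * (v k x * w k x) \<partial>M) - (\<integral>x. A x * (g x * f x) \<partial>M)) \<le> E k"
      using 1(2) i1 2(2) 3(2) unfolding E_def real_norm_def mult.assoc by linarith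
    with i show "integrable M (\<lambda>x. A x * (v k x * w k x)) \<and>
     norm ((\<integral>x. A x * (v k x * w k x) \<partial>M) - (\<integral>x. A x * (g x * f x) \<partial>M)) \<le> E k" by simp
  qed
  show "\<forall>\<^sub>F k in sequentially. integrable M (\<lambda>x. A x * (v k x * w k x))"
    using key by eventually_elim simp
  show "(\<lambda>k. \<integral>x. A x * (v k x * w k x) \<partial>M) \<longlonglongrightarrow> (\<integral>x. A x * (g x * f x) \<partial>M)"
  proof (rule LIM_zero_cancel, rule Lim_null_comparison[OF _ E])
    show "\<forall>\<^sub>F k in sequentially. norm ((\<integral>x. A x * (v k x * w k x) \<partial>M) - (\<integral>x. A x * (g x * f x) \<partial>M)) \<le> E k"
      using key by eventually_elim simp
  qed
qed

section \<open>An integral inequality for weak solutions\<close>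

(* Integrate the divergence of \<eta>^2 v grad v - \<eta>^2 v^2 F and drop |grad (\<eta> v) - \<eta> v F|^2 >= 0. *)
lemma vanishing_weighted_gradient_inequality:
  fixes v \<eta> :: "real^'n::finite \<Rightarrow> real"
  assumes v: "\<And>i x. has_pd i v (v1 i x) x" "\<And>i x. has_pd i (v1 i) (v2 i x) x"
      "continuous_on UNIV v" "\<And>i. continuous_on UNIV (v1 i)" "\<And>i. continuous_on UNIV (v2 i)"
    and \<eta>: "\<And>i x. has_pd i \<eta> (\<eta>1 i x) x" "continuous_on UNIV \<eta>" "\<And>i. continuous_on UNIV (\<eta>1 i)"
      "\<And>x. norm x > R \<Longrightarrow> \<eta> x = 0"
    and F: "\<And>i x. has_pd i (\<lambda>x. (\<eta> x)\<^sup>2 * F i x) (2 * \<eta> x * \<eta>1 i x * F i x + (\<eta> x)\<^sup>2 * F1 i x) x"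
      "\<And>i. continuous_on UNIV (\<lambda>x. (\<eta> x)\<^sup>2 * F i x)"
      "\<And>i. continuous_on UNIV (\<lambda>x. 2 * \<eta> x * \<eta>1 i x * F i x + (\<eta> x)\<^sup>2 * F1 i x)"
    and c: "continuous_on UNIV c" "\<And>x. norm x > R \<Longrightarrow> c x = 0"
      "\<And>x. c x = - (\<Sum>i\<in>UNIV. (\<eta> x)\<^sup>2 * ((F i x)\<^sup>2 + F1 i x) + (\<eta>1 i x)\<^sup>2)"
  shows "(\<integral>x. c x * (v x * v x) + (\<eta> x)\<^sup>2 * (v x * (\<Sum>i\<in>UNIV. v2 i x)) \<partial>lborel) \<le> 0"
proof -
  define G where "G i x = (\<eta> x)\<^sup>2 * F i x" for i x
  define D where "D i x = 2 * \<eta> x * \<eta>1 i x * F i x + (\<eta> x)\<^sup>2 * F1 i x" for i x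
  have G: "has_pd i (G i) (D i x) x" "continuous_on UNIV (G i)" "continuous_on UNIV (D i)" for i x
    using F[of i] by (simp_all add: G_def[abs_def] D_def[abs_def])
  define X where "X i x = (\<eta> x * \<eta> x) * (v x * v1 i x) - (v x * v x) * G i x" for i x
  define dX where "dX i x = ((\<eta> x * \<eta> x) * (v x * v2 i x + v1 i x * v1 i x) + (\<eta> x * \<eta>1 i x + \<eta>1 i x * \<eta> x) * (v x * v1 i x))
     - ((v x * v x) * D i x + (v x * v1 i x + v1 i x * v x) * G i x)" for i x
  have pdX: "has_pd i (X i) (dX i x) x" for i x
    unfolding X_def dX_def 
    by (rule has_pd_diff[OF has_pd_mult[OF has_pd_mult[OF \<eta>(1) \<eta>(1)] has_pd_mult[OF v(1) v(2)]]
          has_pd_mult[OF has_pd_mult[OF v(1) v(1)] G(1)]])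
  have cX: "continuous_on UNIV (X i)" "continuous_on UNIV (dX i)" for i
    unfolding X_def dX_def by (intro continuous_intros v(3-5) \<eta>(2,3) G(2,3))+
  have out: "X i x = 0" if "norm x > R" for i x
    using \<eta>(4)[OF that] by (simp add: X_def G_def)
  have dint: "integrable lborel (dX i)" "integral\<^sup>L lborel (dX i) = 0" for i
    using integral_pd_eq_0[OF pdX cX out] by auto
  have pt: "c x * (v x * v x) + (\<eta> x)\<^sup>2 * (v x * (\<Sum>i\<in>UNIV. v2 i x)) \<le> (\<Sum>i\<in>UNIV. dX i x)" for x
  proof -
    have "c x * (v x * v x) + (\<eta> x)\<^sup>2 * (v x * (\<Sum>i\<in>UNIV. v2 i x))
      = (\<Sum>i\<in>UNIV. - ((\<eta> x)\<^sup>2 * ((F i x)\<^sup>2 + F1 i x) + (\<eta>1 i x)\<^sup>2) * (v x * v x) + (\<eta> x)\<^sup>2 * (v x * v2 i x))"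
      unfolding c(3) by (simp only: sum_negf[symmetric] sum_distrib_right sum_distrib_left sum.distrib[symmetric])
    also have "\<dots> \<le> (\<Sum>i\<in>UNIV. dX i x)"
    proof (rule sum_mono)
      fix i
      have "dX i x - (- ((\<eta> x)\<^sup>2 * ((F i x)\<^sup>2 + F1 i x) + (\<eta>1 i x)\<^sup>2) * (v x * v x) + (\<eta> x)\<^sup>2 * (v x * v2 i x))
        = (\<eta>1 i x * v x + \<eta> x * v1 i x - \<eta> x * v x * F i x)\<^sup>2"
        unfolding dX_def G_def D_def by (simp add: power2_eq_square algebra_simps)
      then show "- ((\<eta> x)\<^sup>2 * ((F i x)\<^sup>2 + F1 i x) + (\<eta>1 i x)\<^sup>2) * (v x * v x) + (\<eta> x)\<^sup>2 * (v x * v2 i x) \<le> dX i x"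
        using zero_le_power2[of "\<eta>1 i x * v x + \<eta> x * v1 i x - \<eta> x * v x * F i x"] by linarith
    qed
    finally show ?thesis .
  qed
  have "integrable lborel (\<lambda>x. c x * (v x * v x) + (\<eta> x)\<^sup>2 * (v x * (\<Sum>i\<in>UNIV. v2 i x)))"
    by (rule integrable_cont_compact_support[where R = R]) (auto intro!: continuous_intros v(3-5) \<eta>(2) c(1) simp: c(2) \<eta>(4))
  then have "(\<integral>x. c x * (v x * v x) + (\<eta> x)\<^sup>2 * (v x * (\<Sum>i\<in>UNIV. v2 i x)) \<partial>lborel) \<le> (\<integral>x. (\<Sum>i\<in>UNIV. dX i x) \<partial>lborel)"
    using dint by (intro integral_mono pt) auto
  also have "\<dots> = 0" using dint by simp
  finally show ?thesis .
qed

text \<open>The pure first and second derivatives travel with the kernel, so that its Laplacian is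
  the sum of the \<open>K2 i\<close>. The last clause makes every translate available as a complex
  test function.\<close>

definition mollifier :: "real \<Rightarrow> (real^'n::finite \<Rightarrow> real) \<Rightarrow> ('n \<Rightarrow> real^'n \<Rightarrow> real) \<Rightarrow> ('n \<Rightarrow> real^'n \<Rightarrow> real) \<Rightarrow> bool" where
  "mollifier e K K1 K2 \<longleftrightarrow>
     (\<forall>i x. has_pd i K (K1 i x) x) \<and> (\<forall>i x. has_pd i (K1 i) (K2 i x) x) \<and>
     continuous_on UNIV K \<and> (\<forall>i. continuous_on UNIV (K1 i)) \<and> (\<forall>i. continuous_on UNIV (K2 i)) \<and>
     (\<forall>x. 0 \<le> K x) \<and> (\<forall>x. norm x \<ge> e \<longrightarrow> K x = 0) \<and> integral\<^sup>L lborel K = 1 \<and>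
     (\<forall>y. smooth_fun (\<lambda>x. complex_of_real (K (x - y))))"

lemma AE_not_in_ball:
  fixes z :: "'a::euclidean_space"
  assumes "AE x in lborel. x \<notin> ball z r"
  shows "r \<le> 0"
proof (rule ccontr)
  assume "\<not> r \<le> 0"
  then have "0 < measure lborel (ball z r)" by (simp add: content_ball_pos)
  moreover have "emeasure lborel (ball z r) = 0"
    using AE_iff_measurable[of "ball z r" lborel "\<lambda>x. x \<notin> ball z r"] assms by (simp del: mem_ball)
  ultimately show False by (simp add: measure_def)
qed

lemma mollifier_exists:
  assumes e: "0 < e"
  shows "\<exists>K K1 K2. mollifier e (K :: real^'n::finite \<Rightarrow> real) K1 K2"
proof -
  let ?N = "CARD('n)"
  \<comment> \<open>A vector of norm at least \<open>e\<close> has a coordinate of modulus at least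
    \<open>e / CARD('n)\<close>, because the norm is at most the sum of the moduli. The product of
    factors of radius \<open>e'\<close> thus lives in the ball of radius \<open>e\<close>.\<close>
  define e' where "e' = e / ?N"
  have e': "e' > 0" using e by (simp add: e'_def)
  define P where "P c x = (\<Prod>j\<in>UNIV. bump [:c:] 0 ((x :: real^'n) $ j / e'))" for c x
  have bs: "(\<lambda>t. bump [:c:] 0 (t / e')) \<in> bumps e'" for c by (auto simp: bumps_def)
  have cont: "continuous_on UNIV f" if "f \<in> bumps e'" for f
    using bumps_derivative[OF that e'] by (metis DERIV_isCont continuous_at_imp_continuous_on)
  have cprod: "continuous_on UNIV (\<lambda>x :: real^'n. \<Prod>j\<in>UNIV. G j (x $ j))" if "\<And>j. G j \<in> bumps e'" for G
    by (intro continuous_intros continuous_on_compose2[OF cont[OF that]]) auto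
  have outside: "(\<Prod>j\<in>UNIV. G j (x $ j)) = 0" if "norm x \<ge> e" "\<And>j. G j \<in> bumps e'" for G and x :: "real^'n"
  proof -
    have "\<exists>j. \<bar>x $ j\<bar> \<ge> e'"
    proof (rule ccontr)
      assume "\<not> ?thesis"
      then have "(\<Sum>j\<in>UNIV. \<bar>x $ j\<bar>) < (\<Sum>j\<in>(UNIV :: 'n set). e')"
        by (intro sum_strict_mono) (auto simp: not_le)
      also have "\<dots> = e" by (simp add: e'_def)
      finally show False using norm_le_l1_cart[of x] that(1) by linarith
    qed
    then obtain j where "\<bar>x $ j\<bar> \<ge> e'" by blast
    then have "G j (x $ j) = 0" using bumps_outside[OF that(2) e'] by blast
    then show ?thesis by (intro prod_zero) auto
  qed
  have cP: "continuous_on UNIV (P c)" for c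
    unfolding P_def using cprod[of "\<lambda>_ t. bump [:c:] 0 (t / e')"] bs by simp
  have oP: "P c x = 0" if "norm x \<ge> e" for c x
    unfolding P_def using outside[OF that, of "\<lambda>_ t. bump [:c:] 0 (t / e')"] bs by simp
  have iP: "integrable lborel (P c)" for c
    by (rule integrable_cont_compact_support[OF cP, of e]) (simp add: oP)
  define I where "I = integral\<^sup>L lborel (P 1)"
  have P1: "0 \<le> P 1 x" for x unfolding P_def by (intro prod_nonneg) (simp add: bump_def)
  have I: "I > 0"
  proof -
    have "I \<noteq> 0"
    proof
      assume "I = 0"
      then have "AE x in lborel. P 1 x = 0"
        using integral_nonneg_eq_0_iff_AE[OF iP] P1 unfolding I_def by simp
      then have "AE x in lborel. x \<notin> ball (0 :: real^'n) e'"
      proof eventually_elim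
        fix x :: "real^'n" assume "P 1 x = 0"
        then obtain j where "bump [:1:] 0 (x $ j / e') = 0" by (auto simp: P_def one_pCons)
        then have "\<bar>x $ j\<bar> \<ge> e'"
          using e' by (auto simp: bump_def split: if_splits)
        then show "x \<notin> ball 0 e'" using component_le_norm_cart[of x j] by simp
      qed
      then show False using AE_not_in_ball[of "0 :: real^'n" e'] e' by simp
    qed
    moreover have "0 \<le> I" unfolding I_def using P1 by simp
    ultimately show ?thesis by simp
  qed
  \<comment> \<open>The normalising factor \<open>1 / I\<close> is distributed evenly over the
    one-dimensional factors, which keeps the kernel a product of bumps.\<close>
  define c where "c = root ?N (1 / I)"
  have c: "c \<ge> 0" "c ^ ?N = 1 / I" using I by (auto simp: c_def)
  define \<beta> where "\<beta> t = bump [:c:] 0 (t / e')" for t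
  have \<beta>b: "\<beta> \<in> bumps e'" using bs[of c] by (simp add: \<beta>_def[abs_def])
  obtain \<beta>1 where \<beta>1: "\<beta>1 \<in> bumps e'" "\<And>t. (\<beta> has_real_derivative \<beta>1 t) (at t)"
    using bumps_derivative[OF \<beta>b e'] by blast
  obtain \<beta>2 where \<beta>2: "\<beta>2 \<in> bumps e'" "\<And>t. (\<beta>1 has_real_derivative \<beta>2 t) (at t)"
    using bumps_derivative[OF \<beta>1(1) e'] by blast
  define K where "K x = (\<Prod>j\<in>UNIV. \<beta> (x $ j))" for x :: "real^'n"
  define K1 where "K1 i x = (\<Prod>j\<in>UNIV. ((\<lambda>_. \<beta>)(i := \<beta>1)) j (x $ j))" for i and x :: "real^'n"
  define K2 where "K2 i x = (\<Prod>j\<in>UNIV. ((\<lambda>_. \<beta>)(i := \<beta>1, i := \<beta>2)) j (x $ j))" for i and x :: "real^'n"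
  have KP: "K x = P 1 x / I" for x
  proof -
    have "\<beta> t = c * bump [:1:] 0 (t / e')" for t by (simp add: \<beta>_def bump_def)
    then show ?thesis using c(2) by (simp add: K_def P_def prod.distrib)
  qed
  have "mollifier e K K1 K2"
    unfolding mollifier_def
  proof (intro conjI allI impI)
    show "has_pd i K (K1 i x) x" for i x
      unfolding K_def K1_def using has_pd_prod[of "\<lambda>_. \<beta>" i \<beta>1 x] \<beta>1(2) by simp
    show "has_pd i (K1 i) (K2 i x) x" for i x
      unfolding K1_def K2_def using \<beta>2(2) by (intro has_pd_prod) simp
    show "continuous_on UNIV K" unfolding K_def by (intro cprod \<beta>b)
    show "continuous_on UNIV (K1 i)" for i unfolding K1_def by (intro cprod) (simp add: \<beta>b \<beta>1)
    show "continuous_on UNIV (K2 i)" for i unfolding K2_def by (intro cprod) (simp add: \<beta>b \<beta>2)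
    show "0 \<le> K x" for x unfolding KP using P1 I by simp
    show "K x = 0" if "norm x \<ge> e" for x unfolding KP using oP[OF that] by simp
    show "integral\<^sup>L lborel K = 1" unfolding KP[abs_def] using I by (simp add: I_def)
    show "smooth_fun (\<lambda>x. complex_of_real (K (x - y)))" for y
      unfolding K_def by (rule smooth_fun_prod[where S = "bumps e'"]) (auto intro: bumps_derivative e' \<beta>b)
  qed
  then show ?thesis by blast
qed


text \<open>The mollified \<open>g\<close> is a classical solution on the support of \<eta>, up to
  mollifying the right-hand side, so the smooth inequality applies to it. The margin
  \<open>r\<close> between this support and the complement of \<open>A\<close> absorbs the kernel
  radius, and the bounded weights permit passage to the limit in the mean square.\<close>

lemma weak_solution_inequality:
  fixes g q \<eta> :: "real^'n::finite \<Rightarrow> real"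
  assumes g[measurable]: "g \<in> borel_measurable borel" "integrable lborel (\<lambda>x. (g x)\<^sup>2)"
    and q[measurable]: "q \<in> borel_measurable borel" and A[measurable]: "A \<in> sets borel"
    and qA: "\<And>x. x \<in> A \<Longrightarrow> \<bar>q x\<bar> \<le> M"
    and r: "r > 0" "\<And>y. \<eta> y \<noteq> 0 \<Longrightarrow> ball y r \<subseteq> A"
    and weak: "\<And>K K1 K2 e y. mollifier e K K1 K2 \<Longrightarrow> e < r \<Longrightarrow> ball y r \<subseteq> A \<Longrightarrow>
       (\<Sum>i\<in>UNIV. conv (K2 i) g y) = conv K (\<lambda>x. q x * g x) y"
    and \<eta>: "\<And>i x. has_pd i \<eta> (\<eta>1 i x) x" "continuous_on UNIV \<eta>" "\<And>i. continuous_on UNIV (\<eta>1 i)"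
      "\<And>x. norm x > R \<Longrightarrow> \<eta> x = 0"
    and F: "\<And>i x. has_pd i (\<lambda>x. (\<eta> x)\<^sup>2 * F i x) (2 * \<eta> x * \<eta>1 i x * F i x + (\<eta> x)\<^sup>2 * F1 i x) x"
      "\<And>i. continuous_on UNIV (\<lambda>x. (\<eta> x)\<^sup>2 * F i x)"
      "\<And>i. continuous_on UNIV (\<lambda>x. 2 * \<eta> x * \<eta>1 i x * F i x + (\<eta> x)\<^sup>2 * F1 i x)"
    and c: "continuous_on UNIV c" "\<And>x. norm x > R \<Longrightarrow> c x = 0"
      "\<And>x. c x = - (\<Sum>i\<in>UNIV. (\<eta> x)\<^sup>2 * ((F i x)\<^sup>2 + F1 i x) + (\<eta>1 i x)\<^sup>2)"
  shows "(\<integral>x. (c x + (\<eta> x)\<^sup>2 * q x) * (g x)\<^sup>2 \<partial>lborel) \<le> 0"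
proof -
  \<comment> \<open>\<open>q\<close> may be unbounded near the poles. Restricting it to
    \<open>A\<close> makes the right-hand side square integrable on the whole space.\<close>
  define f where "f x = indicator A x * q x * g x" for x
  have fm[measurable]: "f \<in> borel_measurable borel" unfolding f_def by measurable
  have [measurable]: "\<eta> \<in> borel_measurable borel" "c \<in> borel_measurable borel"
    using \<eta> c by (auto intro: borel_measurable_continuous_onI)
  obtain Bc where Bc: "Bc > 0" "\<And>x. norm (c x) \<le> Bc"
    using bounded_cont_compact_support[OF c(1,2)] by blast
  obtain B\<eta> where B\<eta>: "B\<eta> > 0" "\<And>x. norm (\<eta> x) \<le> B\<eta>"
    using bounded_cont_compact_support[OF \<eta>(2,4)] by blast
  have \<eta>2: "\<bar>(\<eta> x)\<^sup>2\<bar> \<le> B\<eta>\<^sup>2" for x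
    using power_mono[OF B\<eta>(2)[of x], of 2] by simp
  have fsq: "integrable lborel (\<lambda>x. (f x)\<^sup>2)"
  proof (rule Bochner_Integration.integrable_bound[OF integrable_mult_right[OF g(2), of "M\<^sup>2"]])
    have "norm ((f x)\<^sup>2) \<le> norm (M\<^sup>2 * (g x)\<^sup>2)" for x
      using power_mono[OF qA[of x], of 2] by (auto simp: f_def indicator_def power_mult_distrib mult_right_mono)
    then show "AE x in lborel. norm ((f x)\<^sup>2) \<le> norm (M\<^sup>2 * (g x)\<^sup>2)" by simp
  qed measurable
  define e where "e k = r / real (k + 2)" for k :: nat
  have e: "e k > 0" "e k < r" for k using r(1) by (auto simp: e_def field_simps add_pos_nonneg)
  have e0: "e \<longlonglongrightarrow> 0"
    unfolding e_def by real_asymp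
  have "\<forall>k. \<exists>K. \<exists>K1 K2. mollifier (e k) (K :: real^'n \<Rightarrow> real) K1 K2"
    using mollifier_exists e(1) by blast
  from choice[OF this] obtain K :: "nat \<Rightarrow> real^'n \<Rightarrow> real" where "\<forall>k. \<exists>K1 K2. mollifier (e k) (K k) K1 K2" ..
  from choice[OF this] obtain K1 where "\<forall>k. \<exists>K2. mollifier (e k) (K k) (K1 k) K2" ..
  from choice[OF this] obtain K2 where "\<forall>k. mollifier (e k) (K k) (K1 k) (K2 k)" ..
  then have mol: "mollifier (e k) (K k) (K1 k) (K2 k)" for k by simp
  have K: "has_pd i (K k) (K1 k i x) x" "has_pd i (K1 k i) (K2 k i x) x" "continuous_on UNIV (K k)"
     "continuous_on UNIV (K1 k i)" "continuous_on UNIV (K2 k i)" "0 \<le> K k x" "norm x \<ge> e k \<Longrightarrow> K k x = 0" "integral\<^sup>L lborel (K k) = 1"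
    for k i x using mol[of k] by (auto simp: mollifier_def)
  have out: "norm x > e k \<Longrightarrow> K k x = 0" for k x using K(7) by simp
  have out1: "K1 k i x = 0" if "norm x > e k" for k i x
    using has_pd_outside[OF out K(1) that] .
  have out2: "K2 k i x = 0" if "norm x > e k" for k i x
    using has_pd_outside[OF out1 K(2) that] .
  define v where "v k = conv (K k) g" for k
  define w where "w k = conv (K k) f" for k
  have pd1: "has_pd i (v k) (- conv (K1 k i) g x) x" for k i x
    unfolding v_def by (rule has_pd_conv[OF g K(3) out K(4) K(1)])
  have pd2: "has_pd i (\<lambda>x. - conv (K1 k i) g x) (- (- conv (K2 k i) g x)) x" for k i x
    by (rule has_pd_minus[OF has_pd_conv[OF g K(4) out1 K(5) K(2)]])
  have cv: "continuous_on UNIV (v k)" "continuous_on UNIV (w k)" for k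
    unfolding v_def w_def
    using continuous_on_conv[OF g K(3) out] continuous_on_conv[OF fm fsq K(3) out] by simp_all
  have cv1: "continuous_on UNIV (\<lambda>x. - conv (K1 k i) g x)" for k i
    by (intro continuous_on_minus continuous_on_conv[OF g K(4) out1])
  have cv2: "continuous_on UNIV (\<lambda>x. - (- conv (K2 k i) g x))" for k i
    by (intro continuous_on_minus continuous_on_conv[OF g K(5) out2])
  have [measurable]: "v k \<in> borel_measurable borel" "w k \<in> borel_measurable borel" for k
    using cv by (auto intro: borel_measurable_continuous_onI)
  have le0: "(\<integral>x. c x * (v k x * v k x) + (\<eta> x)\<^sup>2 * (v k x * w k x) \<partial>lborel) \<le> 0" for k
  proof -
    have eq: "(\<eta> x)\<^sup>2 * (v k x * (\<Sum>i\<in>UNIV. - (- conv (K2 k i) g x))) = (\<eta> x)\<^sup>2 * (v k x * w k x)" for x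
    proof (cases "\<eta> x = 0")
      case False
      note bA = r(2)[OF False]
      have "(\<Sum>i\<in>UNIV. conv (K2 k i) g x) = conv (K k) (\<lambda>x. q x * g x) x"
        by (rule weak[OF mol e(2) bA])
      \<comment> \<open>The kernel sees only the ball of radius \<open>e k < r\<close> around
        \<open>x\<close>, which lies in \<open>A\<close>; there the truncation in \<open>f\<close>
        is invisible.\<close>
      also have "\<dots> = w k x"
        unfolding w_def conv_def
      proof (intro Bochner_Integration.integral_cong refl)
        fix z
        show "K k (z - x) * (q z * g z) = K k (z - x) * f z"
        proof (cases "norm (z - x) \<ge> e k")
          case False
          then have "z \<in> ball x r" using e(2)[of k] by (simp add: dist_norm norm_minus_commute)
          then show ?thesis using bA by (auto simp: f_def)
        qed (simp add: K(7))
      qed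
      finally show ?thesis by simp
    qed simp
    show ?thesis
      using vanishing_weighted_gradient_inequality[where R = R, OF pd1[of _ k] pd2[of _ k] cv(1)[of k] cv1[of k] cv2[of k]
          \<eta>(1-3) _ F c(1) _ c(3)] \<eta>(4) c(2) unfolding eq by blast
  qed
  have gg: "\<forall>\<^sub>F k in sequentially. integrable lborel (\<lambda>x. (v k x - g x)\<^sup>2)" "(\<lambda>k. \<integral>x. (v k x - g x)\<^sup>2 \<partial>lborel) \<longlonglongrightarrow> 0"
    unfolding v_def by (rule conv_L2_tendsto[OF g K(3) K(7) K(6) K(8) e0]; assumption)+
  have ff: "\<forall>\<^sub>F k in sequentially. integrable lborel (\<lambda>x. (w k x - f x)\<^sup>2)" "(\<lambda>k. \<integral>x. (w k x - f x)\<^sup>2 \<partial>lborel) \<longlonglongrightarrow> 0"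
    unfolding w_def by (rule conv_L2_tendsto[OF fm fsq K(3) K(7) K(6) K(8) e0]; assumption)+
  have 1: "\<forall>\<^sub>F k in sequentially. integrable lborel (\<lambda>x. c x * (v k x * v k x))"
     "(\<lambda>k. \<integral>x. c x * (v k x * v k x) \<partial>lborel) \<longlonglongrightarrow> (\<integral>x. c x * (g x * g x) \<partial>lborel)"
    by (rule L2_tendsto_weighted_product[where B = Bc]; use Bc g gg in simp)+
  have 2: "\<forall>\<^sub>F k in sequentially. integrable lborel (\<lambda>x. (\<eta> x)\<^sup>2 * (v k x * w k x))"
     "(\<lambda>k. \<integral>x. (\<eta> x)\<^sup>2 * (v k x * w k x) \<partial>lborel) \<longlonglongrightarrow> (\<integral>x. (\<eta> x)\<^sup>2 * (g x * f x) \<partial>lborel)"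
    by (rule L2_tendsto_weighted_product[where B = "B\<eta>\<^sup>2"]; use \<eta>2 g fsq gg ff in simp)+
  have "(\<integral>x. c x * (g x * g x) \<partial>lborel) + (\<integral>x. (\<eta> x)\<^sup>2 * (g x * f x) \<partial>lborel) \<le> 0"
  proof (rule tendsto_upperbound[OF tendsto_add[OF 1(2) 2(2)]])
    show "\<forall>\<^sub>F k in sequentially. (\<integral>x. c x * (v k x * v k x) \<partial>lborel) + (\<integral>x. (\<eta> x)\<^sup>2 * (v k x * w k x) \<partial>lborel) \<le> 0"
      using 1(1) 2(1)
    proof eventually_elim
      fix k assume "integrable lborel (\<lambda>x. c x * (v k x * v k x))" "integrable lborel (\<lambda>x. (\<eta> x)\<^sup>2 * (v k x * w k x))"
      then show "(\<integral>x. c x * (v k x * v k x) \<partial>lborel) + (\<integral>x. (\<eta> x)\<^sup>2 * (v k x * w k x) \<partial>lborel) \<le> 0"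
        using le0[of k] by simp
    qed
  qed simp
  moreover have "integrable lborel (\<lambda>x. c x * (g x * g x))"
    by (rule Bochner_Integration.integrable_bound[OF integrable_mult_right[OF g(2), of Bc]])
       (use Bc in \<open>auto simp: abs_mult power2_eq_square intro!: mult_right_mono\<close>)
  moreover have "integrable lborel (\<lambda>x. (\<eta> x)\<^sup>2 * (g x * f x))"
  proof (rule Bochner_Integration.integrable_bound[OF integrable_mult_right[OF real_Cauchy_Schwarz_integral(1)[of g lborel f], of "B\<eta>\<^sup>2"]])
    have "norm ((\<eta> x)\<^sup>2 * (g x * f x)) \<le> norm (B\<eta>\<^sup>2 * (g x * f x))" for x
      using \<eta>2[of x] by (auto simp: abs_mult intro!: mult_right_mono)
    then show "AE x in lborel. norm ((\<eta> x)\<^sup>2 * (g x * f x)) \<le> norm (B\<eta>\<^sup>2 * (g x * f x))" by simp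
  qed (use g fsq in auto)
  ultimately have "(\<integral>x. c x * (g x * g x) + (\<eta> x)\<^sup>2 * (g x * f x) \<partial>lborel) \<le> 0" by simp
  moreover have "c x * (g x * g x) + (\<eta> x)\<^sup>2 * (g x * f x) = (c x + (\<eta> x)\<^sup>2 * q x) * (g x)\<^sup>2" for x
  proof (cases "\<eta> x = 0")
    case False
    then have "x \<in> A" using r(1) r(2)[OF False] centre_in_ball[of x r] by blast
    then show ?thesis by (simp add: f_def power2_eq_square algebra_simps)
  qed (simp add: power2_eq_square)
  ultimately show ?thesis by simp
qed

section \<open>Test functions and the operator\<close>

lemma smooth_fun_has_pd:
  assumes "smooth_fun f"
  shows "has_pd i (iter_partial is f) (iter_partial (i # is) f x) x"
  using assms unfolding smooth_fun_def has_pd_def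
  by (simp add: partial_deriv_def vector_derivative_works[symmetric])

lemma smooth_fun_continuous: "smooth_fun f \<Longrightarrow> continuous_on UNIV (iter_partial is f)"
  by (simp add: smooth_fun_def)

text \<open>A candidate family for all iterated partial derivatives, consistent under one further
  derivative, is the actual one by induction on the list. Smoothness and the derivative formulas
  come out together.\<close>

lemma smooth_funI:
  assumes "\<And>is i x. has_pd i (G is) (G (i # is) x) x" "\<And>is. continuous_on UNIV (G is)" "G [] = h"
  shows "smooth_fun h" "iter_partial is h = G is"
proof -
  show e: "iter_partial is h = G is" for "is"
  proof (induction "is")
    case (Cons i "is")
    show ?case by (rule ext) (simp add: Cons.IH partial_deriv_eq[OF assms(1)])
  qed (simp add: assms(3))
  show "smooth_fun h"
    unfolding smooth_fun_def e using assms(1,2)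
    by (auto simp: has_pd_def has_vector_derivative_def differentiable_def)
qed

lemma smooth_fun_add:
  assumes "smooth_fun f" "smooth_fun g"
  shows "smooth_fun (\<lambda>x. f x + g x)" "iter_partial is (\<lambda>x. f x + g x) = (\<lambda>x. iter_partial is f x + iter_partial is g x)"
proof -
  let ?G = "\<lambda>is x. iter_partial is f x + iter_partial is g x"
  have pd: "has_pd i (?G is) (?G (i # is) x) x" for "is" i x
    by (rule has_pd_add[OF smooth_fun_has_pd[OF assms(1)] smooth_fun_has_pd[OF assms(2)]])
  have c: "continuous_on UNIV (?G is)" for "is"
    by (rule continuous_on_add[OF smooth_fun_continuous[OF assms(1)] smooth_fun_continuous[OF assms(2)]])
  have z: "?G [] = (\<lambda>x. f x + g x)" by simp
  show "smooth_fun (\<lambda>x. f x + g x)" by (rule smooth_funI(1)[of ?G, OF pd c z])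
  show "iter_partial is (\<lambda>x. f x + g x) = ?G is" by (rule smooth_funI(2)[of ?G, OF pd c z])
qed

lemma smooth_fun_bounded_linear:
  assumes h: "bounded_linear h" and "smooth_fun f"
  shows "smooth_fun (\<lambda>x. h (f x))" "iter_partial is (\<lambda>x. h (f x)) = (\<lambda>x. h (iter_partial is f x))"
proof -
  let ?G = "\<lambda>is x. h (iter_partial is f x)"
  have pd: "has_pd i (?G is) (?G (i # is) x) x" for "is" i x
    by (rule has_pd_bounded_linear[OF h smooth_fun_has_pd[OF assms(2)]])
  have c: "continuous_on UNIV (?G is)" for "is"
    by (rule bounded_linear.continuous_on[OF h smooth_fun_continuous[OF assms(2)]])
  have z: "?G [] = (\<lambda>x. h (f x))" by simp
  show "smooth_fun (\<lambda>x. h (f x))" by (rule smooth_funI(1)[of ?G, OF pd c z])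
  show "iter_partial is (\<lambda>x. h (f x)) = ?G is" by (rule smooth_funI(2)[of ?G, OF pd c z])
qed

lemma Cc_infI:
  assumes "smooth_fun f" "closed S" "bounded S" "S \<subseteq> \<Omega>" "\<And>x. x \<notin> S \<Longrightarrow> f x = 0"
  shows "f \<in> Cc_inf \<Omega>"
proof -
  have "tsupport f \<subseteq> S" unfolding tsupport_def using assms(2,5) by (intro closure_minimal) auto
  moreover have "compact (tsupport f)"
    using \<open>tsupport f \<subseteq> S\<close> assms(3) by (auto simp: compact_eq_bounded_closed tsupport_def intro: bounded_subset)
  ultimately show ?thesis using assms by (auto simp: Cc_inf_def)
qed

lemma Cc_inf_tsupport:
  assumes "f \<in> Cc_inf \<Omega>"
  shows "smooth_fun f" "closed (tsupport f)" "bounded (tsupport f)" "tsupport f \<subseteq> \<Omega>" "x \<notin> tsupport f \<Longrightarrow> f x = 0"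
  using assms closure_subset[of "{x. f x \<noteq> 0}"] by (auto simp: Cc_inf_def tsupport_def compact_eq_bounded_closed)

lemma Cc_inf_lincomb:
  fixes u v :: "real^'n::finite \<Rightarrow> complex"
  assumes "u \<in> Cc_inf \<Omega>" "v \<in> Cc_inf \<Omega>"
  shows "(\<lambda>x. u x + c * v x) \<in> Cc_inf \<Omega>"
    "laplacian (\<lambda>x. u x + c * v x) x = laplacian u x + c * laplacian v x"
proof -
  note u = Cc_inf_tsupport[OF assms(1)] and v = Cc_inf_tsupport[OF assms(2)]
  have cv: "smooth_fun (\<lambda>x. c * v x)" "iter_partial is (\<lambda>x. c * v x) = (\<lambda>x. c * iter_partial is v x)" for "is"
    using smooth_fun_bounded_linear[OF bounded_linear_mult_right v(1)] by auto
  show "(\<lambda>x. u x + c * v x) \<in> Cc_inf \<Omega>"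
    by (rule Cc_infI[OF smooth_fun_add(1)[OF u(1) cv(1)], of "tsupport u \<union> tsupport v"]) (use u v in auto)
  show "laplacian (\<lambda>x. u x + c * v x) x = laplacian u x + c * laplacian v x"
    unfolding laplacian_def smooth_fun_add(2)[OF u(1) cv(1)] cv(2) by (simp add: sum.distrib sum_distrib_left)
qed

lemma Cc_inf_bounded_linear:
  assumes h: "bounded_linear h" and u: "u \<in> Cc_inf \<Omega>"
  shows "(\<lambda>x. h (u x)) \<in> Cc_inf \<Omega>"
  by (rule Cc_infI[OF smooth_fun_bounded_linear(1)[OF h Cc_inf_tsupport(1)[OF u]], of "tsupport u"])
     (use Cc_inf_tsupport[OF u] in \<open>auto simp: bounded_linear.linear[OF h] linear_0 h\<close>)

lemma iter_partial_outside_tsupport: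
  assumes u: "u \<in> Cc_inf \<Omega>" and x: "x \<notin> tsupport u"
  shows "iter_partial is u x = 0"
  using x
proof (induction "is" arbitrary: x)
  case Nil
  then show ?case using Cc_inf_tsupport(5)[OF u] by simp
next
  case (Cons i "is")
  have "eventually (\<lambda>y. y \<in> - tsupport u) (nhds x)"
    using Cons.prems Cc_inf_tsupport(2)[OF u] by (intro eventually_nhds_in_open) auto
  then have "eventually (\<lambda>y. iter_partial is u y = 0) (nhds x)"
    by eventually_elim (use Cons.IH in auto)
  then have "has_pd i (\<lambda>_. 0) (iter_partial (i # is) u x) x"
    by (rule has_pd_cong[OF _ smooth_fun_has_pd[OF Cc_inf_tsupport(1)[OF u]]])
  then show ?case using partial_deriv_eq has_pd_const by metis
qed

lemma Cc_inf_bounded_support: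
  assumes "u \<in> Cc_inf \<Omega>"
  obtains R where "\<And>x is. norm x > R \<Longrightarrow> iter_partial is u x = 0"
proof -
  obtain R where "\<And>x. x \<in> tsupport u \<Longrightarrow> norm x \<le> R"
    using Cc_inf_tsupport(3)[OF assms] by (auto simp: bounded_iff)
  then show ?thesis using that[of R] iter_partial_outside_tsupport[OF assms] by (meson not_le)
qed

lemma laplacian_continuous: "u \<in> Cc_inf \<Omega> \<Longrightarrow> continuous_on UNIV (laplacian u)"
  unfolding laplacian_def by (intro continuous_on_sum smooth_fun_continuous Cc_inf_tsupport)

text \<open>The second factor is regular on \<Omega> only. Since \<open>u\<close> and its
  derivatives vanish on the open complement of \<open>tsupport u\<close>, the products extend by 0
  to differentiable fields on the whole space. The lemma serves for a second test function and for a
  solution singular at a pole.\<close>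

lemma Green_integral:
  fixes u w :: "real^'n::finite \<Rightarrow> complex"
  assumes u: "u \<in> Cc_inf \<Omega>" and \<Omega>: "open \<Omega>"
    and w: "\<And>i x. x \<in> \<Omega> \<Longrightarrow> has_pd i w (w1 i x) x" "\<And>i x. x \<in> \<Omega> \<Longrightarrow> has_pd i (w1 i) (w2 i x) x"
      "continuous_on \<Omega> w" "\<And>i. continuous_on \<Omega> (w1 i)" "\<And>i. continuous_on \<Omega> (w2 i)"
  shows "integrable lborel (\<lambda>x. laplacian u x * w x - u x * (\<Sum>i\<in>UNIV. w2 i x))"
    "(\<integral>x. laplacian u x * w x - u x * (\<Sum>i\<in>UNIV. w2 i x) \<partial>lborel) = 0"
proof -
  note us = Cc_inf_tsupport(1)[OF u]
  obtain R where R: "\<And>x is. norm x > R \<Longrightarrow> iter_partial is u x = 0"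
    using Cc_inf_bounded_support[OF u] by blast
  define X where "X i x = iter_partial [i] u x * w x - iter_partial [] u x * w1 i x" for i x
  define dX where "dX i x = (iter_partial [i] u x * w1 i x + iter_partial [i,i] u x * w x) - (iter_partial [] u x * w2 i x + iter_partial [i] u x * w1 i x)" for i x
  have op: "open (- tsupport u)" using Cc_inf_tsupport(2)[OF u] by auto
  \<comment> \<open>Two open sets cover the space: the product rule is available on the first, and
    everything is identically 0 on the second.\<close>
  have cov: "\<Omega> \<union> - tsupport u = UNIV" using Cc_inf_tsupport(4)[OF u] by auto
  have zero: "X i x = 0" "dX i x = 0" if "x \<in> - tsupport u" for i x
    using iter_partial_outside_tsupport[OF u, of x] that by (auto simp: X_def dX_def simp del: iter_partial.simps)
  have pd: "has_pd i (X i) (dX i x) x" for i x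
  proof (cases "x \<in> \<Omega>")
    case True
    show ?thesis unfolding X_def dX_def
      by (rule has_pd_diff[OF has_pd_mult[OF smooth_fun_has_pd[OF us] w(1)[OF True]] has_pd_mult[OF smooth_fun_has_pd[OF us] w(2)[OF True]]])
  next
    case False
    then have x: "x \<in> - tsupport u" using cov by blast
    have "eventually (\<lambda>y. 0 = X i y) (nhds x)"
      using eventually_nhds_in_open[OF op x] by eventually_elim (simp add: zero)
    then show ?thesis using has_pd_cong[OF _ has_pd_const[of i 0 x]] zero[OF x] by simp
  qed
  have cont: "continuous_on UNIV Y" if "continuous_on \<Omega> Y" "\<And>x. x \<in> - tsupport u \<Longrightarrow> Y x = 0" for Y :: "real^'n \<Rightarrow> complex"
  proof -
    have "continuous_on (- tsupport u) Y"
      using that(2) by (subst continuous_on_cong[OF refl]) (auto intro: continuous_on_const)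
    then show ?thesis using continuous_on_open_Un[OF \<Omega> op that(1)] cov by simp
  qed
  have cu: "continuous_on \<Omega> (iter_partial is u)" for "is"
    using smooth_fun_continuous[OF us] continuous_on_subset by blast
  have c: "continuous_on UNIV (X i)" "continuous_on UNIV (dX i)" for i
  proof -
    have "continuous_on \<Omega> (X i)" "continuous_on \<Omega> (dX i)"
      unfolding X_def dX_def by (intro continuous_intros cu w(3-5))+
    then show "continuous_on UNIV (X i)" "continuous_on UNIV (dX i)"
      using cont zero by blast+
  qed
  have out: "X i x = 0" if "norm x > R" for i x using R[OF that] by (simp add: X_def del: iter_partial.simps)
  have d: "integrable lborel (dX i)" "integral\<^sup>L lborel (dX i) = 0" for i
    using integral_pd_eq_0[OF pd c out] by auto
  have eq: "laplacian u x * w x - u x * (\<Sum>i\<in>UNIV. w2 i x) = (\<Sum>i\<in>UNIV. dX i x)" for x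
    unfolding laplacian_def dX_def
    by (simp add: sum_subtractf sum.distrib sum_distrib_left sum_distrib_right del: iter_partial.simps(2))
  show "integrable lborel (\<lambda>x. laplacian u x * w x - u x * (\<Sum>i\<in>UNIV. w2 i x))"
    "(\<integral>x. laplacian u x * w x - u x * (\<Sum>i\<in>UNIV. w2 i x) \<partial>lborel) = 0"
    unfolding eq using d by auto
qed

lemma integral_grad_sq:
  fixes f :: "real^'n::finite \<Rightarrow> real"
  assumes f: "f \<in> Cc_inf \<Omega>"
  shows "integrable lborel (grad_sq f)" "integrable lborel (\<lambda>x. laplacian f x * f x)"
    "(\<integral>x. grad_sq f x \<partial>lborel) = - (\<integral>x. laplacian f x * f x \<partial>lborel)"
proof -
  note fs = Cc_inf_tsupport(1)[OF f]
  obtain R where R: "\<And>x is. norm x > R \<Longrightarrow> iter_partial is f x = 0"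
    using Cc_inf_bounded_support[OF f] by blast
  have g: "grad_sq f x = (\<Sum>i\<in>UNIV. (iter_partial [i] f x)\<^sup>2)" for x by (simp add: grad_sq_def)
  show i1: "integrable lborel (grad_sq f)"
    unfolding g[abs_def] by (rule integrable_cont_compact_support[where R = R])
      (auto intro!: continuous_intros smooth_fun_continuous[OF fs] simp: R simp del: iter_partial.simps)
  show i2: "integrable lborel (\<lambda>x. laplacian f x * f x)"
    using smooth_fun_continuous[OF fs, of "[]"] R[of _ "[]"]
    by (intro integrable_cont_compact_support[where R = R] continuous_intros laplacian_continuous[OF f]) auto
  define X where "X i x = iter_partial [i] f x * iter_partial [] f x" for i x
  define dX where "dX i x = iter_partial [i] f x * iter_partial [i] f x + iter_partial [i,i] f x * iter_partial [] f x" for i x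
  have pd: "has_pd i (X i) (dX i x) x" for i x
    unfolding X_def dX_def by (rule has_pd_mult[OF smooth_fun_has_pd[OF fs] smooth_fun_has_pd[OF fs]])
  have c: "continuous_on UNIV (X i)" "continuous_on UNIV (dX i)" for i
    unfolding X_def dX_def by (intro continuous_intros smooth_fun_continuous[OF fs])+
  have out: "X i x = 0" if "norm x > R" for i x using R[OF that] by (simp add: X_def del: iter_partial.simps)
  have d: "integrable lborel (dX i)" "integral\<^sup>L lborel (dX i) = 0" for i
    using integral_pd_eq_0[OF pd c out] by auto
  have "grad_sq f x + laplacian f x * f x = (\<Sum>i\<in>UNIV. dX i x)" for x
    unfolding g laplacian_def dX_def
    by (simp add: sum.distrib sum_distrib_right power2_eq_square del: iter_partial.simps(2))
  then have "(\<integral>x. grad_sq f x + laplacian f x * f x \<partial>lborel) = 0" using d by simp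
  then show "(\<integral>x. grad_sq f x \<partial>lborel) = - (\<integral>x. laplacian f x * f x \<partial>lborel)"
    using i1 i2 by simp
qed

lemma lebesgue_eq_lborel:
  fixes f :: "'a::euclidean_space \<Rightarrow> 'b::{banach, second_countable_topology}"
  assumes "f \<in> borel_measurable borel"
  shows "integral\<^sup>L lebesgue f = integral\<^sup>L lborel f" "integrable lebesgue f \<longleftrightarrow> integrable lborel f"
  using assms integral_completion[of f lborel] integrable_completion[of f lborel] by auto

lemma borel_imp_lebesgue: "f \<in> borel_measurable borel \<Longrightarrow> f \<in> borel_measurable lebesgue"
  by (simp add: measurable_completion)

section \<open>Geometry of the poles and bounds for the potential\<close>

locale poles =
  fixes a :: "nat \<Rightarrow> real^'n::finite" and lam \<delta> :: real
  assumes sep: "\<And>n m. n \<noteq> m \<Longrightarrow> norm (a n - a m) \<ge> 1"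
    and delta: "0 < \<delta>" "\<delta> < 1/2"
begin

abbreviation "V \<equiv> potential lam \<delta> a"
abbreviation "\<Omega> \<equiv> UNIV - range a"

lemma closed_poles: "closed (range a)"
proof (rule discrete_imp_closed[of 1])
  show "\<forall>x\<in>range a. \<forall>y\<in>range a. dist y x < 1 \<longrightarrow> y = x"
  proof clarify
    fix n m assume "dist (a m) (a n) < 1"
    then show "a m = a n" using sep[of m n] by (cases "m = n") (auto simp: dist_norm)
  qed
qed simp

lemma V_single:
  assumes "\<And>m. m \<noteq> n \<Longrightarrow> \<delta> \<le> norm (x - a m)"
  shows "V x = lam * (indicator (ball (a n) \<delta>) x / (norm (x - a n))\<^sup>2)"
proof -
  have "(\<Sum>k. indicator (ball (a k) \<delta>) x / (norm (x - a k))\<^sup>2) = (\<Sum>k\<in>{n}. indicator (ball (a k) \<delta>) x / (norm (x - a k))\<^sup>2 :: real)"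
    using assms by (intro suminf_finite) (auto simp: dist_norm norm_minus_commute not_less)
  then show ?thesis by (simp add: potential_def)
qed

text \<open>If two points within \<open>1/2 - \<delta>\<close> of \<open>x\<close> were closer than
  \<delta> to distinct poles, the poles would be at distance less than 2 \<delta> + 2 (1/2 -
  \<delta>) = 1. Near every point the potential therefore has at most one singular term.\<close>

lemma local_pole:
  obtains n where "\<And>y m. norm (y - x) < 1/2 - \<delta> \<Longrightarrow> m \<noteq> n \<Longrightarrow> \<delta> \<le> norm (y - a m)"
proof (cases "\<exists>n y. norm (y - x) < 1/2 - \<delta> \<and> norm (y - a n) < \<delta>")
  case True
  then obtain n y where y: "norm (y - x) < 1/2 - \<delta>" "norm (y - a n) < \<delta>" by blast
  show ?thesis
  proof (rule that[of n], rule ccontr)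
    fix z m assume z: "norm (z - x) < 1/2 - \<delta>" "m \<noteq> n" "\<not> \<delta> \<le> norm (z - a m)"
    have "norm (a n - a m) \<le> norm (y - a n) + norm (y - x) + norm (z - x) + norm (z - a m)"
      using norm_triangle_ineq4[of "y - a n" "y - x"] norm_triangle_ineq4[of "z - x" "z - a m"]
        norm_triangle_ineq4[of "(y - x) - (y - a n)" "(z - x) - (z - a m)"] norm_minus_commute[of "y - a n" "y - x"]
      by (simp add: norm_minus_commute)
    then show False using y z sep[of n m] by linarith
  qed
next
  case False
  then show ?thesis using that[of 0] by (meson not_le)
qed

lemma V_measurable [measurable]: "V \<in> borel_measurable borel"
proof -
  have [measurable]: "(\<lambda>x. (norm (x - a n))\<^sup>2) \<in> borel_measurable borel" for n
    by (intro borel_measurable_continuous_onI continuous_intros)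
  have [measurable]: "(indicator (ball (a n) \<delta>) :: _ \<Rightarrow> real) \<in> borel_measurable borel" for n
    by (intro borel_measurable_indicator) simp
  show ?thesis unfolding potential_def
    by (intro borel_measurable_times borel_measurable_const borel_measurable_suminf borel_measurable_divide) measurable
qed

lemma V_bound:
  assumes "\<rho> > 0" "\<And>n. \<rho> \<le> norm (x - a n)"
  shows "\<bar>V x\<bar> \<le> \<bar>lam\<bar> / \<rho>\<^sup>2"
proof -
  obtain n where n: "\<And>y m. norm (y - x) < 1/2 - \<delta> \<Longrightarrow> m \<noteq> n \<Longrightarrow> \<delta> \<le> norm (y - a m)"
    using local_pole by blast
  have "1 / (norm (x - a n))\<^sup>2 \<le> 1 / \<rho>\<^sup>2"
    using power_mono[OF assms(2)[of n], of 2] assms(1) by (intro frac_le) auto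
  moreover have "V x = lam * (indicator (ball (a n) \<delta>) x / (norm (x - a n))\<^sup>2)"
    by (rule V_single) (use n[of x] delta in auto)
  ultimately show ?thesis
    using mult_left_mono[of "1 / (norm (x - a n))\<^sup>2" "1 / \<rho>\<^sup>2" "\<bar>lam\<bar>"]
    by (auto simp: abs_mult indicator_def)
qed

lemma V_bound_compact:
  assumes "compact S" "S \<subseteq> \<Omega>"
  obtains M where "\<And>x. x \<in> S \<Longrightarrow> \<bar>V x\<bar> \<le> M"
proof -
  have "S \<inter> range a = {}" using assms(2) by auto
  from separate_compact_closed[OF assms(1) closed_poles this]
  obtain \<rho> where \<rho>: "\<rho> > 0" "\<forall>x\<in>S. \<forall>y\<in>range a. \<rho> \<le> dist x y" by auto
  show ?thesis
    using V_bound[OF \<rho>(1)] \<rho>(2) by (intro that[of "\<bar>lam\<bar> / \<rho>\<^sup>2"]) (auto simp: dist_norm)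
qed

end

lemma L2_bounded_support:
  fixes f :: "real^'n::finite \<Rightarrow> complex"
  assumes [measurable]: "f \<in> borel_measurable borel" and bd: "\<And>x. norm (f x) \<le> B" and out: "\<And>x. norm x > R \<Longrightarrow> f x = 0"
  shows "f \<in> L2"
proof -
  have "integrable lborel (\<lambda>x. B\<^sup>2 * indicator (cball (0 :: real^'n) R) x :: real)"
    by (intro integrable_mult_right integrable_real_indicator) (use emeasure_lborel_cball_finite in auto)
  then have "integrable lborel (\<lambda>x. (norm (f x))\<^sup>2)"
  proof (rule Bochner_Integration.integrable_bound)
    have "norm ((norm (f x))\<^sup>2) \<le> norm (B\<^sup>2 * indicator (cball (0 :: real^'n) R) x :: real)" for x
      using power_mono[OF bd[of x], of 2] out[of x] by (cases "norm x \<le> R") auto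
    then show "AE x in lborel. norm ((norm (f x))\<^sup>2) \<le> norm (B\<^sup>2 * indicator (cball (0 :: real^'n) R) x :: real)" by simp
  qed measurable
  then show ?thesis by (simp add: L2_def borel_imp_lebesgue lebesgue_eq_lborel)
qed

section \<open>Symmetry, positivity and the weak equation\<close>

context poles
begin

abbreviation "T \<equiv> schroedinger_op V"

text \<open>The scalar multiplication in \<open>V x *\<^sub>R u x\<close> lets the bounds serve
  complex test functions as well as their real and imaginary parts. Boundedness of this product
  comes from the positive distance of the support to the poles.\<close>

lemma test_function_bounds:
  assumes u: "u \<in> Cc_inf \<Omega>"
  obtains B R where "\<And>x. norm (u x) \<le> B" "\<And>x. norm (V x *\<^sub>R u x) \<le> B" "\<And>x. norm (laplacian u x) \<le> B"
     "\<And>x. norm x > R \<Longrightarrow> u x = 0" "\<And>x. norm x > R \<Longrightarrow> laplacian u x = 0"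
     "u \<in> borel_measurable borel" "laplacian u \<in> borel_measurable borel"
proof -
  obtain R where R0: "\<And>x is. norm x > R \<Longrightarrow> iter_partial is u x = 0"
    using Cc_inf_bounded_support[OF u] by blast
  have R: "\<And>x. norm x > R \<Longrightarrow> u x = 0" "\<And>x. norm x > R \<Longrightarrow> laplacian u x = 0"
    using R0[of _ "[]"] by (simp_all add: laplacian_def R0 del: iter_partial.simps(2))
  have cu: "continuous_on UNIV u" using smooth_fun_continuous[OF Cc_inf_tsupport(1)[OF u], of "[]"] by simp
  have cl: "continuous_on UNIV (laplacian u)" by (rule laplacian_continuous[OF u])
  obtain B1 where B1: "B1 > 0" "\<And>x. norm (u x) \<le> B1" using bounded_cont_compact_support[OF cu R(1)] by blast
  obtain B2 where B2: "B2 > 0" "\<And>x. norm (laplacian u x) \<le> B2" using bounded_cont_compact_support[OF cl R(2)] by blast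
  have "compact (tsupport u)" using Cc_inf_tsupport[OF u] by (simp add: compact_eq_bounded_closed)
  from V_bound_compact[OF this Cc_inf_tsupport(4)[OF u]]
  obtain M where M: "\<And>x. x \<in> tsupport u \<Longrightarrow> \<bar>V x\<bar> \<le> M" by blast
  have VB: "norm (V x *\<^sub>R u x) \<le> \<bar>M\<bar> * B1" for x
  proof (cases "x \<in> tsupport u")
    case True
    then show ?thesis using M[OF True] B1(2)[of x] B1(1) by (auto intro!: mult_mono)
  next
    case False
    then show ?thesis using Cc_inf_tsupport(5)[OF u False] B1(1) by simp
  qed
  show ?thesis
  proof (rule that[of "max B1 (max B2 (\<bar>M\<bar> * B1))" R])
    show "u \<in> borel_measurable borel" "laplacian u \<in> borel_measurable borel"
      using cu cl by (auto intro: borel_measurable_continuous_onI)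
  qed (use B1(2) B2(2) VB R in \<open>auto simp: le_max_iff_disj\<close>)
qed

lemma T_in_L2:
  fixes u :: "real^'n \<Rightarrow> complex"
  assumes u: "u \<in> Cc_inf \<Omega>"
  shows "u \<in> L2" "T u \<in> L2"
proof -
  obtain B R where B: "\<And>x. norm (u x) \<le> B" "\<And>x. norm (V x *\<^sub>R u x) \<le> B" "\<And>x. norm (laplacian u x) \<le> B"
     and R: "\<And>x. norm x > R \<Longrightarrow> u x = 0" "\<And>x. norm x > R \<Longrightarrow> laplacian u x = 0"
     and [measurable]: "u \<in> borel_measurable borel" "laplacian u \<in> borel_measurable borel"
    using test_function_bounds[OF u] by blast
  show "u \<in> L2" by (rule L2_bounded_support[OF _ B(1) R(1)]) simp_all
  show "T u \<in> L2"
  proof (rule L2_bounded_support)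
    show "T u \<in> borel_measurable borel" unfolding schroedinger_op_def by measurable
    show "norm (T u x) \<le> B + B" for x
      unfolding schroedinger_op_def
      by (rule order_trans[OF norm_triangle_ineq4 add_mono]) (use B(2,3)[of x] in \<open>auto simp: scaleR_conv_of_real\<close>)
    show "T u x = 0" if "norm x > R" for x using R that by (simp add: schroedinger_op_def)
  qed
qed

lemma op_graph_T: "op_graph T (Cc_inf \<Omega>) \<subseteq> L2 \<times> L2"
  using T_in_L2 by (auto simp: op_graph_def)

text \<open>The potential is real, so its contributions cancel; what remains is Green's identity for
  \<open>u\<close> and the conjugate of \<open>v\<close>.\<close>

lemma T_symmetric:
  assumes u: "u \<in> Cc_inf \<Omega>" and v: "v \<in> Cc_inf \<Omega>"
  shows "L2_inner (T u) v = L2_inner u (T v)"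
proof -
  note vs = Cc_inf_tsupport(1)[OF v]
  have pd: "has_pd i (\<lambda>x. cnj (iter_partial is v x)) (cnj (iter_partial (i # is) v x)) x" for i "is" x
    by (rule has_pd_bounded_linear[OF bounded_linear_cnj smooth_fun_has_pd[OF vs]])
  have c: "continuous_on UNIV (\<lambda>x. cnj (iter_partial is v x))" for "is"
    by (intro continuous_on_cnj smooth_fun_continuous[OF vs])
  have u': "u \<in> Cc_inf UNIV" using u by (simp add: Cc_inf_def)
  have [measurable]: "u \<in> borel_measurable borel" "v \<in> borel_measurable borel" "laplacian u \<in> borel_measurable borel" "laplacian v \<in> borel_measurable borel"
    using test_function_bounds[OF u] test_function_bounds[OF v] by blast+
  have eq: "T u x * cnj (v x) - u x * cnj (T v x) = - (laplacian u x * cnj (iter_partial [] v x) - u x * (\<Sum>i\<in>UNIV. cnj (iter_partial (i # [i]) v x)))" for x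
    by (simp add: schroedinger_op_def laplacian_def algebra_simps sum_distrib_left)
  have "L2_inner (T u) v - L2_inner u (T v) = (\<integral>x. T u x * cnj (v x) - u x * cnj (T v x) \<partial>lebesgue)"
    unfolding L2_inner_def
    by (intro Bochner_Integration.integral_diff[symmetric] L2_integrable_mult T_in_L2 u v)
  also have "\<dots> = (\<integral>x. T u x * cnj (v x) - u x * cnj (T v x) \<partial>lborel)"
    unfolding schroedinger_op_def by (intro lebesgue_eq_lborel) measurable
  also have "\<dots> = 0"
  proof -
    have "(\<integral>x. laplacian u x * cnj (iter_partial [] v x) - u x * (\<Sum>i\<in>UNIV. cnj (iter_partial (i # [i]) v x)) \<partial>lborel) = 0"
      by (rule Green_integral(2)[OF u' open_UNIV, where ?w1.0 = "\<lambda>i x. cnj (iter_partial [i] v x)"]) (rule pd c)+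
    then show ?thesis unfolding eq Bochner_Integration.integral_minus by (simp only: minus_zero)
  qed
  finally show ?thesis by simp
qed

text \<open>The positivity assumption is about real functions. It is applied to \<open>Re\<close>
  and \<open>Im\<close> of \<open>u\<close> separately, since the cross terms disappear from the
  real part of the form.\<close>

lemma T_nonneg:
  assumes pos: "\<And>f :: real^'n \<Rightarrow> real. f \<in> Cc_inf \<Omega> \<Longrightarrow> 0 \<le> (\<integral>x. grad_sq f x - V x * (f x)\<^sup>2 \<partial>lborel)"
    and u: "u \<in> Cc_inf \<Omega>"
  shows "0 \<le> Re (L2_inner (T u) u)"
proof -
  have part: "integrable lborel (\<lambda>x. - (laplacian (\<lambda>x. h (u x)) x * h (u x)) - V x * (h (u x))\<^sup>2) \<and>
     0 \<le> (\<integral>x. - (laplacian (\<lambda>x. h (u x)) x * h (u x)) - V x * (h (u x))\<^sup>2 \<partial>lborel)"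
    if h: "bounded_linear h" for h :: "complex \<Rightarrow> real"
  proof -
    let ?f = "\<lambda>x. h (u x)"
    have f: "?f \<in> Cc_inf \<Omega>" by (rule Cc_inf_bounded_linear[OF h u])
    obtain B R where B: "\<And>x. norm (?f x) \<le> B" "\<And>x. norm (V x *\<^sub>R ?f x) \<le> B" "\<And>x. norm (laplacian ?f x) \<le> B"
     and R: "\<And>x. norm x > R \<Longrightarrow> ?f x = 0" "\<And>x. norm x > R \<Longrightarrow> laplacian ?f x = 0"
     and [measurable]: "?f \<in> borel_measurable borel" "laplacian ?f \<in> borel_measurable borel"
      by (rule test_function_bounds[OF f]) (rule that; assumption)
    have iV: "integrable lborel (\<lambda>x. V x * (?f x)\<^sup>2)"
    proof (rule Bochner_Integration.integrable_bound)
      show "integrable lborel (\<lambda>x. B * B * indicator (cball (0 :: real^'n) R) x :: real)"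
        by (intro integrable_mult_right integrable_real_indicator) (use emeasure_lborel_cball_finite in auto)
      have "norm (V x * (?f x)\<^sup>2) \<le> norm (B * B * indicator (cball (0 :: real^'n) R) x :: real)" for x
      proof (cases "norm x \<le> R")
        case True
        have "norm (V x * (?f x)\<^sup>2) = norm (V x *\<^sub>R ?f x) * norm (?f x)" by (simp add: power2_eq_square abs_mult)
        also have "\<dots> \<le> B * B" using B(1)[of x] B(2)[of x] norm_ge_zero[of "V x *\<^sub>R ?f x"] norm_ge_zero[of "?f x"]
          by (intro mult_mono) linarith+
        finally show ?thesis using True by simp
      qed (use R in auto)
      then show "AE x in lborel. norm (V x * (?f x)\<^sup>2) \<le> norm (B * B * indicator (cball (0 :: real^'n) R) x :: real)" by simp
    qed measurable
    note g = integral_grad_sq[OF f]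
    show ?thesis using pos[OF f] iV g by simp
  qed
  have lap: "laplacian (\<lambda>x. h (u x)) x = h (laplacian u x)" if h: "bounded_linear h" for h :: "complex \<Rightarrow> real" and x
    unfolding laplacian_def smooth_fun_bounded_linear(2)[OF h Cc_inf_tsupport(1)[OF u]]
    by (simp add: linear_sum[OF bounded_linear.linear[OF h]])
  have mu[measurable]: "u \<in> borel_measurable borel" "laplacian u \<in> borel_measurable borel"
    using test_function_bounds[OF u] by blast+
  let ?Q = "\<lambda>h x. - (laplacian (\<lambda>x. h (u x)) x * h (u x)) - V x * (h (u x))\<^sup>2"
  have "Re (L2_inner (T u) u) = (\<integral>x. Re (T u x * cnj (u x)) \<partial>lebesgue)"
    unfolding L2_inner_def
    by (rule integral_bounded_linear[OF bounded_linear_Re L2_integrable_mult[OF T_in_L2(2)[OF u] T_in_L2(1)[OF u]], symmetric])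
  also have "\<dots> = (\<integral>x. Re (T u x * cnj (u x)) \<partial>lborel)"
    unfolding schroedinger_op_def by (intro lebesgue_eq_lborel) measurable
  also have "(\<lambda>x. Re (T u x * cnj (u x))) = (\<lambda>x. ?Q Re x + ?Q Im x)"
    by (auto simp: fun_eq_iff schroedinger_op_def lap bounded_linear_Re bounded_linear_Im power2_eq_square algebra_simps)
  also have "(\<integral>x. ?Q Re x + ?Q Im x \<partial>lborel) = (\<integral>x. ?Q Re x \<partial>lborel) + (\<integral>x. ?Q Im x \<partial>lborel)"
    using part[OF bounded_linear_Re] part[OF bounded_linear_Im] by (intro Bochner_Integration.integral_add) auto
  also have "\<dots> \<ge> 0" using part[OF bounded_linear_Re] part[OF bounded_linear_Im] by simp
  finally show ?thesis .
qed

lemma T_linear: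
  assumes "u \<in> Cc_inf \<Omega>" "v \<in> Cc_inf \<Omega>"
  shows "T (\<lambda>x. u x + c * v x) = (\<lambda>x. T u x + c * T v x)"
  using Cc_inf_lincomb(2)[OF assms] by (auto simp: fun_eq_iff schroedinger_op_def algebra_simps)

text \<open>The test function is the translated kernel x |-> K (x - y), so orthogonality to the
  range becomes a pointwise equation for mollifications at \<open>y\<close>. The operator has real
  coefficients, so \<open>h = Re\<close> and \<open>h = Im\<close> can be treated alike;
  \<open>g'\<close> is a Borel representative suited to integrals over
  \<open>lborel\<close>.\<close>

lemma kernel_weak_equation:
  fixes g :: "real^'n \<Rightarrow> complex" and g' :: "real^'n \<Rightarrow> real"
  assumes g: "g \<in> L2" and ker: "\<And>u. u \<in> Cc_inf \<Omega> \<Longrightarrow> L2_inner (\<lambda>x. T u x + complex_of_real b * u x) g = 0"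
    and h: "bounded_linear h" and g': "g' \<in> borel_measurable borel" "AE x in lebesgue. g' x = h (g x)"
      "integrable lborel (\<lambda>x. (g' x)\<^sup>2)"
    and mol: "mollifier e K K1 K2" and y: "cball y e \<subseteq> \<Omega>"
  shows "(\<Sum>i\<in>UNIV. conv (K2 i) g' y) = conv K (\<lambda>x. (b - V x) * g' x) y"
proof -
  note [measurable] = g'(1)
  have K: "has_pd i K (K1 i x) x" "has_pd i (K1 i) (K2 i x) x" "continuous_on UNIV K"
     "continuous_on UNIV (K2 i)" "norm x \<ge> e \<Longrightarrow> K x = 0" "smooth_fun (\<lambda>x. complex_of_real (K (x - y)))" for i x
    using mol by (auto simp: mollifier_def)
  have o0: "\<And>x. norm x > e \<Longrightarrow> K x = 0" using K(5) by simp
  have o1: "K1 i x = 0" if "norm x > e" for i x using has_pd_outside[OF o0 K(1) that] .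
  have o2: "K2 i x = 0" if "norm x > e" for i x using has_pd_outside[OF o1 K(2) that] .
  have [measurable]: "K \<in> borel_measurable borel" "K2 i \<in> borel_measurable borel" for i
    using K by (auto intro: borel_measurable_continuous_onI)
  define u where "u x = complex_of_real (K (x - y))" for x
  have u: "u \<in> Cc_inf \<Omega>"
  proof (rule Cc_infI[of _ "cball y e"])
    show "smooth_fun u" using K(6) by (simp add: u_def[abs_def])
    show "u x = 0" if "x \<notin> cball y e" for x
      using that o0[of "x - y"] by (simp add: u_def dist_norm norm_minus_commute)
  qed (use y in auto)
  have "iter_partial [i] u = (\<lambda>x. complex_of_real (K1 i (x - y)))" for i
    using partial_deriv_eq[OF has_pd_of_real[OF has_pd_shift[THEN iffD2, OF K(1)], of i "- y"]]
    by (auto simp: u_def[abs_def])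
  moreover have "partial_deriv i (\<lambda>x. complex_of_real (K1 i (x - y))) x = complex_of_real (K2 i (x - y))" for i x
    using partial_deriv_eq[OF has_pd_of_real[OF has_pd_shift[THEN iffD2, OF K(2)], of i "- y" x]] by simp
  ultimately have lap: "laplacian u x = complex_of_real (\<Sum>i\<in>UNIV. K2 i (x - y))" for x
    by (simp add: laplacian_def)
  \<comment> \<open>\<open>k\<close> is \<open>T + b\<close> applied to the translated kernel, and
    it is real.\<close>
  define k where "k x = - (\<Sum>i\<in>UNIV. K2 i (x - y)) + (b - V x) * K (x - y)" for x
  have [measurable]: "k \<in> borel_measurable borel" unfolding k_def by measurable
  have uk: "T u x + complex_of_real b * u x = complex_of_real (k x)" for x
    by (simp add: schroedinger_op_def lap k_def u_def algebra_simps)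
  have kL: "(\<lambda>x. complex_of_real (k x)) \<in> L2"
    using L2_lincomb[OF T_in_L2(2,1)[OF u], of "complex_of_real b"] by (simp add: uk)
  have i0: "integrable lebesgue (\<lambda>x. complex_of_real (k x) * cnj (g x))"
    by (rule L2_integrable_mult[OF kL g])
  have i1: "integrable lebesgue (\<lambda>x. complex_of_real (k x) * g x)"
    using Bochner_Integration.integrable_cnj[OF i0] by simp
  \<comment> \<open>The inner product conjugates \<open>g\<close>; as \<open>k\<close> is real,
    conjugating the whole integral removes this.\<close>
  have z: "(\<integral>x. complex_of_real (k x) * g x \<partial>lebesgue) = 0"
  proof -
    have "(\<integral>x. complex_of_real (k x) * cnj (g x) \<partial>lebesgue) = 0"
      using ker[OF u] by (simp add: uk L2_inner_def)
    then have "cnj (\<integral>x. complex_of_real (k x) * cnj (g x) \<partial>lebesgue) = 0" by simp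
    then show ?thesis unfolding Bochner_Integration.integral_cnj[symmetric] by simp
  qed
  have hk: "h (complex_of_real (k x) * g x) = k x * h (g x)" for x
    using linear_scale[OF bounded_linear.linear[OF h], of "k x" "g x"] by (simp add: scaleR_conv_of_real)
  have "(\<integral>x. k x * h (g x) \<partial>lebesgue) = 0"
    using integral_bounded_linear[OF h i1] linear_0[OF bounded_linear.linear[OF h]] by (simp add: hk z)
  moreover have "(\<integral>x. k x * h (g x) \<partial>lebesgue) = (\<integral>x. k x * g' x \<partial>lebesgue)"
  proof (rule integral_cong_AE)
    have "(\<lambda>x. h (complex_of_real (k x) * g x)) \<in> borel_measurable lebesgue"
      using integrable_bounded_linear[OF h i1] by simp
    then show "(\<lambda>x. k x * h (g x)) \<in> borel_measurable lebesgue" by (simp add: hk)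
    show "(\<lambda>x. k x * g' x) \<in> borel_measurable lebesgue" by (intro borel_imp_lebesgue) measurable
    show "AE x in lebesgue. k x * h (g x) = k x * g' x" using g'(2) by eventually_elim simp
  qed
  moreover have "integrable lebesgue (\<lambda>x. k x * h (g x))"
    using integrable_bounded_linear[OF h i1] by (simp add: hk)
  then have "integrable lebesgue (\<lambda>x. k x * g' x)"
  proof (rule integrable_cong_AE_imp)
    show "(\<lambda>x. k x * g' x) \<in> borel_measurable lebesgue" by (intro borel_imp_lebesgue) measurable
    show "AE x in lebesgue. k x * h (g x) = k x * g' x" using g'(2) by eventually_elim simp
  qed
  ultimately have kz: "(\<integral>x. k x * g' x \<partial>lborel) = 0" "integrable lborel (\<lambda>x. k x * g' x)"
    by (simp_all add: lebesgue_eq_lborel)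
  have i2: "integrable lborel (\<lambda>x. K2 i (x - y) * g' x)" for i
    by (rule integrable_shift_mult[OF g'(1,3) K(4) o2])
  have eq: "K (x - y) * ((b - V x) * g' x) = k x * g' x + (\<Sum>i\<in>UNIV. K2 i (x - y) * g' x)" for x
    by (simp add: k_def algebra_simps sum_distrib_left)
  show ?thesis
    unfolding conv_def eq using kz i2 by simp
qed

end

section \<open>The weight near a pole\<close>

text \<open>A square cut off at 0 is continuously differentiable, which is all that is asked of the
  weights and of the field \<open>F\<close>; explicit derivatives keep the constants sharp.\<close>

definition pos_sq :: "real \<Rightarrow> real" where "pos_sq t = (max 0 t)\<^sup>2"

lemma pos_sq_has_derivative: "(pos_sq has_real_derivative 2 * max 0 t) (at t)"
proof -
  consider "t > 0" | "t = 0" | "t < 0" by linarith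
  then show ?thesis
  proof cases
    case 1
    have d: "((\<lambda>t. t\<^sup>2) has_real_derivative 2 * max 0 t) (at t)"
      using 1 by (auto intro!: derivative_eq_intros)
    have ev: "\<forall>\<^sub>F s in nhds t. s\<^sup>2 = pos_sq s"
      using eventually_nhds_in_open[of "{0<..}" t] 1 by (auto simp: pos_sq_def elim!: eventually_mono)
    show ?thesis by (rule DERIV_cong_ev[OF refl ev refl, THEN iffD1, OF d])
  next
    case 2
    have "\<bar>pos_sq s\<bar> \<le> 1 * (s - 0)\<^sup>2" for s by (simp add: pos_sq_def max_def)
    then show ?thesis using has_real_derivative_0_quadratic[of pos_sq 1 0] 2 by simp
  next
    case 3
    have d: "((\<lambda>t. 0) has_real_derivative 2 * max 0 t) (at t)" using 3 by simp
    have ev: "\<forall>\<^sub>F s in nhds t. 0 = pos_sq s"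
      using eventually_nhds_in_open[of "{..<0}" t] 3 by (auto simp: pos_sq_def elim!: eventually_mono)
    show ?thesis by (rule DERIV_cong_ev[OF refl ev refl, THEN iffD1, OF d])
  qed
qed

lemmas pos_sq_chain [derivative_intros] = DERIV_chain2[OF pos_sq_has_derivative]

locale profile =
  fixes \<delta> :: real
  assumes \<delta>0: "0 < \<delta>"
begin

(* All functions below are functions of s = |x - a_n|^2.  The weight behaves like sqrt (H s), i.e. like a multiple
   of |x - a_n| near the pole.  For z > e one has \<Phi> e z = z - 2 e + e^2 / z with derivative 1 - (e / z)^2 in [0,1], so that
   cutting off near the pole does not increase the gradient.  By x / 0 = 0 all functions vanish suitably at s = 0. *)
definition H :: "real \<Rightarrow> real" where "H s = 1 - pos_sq (1 - s / \<delta>\<^sup>2)"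
definition H1 :: "real \<Rightarrow> real" where "H1 s = 2 * max 0 (1 - s / \<delta>\<^sup>2) / \<delta>\<^sup>2"
definition q :: "real \<Rightarrow> real" where "q s = pos_sq (1 - s / \<delta>\<^sup>2) / s"
definition q1 :: "real \<Rightarrow> real" where "q1 s = - (H1 s / s) - pos_sq (1 - s / \<delta>\<^sup>2) / s\<^sup>2"
definition \<Phi> :: "real \<Rightarrow> real \<Rightarrow> real" where "\<Phi> e z = pos_sq (z - e) / z"
definition \<Phi>1 :: "real \<Rightarrow> real \<Rightarrow> real" where "\<Phi>1 e z = 2 * max 0 (z - e) / z - pos_sq (z - e) / z\<^sup>2"
definition p :: "real \<Rightarrow> real \<Rightarrow> real" where "p e s = \<Phi> e (sqrt (H s))"
definition p1 :: "real \<Rightarrow> real \<Rightarrow> real" where "p1 e s = \<Phi>1 e (sqrt (H s)) * (H1 s / (2 * sqrt (H s)))"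

text \<open>With t = s / \<delta>^2 the function is 2 t - t^2 up to t = 1 and constant afterwards.
  The bound \<open>s * H1 s \<le> H s\<close> reflects concavity and \<open>H 0 = 0\<close>; it is
  the origin of the gradient bound with constant 1.\<close>

lemma H_bounds:
  assumes "0 \<le> s"
  shows "0 \<le> H s" "H s \<le> 1" "H s \<le> 2 * s / \<delta>\<^sup>2" "0 \<le> H1 s" "s * H1 s \<le> H s" "0 < s \<Longrightarrow> 0 < H s"
proof -
  define t where "t = s / \<delta>\<^sup>2"
  have t: "0 \<le> t" using assms by (simp add: t_def)
  have st: "s * H1 s = 2 * t * max 0 (1 - t)" by (simp add: H1_def t_def)
  have Ht: "H s = 1 - (max 0 (1 - t))\<^sup>2" by (simp add: H_def pos_sq_def t_def)
  have "(max 0 (1 - t))\<^sup>2 \<le> 1\<^sup>2" using t by (intro power_mono) auto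
  then show "0 \<le> H s" by (simp add: Ht)
  show "H s \<le> 1" by (simp add: Ht)
  have "1 - (max 0 (1 - t))\<^sup>2 \<le> 2 * t"
    using t by (auto simp: max_def power2_eq_square algebra_simps)
  then show "H s \<le> 2 * s / \<delta>\<^sup>2" by (simp add: Ht t_def)
  show "0 \<le> H1 s" by (simp add: H1_def)
  show "s * H1 s \<le> H s"
    unfolding st Ht using t by (auto simp: max_def power2_eq_square algebra_simps)
  show "0 < H s" if "0 < s"
  proof -
    have "0 < t" using that \<delta>0 by (simp add: t_def)
    then have "(max 0 (1 - t))\<^sup>2 < 1\<^sup>2" by (intro power_strict_mono) auto
    then show ?thesis by (simp add: Ht)
  qed
qed

lemma far:
  assumes "\<delta>\<^sup>2 \<le> s"
  shows "H s = 1" "H1 s = 0" "q s = 0" "q1 s = 0" "p e s = \<Phi> e 1" "p1 e s = 0"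
proof -
  have "1 - s / \<delta>\<^sup>2 \<le> 0" using assms \<delta>0 by (simp add: field_simps)
  then show "H s = 1" "H1 s = 0" "q s = 0" "q1 s = 0" "p e s = \<Phi> e 1" "p1 e s = 0"
    by (simp_all add: H_def H1_def q_def q1_def p_def p1_def pos_sq_def)
qed

lemma near:
  assumes "0 < e" "H s \<le> e\<^sup>2"
  shows "p e s = 0" "p1 e s = 0"
proof -
  have "sqrt (H s) \<le> e" using real_sqrt_le_mono[OF assms(2)] assms(1) by simp
  then show "p e s = 0" "p1 e s = 0"
    by (simp_all add: p_def p1_def \<Phi>_def \<Phi>1_def pos_sq_def)
qed

lemma derivatives:
  assumes s: "0 < s"
  shows "(q has_real_derivative q1 s) (at s)" "(p e has_real_derivative p1 e s) (at s)"
proof -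
  have Hs: "0 < H s" using H_bounds(6)[of s] s by simp
  show "(q has_real_derivative q1 s) (at s)"
    unfolding q_def q1_def H1_def using s \<delta>0
    by (auto intro!: derivative_eq_intros simp: field_simps power2_eq_square)
  have dH: "(H has_real_derivative H1 s) (at s)"
    unfolding H_def H1_def using \<delta>0 by (auto intro!: derivative_eq_intros simp: field_simps power2_eq_square power4_eq_xxxx)
  have d\<Phi>: "(\<Phi> e has_real_derivative \<Phi>1 e z) (at z)" if "0 < z" for z
    unfolding \<Phi>_def \<Phi>1_def using that by (auto intro!: derivative_eq_intros simp: field_simps power2_eq_square)
  have "((\<lambda>s. sqrt (H s)) has_real_derivative H1 s / (2 * sqrt (H s))) (at s)"
    using dH Hs by (auto intro!: derivative_eq_intros simp: field_simps)
  from DERIV_chain2[OF d\<Phi> this] show "(p e has_real_derivative p1 e s) (at s)"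
    using Hs unfolding p_def p1_def by simp
qed

lemma continuity:
  fixes f :: "'a::t2_space \<Rightarrow> real"
  assumes f: "isCont f x" "0 < f x"
  shows "isCont (\<lambda>x. p e (f x)) x" "isCont (\<lambda>x. p1 e (f x)) x" "isCont (\<lambda>x. q (f x)) x" "isCont (\<lambda>x. q1 (f x)) x"
proof -
  have Hs: "0 < H (f x)" using H_bounds(6)[of "f x"] f by simp
  have cH: "isCont (\<lambda>x. H (f x)) x" unfolding H_def pos_sq_def using f \<delta>0 by (intro continuous_intros) auto
  have cH1: "isCont (\<lambda>x. H1 (f x)) x" unfolding H1_def using f \<delta>0 by (intro continuous_intros) auto
  show "isCont (\<lambda>x. p e (f x)) x" unfolding p_def \<Phi>_def pos_sq_def using Hs by (intro continuous_intros cH) auto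
  show "isCont (\<lambda>x. p1 e (f x)) x" unfolding p1_def \<Phi>1_def pos_sq_def using Hs by (intro continuous_intros cH cH1) auto
  show "isCont (\<lambda>x. q (f x)) x" unfolding q_def pos_sq_def using f \<delta>0 by (intro continuous_intros) auto
  show "isCont (\<lambda>x. q1 (f x)) x" unfolding q1_def pos_sq_def using f \<delta>0 by (intro continuous_intros cH1) auto
qed

text \<open>\<open>4 * s * (p1 e s)\<^sup>2\<close> is the squared gradient of x |-> p e (|x - a
  n|^2). Since \<Phi> has slope between 0 and 1, the bounds for the untruncated weight
  \<open>sqrt (H s)\<close> survive for every \<open>e\<close>, as dominated convergence
  demands.\<close>

lemma p_bounds:
  assumes s: "0 < s" and e: "0 < e"
  shows "(p e s)\<^sup>2 \<le> H s" "4 * s * (p1 e s)\<^sup>2 \<le> H s / s"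
proof -
  have Hs: "0 < H s" using H_bounds(6)[of s] s by simp
  define z where "z = sqrt (H s)"
  have z: "0 < z" "z\<^sup>2 = H s" using Hs by (auto simp: z_def)
  have "0 \<le> \<Phi> e z" "\<Phi> e z \<le> z"
  proof -
    show "0 \<le> \<Phi> e z" using z by (simp add: \<Phi>_def pos_sq_def)
    have "pos_sq (z - e) \<le> z\<^sup>2" unfolding pos_sq_def using z e by (intro power_mono) auto
    then show "\<Phi> e z \<le> z" using z by (simp add: \<Phi>_def divide_le_eq power2_eq_square)
  qed
  then have "(\<Phi> e z)\<^sup>2 \<le> z\<^sup>2" by (intro power_mono) auto
  then show "(p e s)\<^sup>2 \<le> H s" using z by (simp add: p_def z_def[symmetric])
  have \<Phi>1: "0 \<le> \<Phi>1 e z" "\<Phi>1 e z \<le> 1"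
  proof -
    have "\<Phi>1 e z = 1 - (e / z)\<^sup>2" if "e < z"
      using that z(1) e by (simp add: \<Phi>1_def pos_sq_def field_simps power2_eq_square)
    moreover have "(e / z)\<^sup>2 \<le> 1\<^sup>2" if "e < z" using that z e by (intro power_mono) auto
    moreover have "\<Phi>1 e z = 0" if "z \<le> e" using that by (simp add: \<Phi>1_def pos_sq_def)
    ultimately show "0 \<le> \<Phi>1 e z" "\<Phi>1 e z \<le> 1" by (cases "e < z"; simp)+
  qed
  have "(p1 e s)\<^sup>2 \<le> (H1 s / (2 * z))\<^sup>2"
  proof (rule power_mono)
    show "p1 e s \<le> H1 s / (2 * z)"
      unfolding p1_def z_def[symmetric] using \<Phi>1 H_bounds(4)[of s] s z
      by (intro mult_left_le_one_le) auto
    show "0 \<le> p1 e s" unfolding p1_def z_def[symmetric] using \<Phi>1 H_bounds(4)[of s] s z by simp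
  qed
  also have "\<dots> = (H1 s)\<^sup>2 / (4 * H s)" using z by (simp add: power_divide power_mult_distrib)
  finally have "4 * s * (p1 e s)\<^sup>2 \<le> 4 * s * ((H1 s)\<^sup>2 / (4 * H s))"
    using s by (intro mult_left_mono) auto
  also have "\<dots> = (s * H1 s)\<^sup>2 / (s * H s)" using s Hs by (simp add: field_simps power2_eq_square)
  also have "\<dots> \<le> (H s)\<^sup>2 / (s * H s)"
    using s Hs H_bounds(4,5)[of s] by (intro divide_right_mono power_mono) auto
  also have "\<dots> = H s / s" using s Hs by (simp add: power2_eq_square)
  finally show "4 * s * (p1 e s)\<^sup>2 \<le> H s / s" .
qed

text \<open>The left side of the first bound is the squared gradient of the limit weight, so this is
  the inequality between squared gradient and squared weight over r^2, free of any loss. The second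
  bound says that the weight tames a singularity of order 1 / s.\<close>

lemma H_quotient:
  assumes s: "0 < s"
  shows "s * (H1 s)\<^sup>2 / H s \<le> H s / s" "H s / s \<le> 2 / \<delta>\<^sup>2"
proof -
  have Hs: "0 < H s" using H_bounds(6)[of s] s by simp
  have "s * (H1 s)\<^sup>2 / H s = (s * H1 s)\<^sup>2 / (s * H s)" using s Hs by (simp add: field_simps power2_eq_square)
  also have "\<dots> \<le> (H s)\<^sup>2 / (s * H s)"
    using s Hs H_bounds(4,5)[of s] by (intro divide_right_mono power_mono) auto
  also have "\<dots> = H s / s" using s Hs by (simp add: power2_eq_square)
  finally show "s * (H1 s)\<^sup>2 / H s \<le> H s / s" .
  show "H s / s \<le> 2 / \<delta>\<^sup>2" using H_bounds(3)[of s] s \<delta>0 by (simp add: divide_le_eq)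
qed

lemma p_tendsto:
  assumes s: "0 < s" and e: "e \<longlonglongrightarrow> 0"
  shows "(\<lambda>k. p (e k) s) \<longlonglongrightarrow> sqrt (H s)" "(\<lambda>k. p1 (e k) s) \<longlonglongrightarrow> H1 s / (2 * sqrt (H s))"
proof -
  have Hs: "0 < sqrt (H s)" using H_bounds(6)[of s] s by simp
  define z where "z = sqrt (H s)"
  have z: "0 < z" using Hs by (simp add: z_def)
  have "(\<lambda>k. (max 0 (z - e k))\<^sup>2 / z) \<longlonglongrightarrow> (max 0 (z - 0))\<^sup>2 / z"
    using z by (intro tendsto_intros e) auto
  then show "(\<lambda>k. p (e k) s) \<longlonglongrightarrow> sqrt (H s)"
    using z by (simp add: p_def \<Phi>_def pos_sq_def z_def[symmetric] power2_eq_square)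
  have "(\<lambda>k. (2 * max 0 (z - e k) / z - (max 0 (z - e k))\<^sup>2 / z\<^sup>2) * (H1 s / (2 * z))) \<longlonglongrightarrow>
      (2 * max 0 (z - 0) / z - (max 0 (z - 0))\<^sup>2 / z\<^sup>2) * (H1 s / (2 * z))"
    using z by (intro tendsto_intros e) auto
  then show "(\<lambda>k. p1 (e k) s) \<longlonglongrightarrow> H1 s / (2 * sqrt (H s))"
    using z by (simp add: p1_def \<Phi>1_def pos_sq_def z_def[symmetric])
qed

text \<open>The Hardy weight - div F - |F|^2 for F = - \<kappa> q(s) (x - a n) in dimension 2
  \<kappa> + 2, as a function of s.\<close>

definition W :: "real \<Rightarrow> real \<Rightarrow> real" where
  "W \<kappa> s = \<kappa> * (2 * s * q1 s + (2 * \<kappa> + 2) * q s) - \<kappa>\<^sup>2 * (q s)\<^sup>2 * s"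

text \<open>Substituting q = (1 - H) / s completes a square: 2 (1 - H) - (1 - H)^2 = 1 - H^2. Since
  \<open>H\<close> is of order s, the deviation from \<kappa>^2 / s is bounded.\<close>

lemma W_eq:
  assumes s: "0 < s"
  shows "W \<kappa> s = - (2 * \<kappa> * H1 s) + \<kappa>\<^sup>2 * (1 - (H s)\<^sup>2) / s"
proof -
  define \<theta> where "\<theta> = pos_sq (1 - s / \<delta>\<^sup>2)"
  have Ht: "H s = 1 - \<theta>" by (simp add: H_def \<theta>_def)
  have "s * q1 s = - H1 s - \<theta> / s" "q s = \<theta> / s"
    using s by (simp_all add: q1_def q_def \<theta>_def field_simps power2_eq_square)
  then have "W \<kappa> s = \<kappa> * (2 * (- H1 s - \<theta> / s) + (2 * \<kappa> + 2) * (\<theta> / s)) - \<kappa>\<^sup>2 * (\<theta> / s)\<^sup>2 * s"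
    by (simp add: W_def mult.assoc)
  also have "\<dots> = - (2 * \<kappa> * H1 s) + \<kappa>\<^sup>2 * (1 - (H s)\<^sup>2) / s"
    unfolding Ht using s by (simp add: field_simps power2_eq_square)
  finally show ?thesis .
qed

lemma H1_le: "0 \<le> s \<Longrightarrow> H1 s \<le> 2 / \<delta>\<^sup>2"
  using \<delta>0 by (auto simp: H1_def max_def intro!: divide_right_mono)

text \<open>The error 4 \<kappa> / \<delta>^2 comes from the derivative term via
  \<open>H1_le\<close>, and 2 \<kappa>^2 / \<delta>^2 comes from \<kappa>^2 H^2 / s. Their sum is
  what the constant \<open>b\<close> will have to absorb.\<close>

lemma W_bounds:
  assumes s: "0 < s" and \<kappa>: "0 \<le> \<kappa>"
  shows "\<bar>W \<kappa> s\<bar> \<le> 4 * \<kappa> / \<delta>\<^sup>2 + \<kappa>\<^sup>2 / s" "\<kappa>\<^sup>2 / s - (4 * \<kappa> + 2 * \<kappa>\<^sup>2) / \<delta>\<^sup>2 \<le> W \<kappa> s"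
proof -
  have H: "0 \<le> H s" "H s \<le> 1" "0 \<le> H1 s" using H_bounds[of s] s by auto
  have H2: "(H s)\<^sup>2 \<le> H s" using H by (simp add: power2_eq_square mult_left_le)
  have 1: "0 \<le> 2 * \<kappa> * H1 s" "2 * \<kappa> * H1 s \<le> 4 * \<kappa> / \<delta>\<^sup>2"
    using \<kappa> H mult_left_mono[OF H1_le[of s], of "2 * \<kappa>"] s by auto
  have 2: "0 \<le> \<kappa>\<^sup>2 * (1 - (H s)\<^sup>2) / s" "\<kappa>\<^sup>2 * (1 - (H s)\<^sup>2) / s \<le> \<kappa>\<^sup>2 / s"
    using s H H2 by (auto intro!: divide_nonneg_pos mult_nonneg_nonneg divide_right_mono mult_left_le)
  show "\<bar>W \<kappa> s\<bar> \<le> 4 * \<kappa> / \<delta>\<^sup>2 + \<kappa>\<^sup>2 / s" unfolding W_eq[OF s] using 1 2 by linarith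
  have "\<kappa>\<^sup>2 * ((H s)\<^sup>2 / s) \<le> \<kappa>\<^sup>2 * (2 / \<delta>\<^sup>2)"
    using H2 H_quotient(2)[OF s] divide_right_mono[OF H2, of s] s by (intro mult_left_mono) auto
  moreover have "\<kappa>\<^sup>2 * (1 - (H s)\<^sup>2) / s = \<kappa>\<^sup>2 / s - \<kappa>\<^sup>2 * ((H s)\<^sup>2 / s)"
    by (simp add: algebra_simps diff_divide_distrib)
  moreover have "(4 * \<kappa> + 2 * \<kappa>\<^sup>2) / \<delta>\<^sup>2 = 4 * \<kappa> / \<delta>\<^sup>2 + \<kappa>\<^sup>2 * (2 / \<delta>\<^sup>2)"
    by (simp add: add_divide_distrib)
  ultimately show "\<kappa>\<^sup>2 / s - (4 * \<kappa> + 2 * \<kappa>\<^sup>2) / \<delta>\<^sup>2 \<le> W \<kappa> s"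
    unfolding W_eq[OF s] using 1 by linarith
qed

lemma W_far: "\<delta>\<^sup>2 \<le> s \<Longrightarrow> W \<kappa> s = 0"
  by (simp add: W_def far)

end

section \<open>The weight with all poles\<close>

context poles
begin

sublocale profile \<delta> using delta by unfold_locales

(* Outside all the balls of radius \<delta> the value is arbitrary; everything built from idx is independent of it there. *)
definition idx :: "real^'n \<Rightarrow> nat" where "idx x = (SOME n. norm (x - a n) < \<delta>)"

lemma idx_unique:
  assumes "norm (x - a n) < \<delta>"
  shows "idx x = n"
proof (rule ccontr)
  assume ne: "idx x \<noteq> n"
  have "norm (x - a (idx x)) < \<delta>" unfolding idx_def by (rule someI[of _ n]) (rule assms)
  moreover have "norm (a (idx x) - a n) \<le> norm (x - a n) + norm (x - a (idx x))"
    using norm_triangle_ineq4[of "x - a n" "x - a (idx x)"] by simp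
  ultimately show False using sep[OF ne] assms delta by linarith
qed

text \<open>\<open>idx\<close> may jump wildly outside the balls. Near a given point, however, it
  either equals one fixed index or the point lies outside both balls concerned, where all local
  definitions agree.\<close>

lemma idx_local:
  obtains n where "\<And>y. norm (y - x) < 1/2 - \<delta> \<Longrightarrow> idx y = n \<or> (\<delta> \<le> norm (y - a (idx y)) \<and> \<delta> \<le> norm (y - a n))"
proof -
  obtain n0 where n0: "\<And>y m. norm (y - x) < 1/2 - \<delta> \<Longrightarrow> m \<noteq> n0 \<Longrightarrow> \<delta> \<le> norm (y - a m)"
    using local_pole by blast
  have "idx y = n0 \<or> (\<delta> \<le> norm (y - a (idx y)) \<and> \<delta> \<le> norm (y - a n0))" if "norm (y - x) < 1/2 - \<delta>" for y
    using n0[OF that] idx_unique[of y n0] not_le by blast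
  then show ?thesis by (rule that)
qed

lemma V_idx: "V x = (if norm (x - a (idx x)) < \<delta> then lam / (norm (x - a (idx x)))\<^sup>2 else 0)"
proof -
  have "\<delta> \<le> norm (x - a m)" if "m \<noteq> idx x" for m
    using idx_unique[of x m] that by force
  from V_single[OF this] show ?thesis by (simp add: indicator_def dist_norm norm_minus_commute)
qed

section \<open>Gluing functions attached to the individual poles\<close>

lemma eventually_near:
  fixes x :: "real^'n"
  assumes "0 < r"
  shows "\<forall>\<^sub>F y in nhds x. norm (y - x) < r"
proof -
  have "\<forall>\<^sub>F y in nhds x. y \<in> ball x r"
    by (rule eventually_nhds_in_open) (use assms in auto)
  then show ?thesis by eventually_elim (simp add: dist_norm norm_minus_commute)
qed

lemma glue_eventually:
  assumes far: "\<And>n m y. \<delta> \<le> norm (y - a n) \<Longrightarrow> \<delta> \<le> norm (y - a m) \<Longrightarrow> Y n y = Y m y"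
    and n: "\<And>y. norm (y - x) < 1/2 - \<delta> \<Longrightarrow> idx y = n \<or> (\<delta> \<le> norm (y - a (idx y)) \<and> \<delta> \<le> norm (y - a n))"
  shows "\<forall>\<^sub>F y in nhds x. Y n y = Y (idx y) y" "Y n x = Y (idx x) x"
proof -
  have *: "Y n y = Y (idx y) y" if "norm (y - x) < 1/2 - \<delta>" for y
    using n[OF that] far[where n = n and m = "idx y" and y = y] by auto
  show "\<forall>\<^sub>F y in nhds x. Y n y = Y (idx y) y"
  proof -
    have "\<forall>\<^sub>F y in nhds x. norm (y - x) < 1/2 - \<delta>" by (rule eventually_near) (use delta in simp)
    then show ?thesis by eventually_elim (rule *)
  qed
  show "Y n x = Y (idx x) x" using *[of x] delta by simp
qed

lemma glue_continuous:
  fixes Y :: "nat \<Rightarrow> real^'n \<Rightarrow> real"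
  assumes far: "\<And>n m y. \<delta> \<le> norm (y - a n) \<Longrightarrow> \<delta> \<le> norm (y - a m) \<Longrightarrow> Y n y = Y m y"
    and c: "\<And>n x. x \<noteq> a n \<Longrightarrow> isCont (Y n) x" and z: "\<And>n. \<forall>\<^sub>F y in nhds (a n). Y n y = 0"
  shows "continuous_on UNIV (\<lambda>y. Y (idx y) y)"
proof (rule continuous_at_imp_continuous_on, rule ballI)
  fix x
  obtain n where n: "\<And>y. norm (y - x) < 1/2 - \<delta> \<Longrightarrow> idx y = n \<or> (\<delta> \<le> norm (y - a (idx y)) \<and> \<delta> \<le> norm (y - a n))"
    using idx_local[of x] by blast
  have "isCont (Y n) x"
  proof (cases "x = a n")
    case True
    have "isCont (Y n) x = isCont (\<lambda>_. 0 :: real) x" by (rule isCont_cong) (use z[of n] True in simp)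
    then show ?thesis by simp
  qed (rule c)
  moreover have "isCont (Y n) x = isCont (\<lambda>y. Y (idx y) y) x"
    by (rule isCont_cong) (rule glue_eventually(1)[OF far n])
  ultimately show "isCont (\<lambda>y. Y (idx y) y) x" by simp
qed

text \<open>Each local function is regular away from its own pole and identically 0 in a
  neighbourhood of it, so differentiability holds everywhere; agreement outside the balls transfers
  it to the glued function.\<close>

lemma glue_has_pd:
  fixes Y :: "nat \<Rightarrow> real^'n \<Rightarrow> real"
  assumes far: "\<And>n m y. \<delta> \<le> norm (y - a n) \<Longrightarrow> \<delta> \<le> norm (y - a m) \<Longrightarrow> Y n y = Y m y"
     "\<And>n m y. \<delta> \<le> norm (y - a n) \<Longrightarrow> \<delta> \<le> norm (y - a m) \<Longrightarrow> D n y = D m y"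
    and d: "\<And>n x. x \<noteq> a n \<Longrightarrow> has_pd i (Y n) (D n x) x"
    and z: "\<And>n. \<forall>\<^sub>F y in nhds (a n). Y n y = 0" "\<And>n. \<forall>\<^sub>F y in nhds (a n). D n y = 0"
  shows "has_pd i (\<lambda>y. Y (idx y) y) (D (idx x) x) x"
proof -
  obtain n where n: "\<And>y. norm (y - x) < 1/2 - \<delta> \<Longrightarrow> idx y = n \<or> (\<delta> \<le> norm (y - a (idx y)) \<and> \<delta> \<le> norm (y - a n))"
    using idx_local[of x] by blast
  have pd: "has_pd i (Y n) (D n x) x"
  proof (cases "x = a n")
    case True
    have "D n x = 0" using eventually_nhds_x_imp_x[OF z(2)] True by simp
    moreover have "\<forall>\<^sub>F y in nhds x. 0 = Y n y"
      using z(1)[of n] unfolding True by eventually_elim simp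
    ultimately show ?thesis using has_pd_cong[OF _ has_pd_const[of i 0 x]] by simp
  qed (rule d)
  have ev: "\<forall>\<^sub>F y in nhds x. Y n y = Y (idx y) y"
    by (rule glue_eventually(1)[OF far(1) n])
  have "has_pd i (\<lambda>y. Y (idx y) y) (D n x) x"
    by (rule has_pd_cong[OF ev pd])
  moreover have "D n x = D (idx x) x"
    by (rule glue_eventually(2)[OF far(2) n])
  ultimately show ?thesis by simp
qed

section \<open>Cutoff at infinity and the coefficients of the integral inequality\<close>

definition \<zeta> :: "real \<Rightarrow> real^'n \<Rightarrow> real" where "\<zeta> R x = pos_sq (1 - (norm x)\<^sup>2 / R\<^sup>2)"
definition \<zeta>1 :: "real \<Rightarrow> 'n \<Rightarrow> real^'n \<Rightarrow> real" where
  "\<zeta>1 R i x = 2 * max 0 (1 - (norm x)\<^sup>2 / R\<^sup>2) * (- (2 * x $ i / R\<^sup>2))"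

lemma \<zeta>_has_pd: "has_pd i (\<zeta> R) (\<zeta>1 R i x) x"
proof -
  have n: "has_pd i (\<lambda>x. (norm x)\<^sup>2) (2 * x $ i) x" using has_pd_norm_sq[of i 0 x] by simp
  have d: "((\<lambda>t. pos_sq (1 - t / R\<^sup>2)) has_real_derivative 2 * max 0 (1 - t / R\<^sup>2) * (- (1 / R\<^sup>2))) (at t)" for t
    by (rule DERIV_chain2[OF pos_sq_has_derivative]) (cases "R = 0"; auto intro!: derivative_eq_intros simp: field_simps)
  have "has_pd i (\<zeta> R) (2 * max 0 (1 - (norm x)\<^sup>2 / R\<^sup>2) * (- (1 / R\<^sup>2)) * (2 * x $ i)) x"
    unfolding \<zeta>_def by (rule has_pd_chain[OF d n])
  moreover have "2 * max 0 (1 - (norm x)\<^sup>2 / R\<^sup>2) * (- (1 / R\<^sup>2)) * (2 * x $ i) = \<zeta>1 R i x"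
    by (simp add: \<zeta>1_def)
  ultimately show ?thesis by simp
qed

lemma \<zeta>_continuous: "isCont (\<zeta> R) x" "isCont (\<zeta>1 R i) x"
  unfolding \<zeta>_def \<zeta>1_def pos_sq_def divide_inverse by (intro continuous_intros)+

text \<open>The gradient has length 4 M |x| / R^2 with M at most 1, hence at most 4 for R at least
  1. A bound uniform in \<open>R\<close> suffices, because the gradient tends to 0
  pointwise.\<close>

lemma \<zeta>_bounds:
  assumes R: "1 \<le> R"
  shows "0 \<le> \<zeta> R x" "\<zeta> R x \<le> 1" "(\<Sum>i\<in>UNIV. (\<zeta>1 R i x)\<^sup>2) \<le> 16" "norm x > R \<Longrightarrow> \<zeta> R x = 0" "norm x > R \<Longrightarrow> \<zeta>1 R i x = 0"
proof -
  define M where "M = max 0 (1 - (norm x)\<^sup>2 / R\<^sup>2)"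
  have M: "0 \<le> M" "M \<le> 1" by (auto simp: M_def)
  have MR: "M = 0" if "norm x > R"
  proof -
    have "R\<^sup>2 \<le> (norm x)\<^sup>2" using that R by (intro power_mono) auto
    then have "1 \<le> (norm x)\<^sup>2 / R\<^sup>2" using R by (simp add: field_simps)
    then show ?thesis by (simp add: M_def)
  qed
  have \<zeta>: "\<zeta> R x = M\<^sup>2" by (simp add: \<zeta>_def pos_sq_def M_def)
  have \<zeta>1: "\<zeta>1 R i x = - (4 * M / R\<^sup>2) * x $ i" for i by (simp add: \<zeta>1_def M_def)
  show "0 \<le> \<zeta> R x" "norm x > R \<Longrightarrow> \<zeta> R x = 0" "norm x > R \<Longrightarrow> \<zeta>1 R i x = 0"
    using MR by (auto simp: \<zeta> \<zeta>1)
  show "\<zeta> R x \<le> 1" unfolding \<zeta> using M by (simp add: power_le_one)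
  have "(\<Sum>i\<in>UNIV. (\<zeta>1 R i x)\<^sup>2) = (4 * M / R\<^sup>2)\<^sup>2 * (\<Sum>i\<in>UNIV. (x $ i)\<^sup>2)"
    by (simp only: \<zeta>1 power_mult_distrib sum_distrib_left power2_minus)
  also have "(\<Sum>i\<in>UNIV. (x $ i)\<^sup>2) = (norm x)\<^sup>2"
    unfolding power2_norm_eq_inner inner_vec_def by (simp add: power2_eq_square)
  also have "(4 * M / R\<^sup>2)\<^sup>2 * (norm x)\<^sup>2 = (4 * M * norm x / R\<^sup>2)\<^sup>2"
    by (simp add: power_mult_distrib power_divide)
  also have "\<dots> \<le> 4\<^sup>2"
  proof (cases "norm x > R")
    case False
    have "M * norm x \<le> 1 * R" using M False by (intro mult_mono) auto
    also have "\<dots> \<le> R\<^sup>2" using R by (simp add: power2_eq_square)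
    finally have "4 * M * norm x / R\<^sup>2 \<le> 4" using R by (simp add: divide_le_eq)
    then show ?thesis using M R by (intro power_mono) auto
  qed (simp add: MR)
  finally show "(\<Sum>i\<in>UNIV. (\<zeta>1 R i x)\<^sup>2) \<le> 16" by simp
qed

definition \<kappa> :: real where "\<kappa> = (real CARD('n) - 2) / 2"

text \<open>Index \<open>n\<close> selects the pole to which these functions refer.
  \<open>F1 i\<close> is the derivative of \<open>F i\<close> in direction \<open>i\<close>,
  \<open>D\<close> the derivative of \<open>\<eta>\<^sup>2 * F i\<close> in the expanded form used
  by \<open>weak_solution_inequality\<close>, and \<open>C\<close> its coefficient
  \<open>c\<close>.\<close>

definition \<eta> where "\<eta> e R n x = p e ((norm (x - a n))\<^sup>2) * \<zeta> R x"
definition \<eta>1 where "\<eta>1 e R i n x = p e ((norm (x - a n))\<^sup>2) * \<zeta>1 R i x + p1 e ((norm (x - a n))\<^sup>2) * (2 * (x - a n) $ i) * \<zeta> R x"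
definition F where "F i n x = - (\<kappa> * (q ((norm (x - a n))\<^sup>2) * (x - a n) $ i))"
definition F1 where "F1 i n x = - (\<kappa> * (q ((norm (x - a n))\<^sup>2) * 1 + q1 ((norm (x - a n))\<^sup>2) * (2 * (x - a n) $ i) * (x - a n) $ i))"
definition D where "D e R i n x = 2 * \<eta> e R n x * \<eta>1 e R i n x * F i n x + (\<eta> e R n x)\<^sup>2 * F1 i n x"
definition C where "C e R n x = - (\<Sum>i\<in>UNIV. (\<eta> e R n x)\<^sup>2 * ((F i n x)\<^sup>2 + F1 i n x) + (\<eta>1 e R i n x)\<^sup>2)"

lemmas local_defs = \<eta>_def \<eta>1_def F_def F1_def

lemma far_eq:
  assumes "\<delta> \<le> norm (y - a n)" "\<delta> \<le> norm (y - a m)"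
  shows "\<eta> e R n y = \<eta> e R m y" "\<eta>1 e R i n y = \<eta>1 e R i m y" "F i n y = F i m y" "F1 i n y = F1 i m y"
    "D e R i n y = D e R i m y" "C e R n y = C e R m y"
proof -
  have "\<delta>\<^sup>2 \<le> (norm (y - a n))\<^sup>2" "\<delta>\<^sup>2 \<le> (norm (y - a m))\<^sup>2"
    using assms delta by (auto intro!: power_mono)
  note f = far[OF this(1)] far[OF this(2)]
  show "\<eta> e R n y = \<eta> e R m y" "\<eta>1 e R i n y = \<eta>1 e R i m y" "F i n y = F i m y" "F1 i n y = F1 i m y" for i
    by (simp_all add: local_defs f)
  then show "D e R i n y = D e R i m y" "C e R n y = C e R m y" by (simp_all add: D_def C_def)
qed

lemma p_zero_near:
  assumes e: "0 < e" and s: "0 \<le> s" "s < e\<^sup>2 * \<delta>\<^sup>2 / 2"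
  shows "p e s = 0" "p1 e s = 0"
proof -
  have "2 * s / \<delta>\<^sup>2 \<le> e\<^sup>2" using s delta by (simp add: divide_le_eq)
  then have "H s \<le> e\<^sup>2" using H_bounds(3)[OF s(1)] by linarith
  then show "p e s = 0" "p1 e s = 0" using near[OF e] by auto
qed

lemma zero_near_pole:
  assumes e: "0 < e"
  shows "\<forall>\<^sub>F y in nhds (a n). \<eta> e R n y = 0 \<and> \<eta>1 e R i n y = 0"
proof -
  \<comment> \<open>The square of this radius is e^2 \<delta>^2 / 4, below the bound e^2 \<delta>^2
    / 2 under which the truncated weight vanishes.\<close>
  have r: "0 < e * \<delta> / 2" using e delta by simp
  show ?thesis
    using eventually_near[OF r]
  proof eventually_elim
    fix y assume "norm (y - a n) < e * \<delta> / 2"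
    then have "(norm (y - a n))\<^sup>2 < (e * \<delta> / 2)\<^sup>2" by (intro power_strict_mono) auto
    also have "\<dots> \<le> e\<^sup>2 * \<delta>\<^sup>2 / 2" by (simp add: power_mult_distrib power_divide)
    finally show "\<eta> e R n y = 0 \<and> \<eta>1 e R i n y = 0"
      using p_zero_near[OF e, of "(norm (y - a n))\<^sup>2"] by (simp add: local_defs)
  qed
qed

lemma local_has_pd:
  assumes x: "x \<noteq> a n"
  shows "has_pd i (\<eta> e R n) (\<eta>1 e R i n x) x" "has_pd i (F i n) (F1 i n x) x"
    "has_pd i (\<lambda>x. (\<eta> e R n x)\<^sup>2 * F i n x) (D e R i n x) x"
proof -
  have s: "0 < (norm (x - a n))\<^sup>2" using x by simp
  have pp: "has_pd i (\<lambda>x. p e ((norm (x - a n))\<^sup>2)) (p1 e ((norm (x - a n))\<^sup>2) * (2 * (x - a n) $ i)) x"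
    by (rule has_pd_chain[OF derivatives(2)[OF s] has_pd_norm_sq])
  have pq: "has_pd i (\<lambda>x. q ((norm (x - a n))\<^sup>2)) (q1 ((norm (x - a n))\<^sup>2) * (2 * (x - a n) $ i)) x"
    by (rule has_pd_chain[OF derivatives(1)[OF s] has_pd_norm_sq])
  have px: "has_pd i (\<lambda>x. (x - a n) $ i) 1 x"
    using has_pd_diff[OF has_pd_nth[of i i x] has_pd_const[of i "a n $ i" x]] by simp
  show e: "has_pd i (\<eta> e R n) (\<eta>1 e R i n x) x"
    unfolding \<eta>_def \<eta>1_def by (rule has_pd_mult[OF pp \<zeta>_has_pd])
  have "has_pd i (\<lambda>x. - (\<kappa> * (q ((norm (x - a n))\<^sup>2) * (x - a n) $ i)))
     (- (\<kappa> * (q ((norm (x - a n))\<^sup>2) * 1 + q1 ((norm (x - a n))\<^sup>2) * (2 * (x - a n) $ i) * (x - a n) $ i) + 0 * (q ((norm (x - a n))\<^sup>2) * (x - a n) $ i))) x"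
    by (rule has_pd_minus[OF has_pd_mult[OF has_pd_const has_pd_mult[OF pq px]]])
  then show f: "has_pd i (F i n) (F1 i n x) x"
    unfolding F_def F1_def by simp
  have "has_pd i (\<lambda>x. (\<eta> e R n x * \<eta> e R n x) * F i n x)
     ((\<eta> e R n x * \<eta> e R n x) * F1 i n x + (\<eta> e R n x * \<eta>1 e R i n x + \<eta>1 e R i n x * \<eta> e R n x) * F i n x) x"
    by (rule has_pd_mult[OF has_pd_mult[OF e e] f])
  moreover have "(\<eta> e R n x * \<eta> e R n x) * F1 i n x + (\<eta> e R n x * \<eta>1 e R i n x + \<eta>1 e R i n x * \<eta> e R n x) * F i n x = D e R i n x"
    by (simp add: D_def power2_eq_square algebra_simps)
  ultimately show "has_pd i (\<lambda>x. (\<eta> e R n x)\<^sup>2 * F i n x) (D e R i n x) x"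
    by (simp add: power2_eq_square)
qed

lemma local_continuous:
  assumes x: "x \<noteq> a n"
  shows "isCont (\<eta> e R n) x" "isCont (\<eta>1 e R i n) x" "isCont (\<lambda>x. (\<eta> e R n x)\<^sup>2 * F i n x) x" "isCont (D e R i n) x" "isCont (C e R n) x"
proof -
  have s: "0 < (norm (x - a n))\<^sup>2" using x by simp
  have cs: "isCont (\<lambda>x. (norm (x - a n))\<^sup>2) x" by (intro continuous_intros)
  have cx: "isCont (\<lambda>x. (x - a n) $ i) x" for i by (intro continuous_intros)
  note c = continuity[OF cs s]
  show e: "isCont (\<eta> e R n) x" "isCont (\<eta>1 e R i n) x" for i
    unfolding \<eta>_def \<eta>1_def by (intro continuous_intros c cx \<zeta>_continuous)+
  have f: "isCont (F i n) x" "isCont (F1 i n) x" for i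
    unfolding F_def F1_def by (intro continuous_intros c cx)+
  show "isCont (\<lambda>x. (\<eta> e R n x)\<^sup>2 * F i n x) x" "isCont (D e R i n) x" "isCont (C e R n) x"
    unfolding D_def C_def by (intro continuous_intros e f)+
qed


lemma glued:
  assumes e: "0 < e"
  shows "has_pd i (\<lambda>x. \<eta> e R (idx x) x) (\<eta>1 e R i (idx x) x) x"
    "has_pd i (\<lambda>x. (\<eta> e R (idx x) x)\<^sup>2 * F i (idx x) x) (D e R i (idx x) x) x"
    "continuous_on UNIV (\<lambda>x. \<eta> e R (idx x) x)" "continuous_on UNIV (\<lambda>x. \<eta>1 e R i (idx x) x)"
    "continuous_on UNIV (\<lambda>x. (\<eta> e R (idx x) x)\<^sup>2 * F i (idx x) x)"
    "continuous_on UNIV (\<lambda>x. D e R i (idx x) x)" "continuous_on UNIV (\<lambda>x. C e R (idx x) x)"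
proof -
  have z: "\<forall>\<^sub>F y in nhds (a n). \<eta> e R n y = 0" "\<forall>\<^sub>F y in nhds (a n). \<eta>1 e R i n y = 0" for n i
    using zero_near_pole[OF e, where i = i and n = n and R = R] by (simp_all add: eventually_conj_iff)
  have zF: "\<forall>\<^sub>F y in nhds (a n). (\<eta> e R n y)\<^sup>2 * F i n y = 0" for n
    using z(1)[of n] by eventually_elim simp
  have zD: "\<forall>\<^sub>F y in nhds (a n). D e R i n y = 0" for n
    using z(1)[of n] by eventually_elim (simp add: D_def)
  have "\<forall>\<^sub>F y in nhds (a n). \<forall>i. \<eta>1 e R i n y = 0" for n
    using z(2) by (simp add: eventually_all_finite)
  then have zC: "\<forall>\<^sub>F y in nhds (a n). C e R n y = 0" for n
    using z(1)[of n] by eventually_elim (simp add: C_def)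
  show "has_pd i (\<lambda>x. \<eta> e R (idx x) x) (\<eta>1 e R i (idx x) x) x"
    by (rule glue_has_pd[where Y = "\<lambda>n. \<eta> e R n" and D = "\<lambda>n. \<eta>1 e R i n"])
       (fact far_eq(1) far_eq(2) local_has_pd(1) z)+
  show "has_pd i (\<lambda>x. (\<eta> e R (idx x) x)\<^sup>2 * F i (idx x) x) (D e R i (idx x) x) x"
  proof (rule glue_has_pd[where Y = "\<lambda>n x. (\<eta> e R n x)\<^sup>2 * F i n x" and D = "\<lambda>n. D e R i n"])
    fix n m y assume f: "\<delta> \<le> norm (y - a n)" "\<delta> \<le> norm (y - a m)"
    show "(\<eta> e R n y)\<^sup>2 * F i n y = (\<eta> e R m y)\<^sup>2 * F i m y" "D e R i n y = D e R i m y"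
      using far_eq(1)[OF f] far_eq(3)[OF f] far_eq(5)[OF f] by simp_all
  qed (fact local_has_pd(3) zF zD)+
  show "continuous_on UNIV (\<lambda>x. \<eta> e R (idx x) x)"
    by (rule glue_continuous[where Y = "\<lambda>n. \<eta> e R n"]) (fact far_eq(1) local_continuous(1) z(1))+
  show "continuous_on UNIV (\<lambda>x. \<eta>1 e R i (idx x) x)"
    by (rule glue_continuous[where Y = "\<lambda>n. \<eta>1 e R i n"]) (fact far_eq(2) local_continuous(2) z(2))+
  show "continuous_on UNIV (\<lambda>x. (\<eta> e R (idx x) x)\<^sup>2 * F i (idx x) x)"
  proof (rule glue_continuous[where Y = "\<lambda>n x. (\<eta> e R n x)\<^sup>2 * F i n x"])
    fix n m y assume f: "\<delta> \<le> norm (y - a n)" "\<delta> \<le> norm (y - a m)"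
    show "(\<eta> e R n y)\<^sup>2 * F i n y = (\<eta> e R m y)\<^sup>2 * F i m y"
      using far_eq(1)[OF f] far_eq(3)[OF f] by simp
  qed (fact local_continuous(3) zF)+
  show "continuous_on UNIV (\<lambda>x. D e R i (idx x) x)"
    by (rule glue_continuous[where Y = "\<lambda>n. D e R i n"]) (fact far_eq(5) local_continuous(4) zD)+
  show "continuous_on UNIV (\<lambda>x. C e R (idx x) x)"
    by (rule glue_continuous[where Y = "\<lambda>n. C e R n"]) (fact far_eq(6) local_continuous(5) zC)+
qed

lemma sum_sq_components: "(\<Sum>i\<in>UNIV. (v $ i)\<^sup>2) = (norm (v :: real^'n))\<^sup>2"
  unfolding power2_norm_eq_inner inner_vec_def by (simp add: power2_eq_square)

text \<open>The radial derivatives sum up by \<Sum> v_i^2 = s, and the dimension is 2 \<kappa> + 2;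
  thus \<open>C\<close> is the Hardy weight times \<eta>^2 minus the squared gradient of
  \<eta>.\<close>

lemma C_formula:
  "C e R n x = (\<eta> e R n x)\<^sup>2 * W \<kappa> ((norm (x - a n))\<^sup>2) - (\<Sum>i\<in>UNIV. (\<eta>1 e R i n x)\<^sup>2)"
proof -
  define v where "v = x - a n"
  define s where "s = (norm v)\<^sup>2"
  have card: "real CARD('n) = 2 * \<kappa> + 2" unfolding \<kappa>_def by (simp add: field_simps)
  have vs: "(\<Sum>i\<in>UNIV. (v $ i)\<^sup>2) = s" unfolding s_def by (rule sum_sq_components)
  have "(\<Sum>i\<in>UNIV. (F i n x)\<^sup>2) = \<kappa>\<^sup>2 * (q s)\<^sup>2 * (\<Sum>i\<in>UNIV. (v $ i)\<^sup>2)"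
    unfolding F_def v_def[symmetric] s_def[symmetric] by (simp only: power2_minus power_mult_distrib sum_distrib_left mult.assoc)
  then have sF: "(\<Sum>i\<in>UNIV. (F i n x)\<^sup>2) = \<kappa>\<^sup>2 * (q s)\<^sup>2 * s" by (simp only: vs)
  have "F1 i n x = - \<kappa> * q s - 2 * \<kappa> * q1 s * (v $ i)\<^sup>2" for i
    unfolding F1_def v_def[symmetric] s_def[symmetric] by (simp add: algebra_simps power2_eq_square)
  then have "(\<Sum>i\<in>UNIV. F1 i n x) = - \<kappa> * q s * real CARD('n) - 2 * \<kappa> * q1 s * (\<Sum>i\<in>UNIV. (v $ i)\<^sup>2)"
    by (simp add: sum_subtractf sum_distrib_left)
  then have sF1: "(\<Sum>i\<in>UNIV. F1 i n x) = - \<kappa> * q s * (2 * \<kappa> + 2) - 2 * \<kappa> * q1 s * s"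
    unfolding vs card by simp
  have "C e R n x = - ((\<eta> e R n x)\<^sup>2 * ((\<Sum>i\<in>UNIV. (F i n x)\<^sup>2) + (\<Sum>i\<in>UNIV. F1 i n x)) + (\<Sum>i\<in>UNIV. (\<eta>1 e R i n x)\<^sup>2))"
    unfolding C_def by (simp only: sum.distrib sum_distrib_left[symmetric])
  also have "\<dots> = (\<eta> e R n x)\<^sup>2 * W \<kappa> s - (\<Sum>i\<in>UNIV. (\<eta>1 e R i n x)\<^sup>2)"
    unfolding sF sF1 W_def by (simp add: algebra_simps)
  finally show ?thesis by (simp add: s_def v_def)
qed

text \<open>The full coefficient of g^2 in the integral inequality, with q = b - V.\<close>

definition G :: "real \<Rightarrow> real \<Rightarrow> real \<Rightarrow> real^'n \<Rightarrow> real" where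
  "G b e R x = C e R (idx x) x + (\<eta> e R (idx x) x)\<^sup>2 * (b - V x)"

text \<open>The limit of \<open>G\<close> for e to 0 and R to infinity: \<eta>^2 becomes
  \<open>H s\<close> and the squared gradient becomes
  \<open>s * (H1 s)\<^sup>2 / H s\<close>.\<close>

definition Glim :: "real \<Rightarrow> real^'n \<Rightarrow> real" where
  "Glim b x = (let s = (norm (x - a (idx x)))\<^sup>2 in H s * (W \<kappa> s + b - V x) - s * (H1 s)\<^sup>2 / H s)"

lemma V_idx_bound: "x \<noteq> a (idx x) \<Longrightarrow> \<bar>V x\<bar> \<le> \<bar>lam\<bar> / (norm (x - a (idx x)))\<^sup>2"
  by (auto simp: V_idx)

text \<open>The bound is independent of \<open>e\<close> and \<open>R\<close>. All singular terms
  are of order 1 / s and are multiplied by at most \<open>H s\<close>. The constants 32 and 4 /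
  \<delta>^2 are twice the gradient bounds of the two cutoffs, from (A + B)^2 \<le> 2 A^2 + 2
  B^2.\<close>

lemma G_bound:
  assumes e: "0 < e" and R: "1 \<le> R" and \<kappa>: "0 \<le> \<kappa>"
  shows "\<bar>G b e R x\<bar> \<le> 4 * \<kappa> / \<delta>\<^sup>2 + \<bar>b\<bar> + (\<kappa>\<^sup>2 + \<bar>lam\<bar>) * (2 / \<delta>\<^sup>2) + 4 / \<delta>\<^sup>2 + 32"
    (is "_ \<le> ?B")
proof (cases "x = a (idx x)")
  \<comment> \<open>At a pole s = 0, where the truncated weight and its derivative vanish by
    \<open>H 0 = 0\<close>.\<close>
  case True
  have "H 0 = 0" by (simp add: H_def pos_sq_def)
  then have "p e 0 = 0" "p1 e 0 = 0" using near[OF e, of 0] by auto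
  then have "\<eta> e R (idx x) x = 0" "\<eta>1 e R i (idx x) x = 0" for i
    using True by (simp_all add: \<eta>_def \<eta>1_def)
  moreover have "0 \<le> ?B" using \<kappa> by simp
  ultimately show ?thesis by (simp add: G_def C_def)
next
  case False
  define v where "v = x - a (idx x)"
  define s where "s = (norm v)\<^sup>2"
  have s: "0 < s" using False by (simp add: s_def v_def)
  have H: "0 < H s" "H s \<le> 1" "0 \<le> H s" using H_bounds[of s] s by auto
  have z: "0 \<le> \<zeta> R x" "\<zeta> R x \<le> 1" "(\<Sum>i\<in>UNIV. (\<zeta>1 R i x)\<^sup>2) \<le> 16" using \<zeta>_bounds[OF R] by auto
  have z2: "(\<zeta> R x)\<^sup>2 \<le> 1" using z by (simp add: power_le_one)
  let ?\<eta> = "\<eta> e R (idx x) x" and ?\<eta>1 = "\<lambda>i. \<eta>1 e R i (idx x) x"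
  have \<eta>: "?\<eta> = p e s * \<zeta> R x" "?\<eta>1 i = p e s * \<zeta>1 R i x + p1 e s * (2 * v $ i) * \<zeta> R x" for i
    by (simp_all add: \<eta>_def \<eta>1_def s_def v_def)
  have "?\<eta>\<^sup>2 = (p e s)\<^sup>2 * (\<zeta> R x)\<^sup>2" by (simp add: \<eta> power_mult_distrib)
  also have "\<dots> \<le> H s * 1" using p_bounds(1)[OF s e] z2 H by (intro mult_mono) auto
  finally have \<eta>2: "?\<eta>\<^sup>2 \<le> H s" by simp
  have "\<bar>W \<kappa> s + b - V x\<bar> \<le> 4 * \<kappa> / \<delta>\<^sup>2 + \<kappa>\<^sup>2 / s + \<bar>b\<bar> + \<bar>lam\<bar> / s"
    using W_bounds(1)[OF s \<kappa>] V_idx_bound[OF False] unfolding s_def v_def by linarith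
  then have "?\<eta>\<^sup>2 * \<bar>W \<kappa> s + b - V x\<bar> \<le> H s * (4 * \<kappa> / \<delta>\<^sup>2 + \<kappa>\<^sup>2 / s + \<bar>b\<bar> + \<bar>lam\<bar> / s)"
    using \<eta>2 H by (intro mult_mono) auto
  also have "\<dots> = H s * (4 * \<kappa> / \<delta>\<^sup>2 + \<bar>b\<bar>) + (\<kappa>\<^sup>2 + \<bar>lam\<bar>) * (H s / s)"
    by (simp add: algebra_simps add_divide_distrib)
  also have "\<dots> \<le> 1 * (4 * \<kappa> / \<delta>\<^sup>2 + \<bar>b\<bar>) + (\<kappa>\<^sup>2 + \<bar>lam\<bar>) * (2 / \<delta>\<^sup>2)"
    using H \<kappa> H_quotient(2)[OF s] by (intro add_mono mult_right_mono mult_left_mono) auto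
  finally have 1: "\<bar>?\<eta>\<^sup>2 * (W \<kappa> s + b - V x)\<bar> \<le> 4 * \<kappa> / \<delta>\<^sup>2 + \<bar>b\<bar> + (\<kappa>\<^sup>2 + \<bar>lam\<bar>) * (2 / \<delta>\<^sup>2)"
    by (simp add: abs_mult)
  have "(\<Sum>i\<in>UNIV. (?\<eta>1 i)\<^sup>2) \<le> (\<Sum>i\<in>UNIV. 2 * ((p e s)\<^sup>2 * (\<zeta>1 R i x)\<^sup>2) + 2 * ((4 * (p1 e s)\<^sup>2 * (\<zeta> R x)\<^sup>2) * (v $ i)\<^sup>2))"
  proof (rule sum_mono)
    fix i
    have sq: "(A + B)\<^sup>2 \<le> 2 * A\<^sup>2 + 2 * B\<^sup>2" for A B :: real
      using zero_le_power2[of "A - B"] unfolding power2_sum power2_diff by linarith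
    show "(?\<eta>1 i)\<^sup>2 \<le> 2 * ((p e s)\<^sup>2 * (\<zeta>1 R i x)\<^sup>2) + 2 * ((4 * (p1 e s)\<^sup>2 * (\<zeta> R x)\<^sup>2) * (v $ i)\<^sup>2)"
      unfolding \<eta> by (rule order_trans[OF sq]) (simp add: power_mult_distrib mult.assoc mult.left_commute)
  qed
  also have "\<dots> = 2 * ((p e s)\<^sup>2 * (\<Sum>i\<in>UNIV. (\<zeta>1 R i x)\<^sup>2)) + 2 * ((\<zeta> R x)\<^sup>2 * (4 * s * (p1 e s)\<^sup>2))"
    unfolding sum.distrib sum_distrib_left[symmetric] sum_sq_components s_def[symmetric] by (simp add: algebra_simps)
  also have "\<dots> \<le> 2 * (1 * 16) + 2 * (1 * (2 / \<delta>\<^sup>2))"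
  proof (intro add_mono mult_left_mono mult_mono)
    show "(p e s)\<^sup>2 \<le> 1" using p_bounds(1)[OF s e] H by linarith
    show "4 * s * (p1 e s)\<^sup>2 \<le> 2 / \<delta>\<^sup>2" using p_bounds(2)[OF s e] H_quotient(2)[OF s] by linarith
  qed (use z z2 s in \<open>auto intro!: sum_nonneg\<close>)
  finally have 2: "(\<Sum>i\<in>UNIV. (?\<eta>1 i)\<^sup>2) \<le> 32 + 4 / \<delta>\<^sup>2" by simp
  have 3: "0 \<le> (\<Sum>i\<in>UNIV. (?\<eta>1 i)\<^sup>2)" by (intro sum_nonneg) simp
  have "G b e R x = ?\<eta>\<^sup>2 * (W \<kappa> s + b - V x) - (\<Sum>i\<in>UNIV. (?\<eta>1 i)\<^sup>2)"
    unfolding G_def C_formula s_def v_def by (simp add: algebra_simps)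
  then show ?thesis using 1 2 3 by linarith
qed

lemma G_tendsto:
  assumes x: "x \<noteq> a (idx x)" and e: "e \<longlonglongrightarrow> 0" and R: "filterlim R at_top sequentially"
  shows "(\<lambda>k. G b (e k) (R k) x) \<longlonglongrightarrow> Glim b x"
proof -
  define v where "v = x - a (idx x)"
  define s where "s = (norm v)\<^sup>2"
  have s: "0 < s" using x by (simp add: s_def v_def)
  have H: "0 < H s" using H_bounds[of s] s by auto
  have iR: "(\<lambda>k. inverse (R k)) \<longlonglongrightarrow> 0" by (rule tendsto_inverse_0_at_top[OF R])
  have "(\<lambda>k. (max 0 (1 - (norm x)\<^sup>2 * (inverse (R k))\<^sup>2))\<^sup>2) \<longlonglongrightarrow> (max 0 (1 - (norm x)\<^sup>2 * 0\<^sup>2))\<^sup>2"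
    by (intro tendsto_intros iR)
  then have z: "(\<lambda>k. \<zeta> (R k) x) \<longlonglongrightarrow> 1" by (simp add: \<zeta>_def pos_sq_def divide_inverse power_inverse)
  have "(\<lambda>k. 2 * max 0 (1 - (norm x)\<^sup>2 * (inverse (R k))\<^sup>2) * (- (2 * x $ i * (inverse (R k))\<^sup>2))) \<longlonglongrightarrow>
      2 * max 0 (1 - (norm x)\<^sup>2 * 0\<^sup>2) * (- (2 * x $ i * 0\<^sup>2))" for i
    by (intro tendsto_intros iR)
  then have z1: "(\<lambda>k. \<zeta>1 (R k) i x) \<longlonglongrightarrow> 0" for i by (simp add: \<zeta>1_def divide_inverse power_inverse)
  note pt = p_tendsto[OF s e]
  have lim: "(\<lambda>k. (p (e k) s * \<zeta> (R k) x)\<^sup>2 * W \<kappa> s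
       - (\<Sum>i\<in>UNIV. (p (e k) s * \<zeta>1 (R k) i x + p1 (e k) s * (2 * v $ i) * \<zeta> (R k) x)\<^sup>2)
       + (p (e k) s * \<zeta> (R k) x)\<^sup>2 * (b - V x)) \<longlonglongrightarrow>
     (sqrt (H s) * 1)\<^sup>2 * W \<kappa> s - (\<Sum>i\<in>UNIV. (sqrt (H s) * 0 + H1 s / (2 * sqrt (H s)) * (2 * v $ i) * 1)\<^sup>2)
       + (sqrt (H s) * 1)\<^sup>2 * (b - V x)"
    by (intro tendsto_intros pt z z1)
  have "(\<Sum>i\<in>UNIV. (sqrt (H s) * 0 + H1 s / (2 * sqrt (H s)) * (2 * v $ i) * 1)\<^sup>2) = (\<Sum>i\<in>UNIV. ((H1 s)\<^sup>2 / H s) * (v $ i)\<^sup>2)"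
    using H by (simp add: power_mult_distrib power_divide)
  also have "\<dots> = s * (H1 s)\<^sup>2 / H s"
    unfolding sum_distrib_left[symmetric] sum_sq_components s_def by simp
  finally have sm: "(\<Sum>i\<in>UNIV. (sqrt (H s) * 0 + H1 s / (2 * sqrt (H s)) * (2 * v $ i) * 1)\<^sup>2) = s * (H1 s)\<^sup>2 / H s" .
  have eq: "(sqrt (H s) * 1)\<^sup>2 * W \<kappa> s - s * (H1 s)\<^sup>2 / H s + (sqrt (H s) * 1)\<^sup>2 * (b - V x) = Glim b x"
    using H by (simp add: Glim_def Let_def s_def v_def algebra_simps)
  have Gk: "G b e R x = (p e s * \<zeta> R x)\<^sup>2 * W \<kappa> s
       - (\<Sum>i\<in>UNIV. (p e s * \<zeta>1 R i x + p1 e s * (2 * v $ i) * \<zeta> R x)\<^sup>2) + (p e s * \<zeta> R x)\<^sup>2 * (b - V x)" for e R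
    unfolding G_def C_formula \<eta>_def \<eta>1_def s_def v_def ..
  show ?thesis using lim unfolding sm eq Gk .
qed

text \<open>The gradient term is at most H / s, so inside a ball the bracket is at least (\<kappa>^2
  - lam - 1) / s plus the part of \<open>b\<close> left after the error of \<open>W\<close>. That
  part is 1, which yields strict positivity even at the threshold. Outside the balls the value is
  \<open>b\<close>.\<close>

lemma Glim_pos:
  assumes x: "x \<noteq> a (idx x)" and \<kappa>: "0 \<le> \<kappa>" and lam: "lam \<le> \<kappa>\<^sup>2 - 1"
    and b: "b = (4 * \<kappa> + 2 * \<kappa>\<^sup>2) / \<delta>\<^sup>2 + 1"
  shows "0 < Glim b x"
proof -
  define s where "s = (norm (x - a (idx x)))\<^sup>2"
  have s: "0 < s" using x by (simp add: s_def)
  have H: "0 < H s" using H_bounds[of s] s by auto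
  have G: "Glim b x = H s * (W \<kappa> s + b - V x) - s * (H1 s)\<^sup>2 / H s" by (simp add: Glim_def s_def Let_def)
  show ?thesis
  proof (cases "norm (x - a (idx x)) < \<delta>")
    case True
    have "\<kappa>\<^sup>2 / s - lam / s - 1 / s = (\<kappa>\<^sup>2 - lam - 1) / s" by (simp add: diff_divide_distrib)
    also have "\<dots> \<ge> 0" using s lam by simp
    finally have "1 \<le> W \<kappa> s + b - V x - 1 / s"
      using W_bounds(2)[OF s \<kappa>] True b by (simp add: V_idx s_def)
    then have "H s * 1 \<le> H s * (W \<kappa> s + b - V x - 1 / s)" using H by (intro mult_left_mono) auto
    also have "\<dots> = H s * (W \<kappa> s + b - V x) - H s / s" by (simp add: right_diff_distrib)
    also have "\<dots> \<le> Glim b x" unfolding G using H_quotient(1)[OF s] by simp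
    finally show ?thesis using H by simp
  next
    case False
    then have "\<delta>\<^sup>2 \<le> s" unfolding s_def using delta by (intro power_mono) auto
    then have "Glim b x = b" unfolding G using False by (simp add: far W_far V_idx)
    moreover have "b > 0" unfolding b using \<kappa> by (simp add: add_nonneg_pos)
    ultimately show ?thesis by simp
  qed
qed

text \<open>For fixed \<open>e\<close> and \<open>R\<close> the cutoff stays away from the poles and
  has bounded support, so the weak equation holds in a uniform neighbourhood of its support and
  \<open>V\<close> is bounded there.\<close>

lemma G_integral_nonpos:
  fixes g :: "real^'n \<Rightarrow> complex" and g' :: "real^'n \<Rightarrow> real"
  assumes g: "g \<in> L2" and ker: "\<And>u. u \<in> Cc_inf \<Omega> \<Longrightarrow> L2_inner (\<lambda>x. T u x + complex_of_real b * u x) g = 0"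
    and h: "bounded_linear h" and g': "g' \<in> borel_measurable borel" "AE x in lebesgue. g' x = h (g x)"
      "integrable lborel (\<lambda>x. (g' x)\<^sup>2)"
    and e: "0 < e" "e \<le> 1" and R: "1 \<le> R"
  shows "(\<integral>x. G b e R x * (g' x)\<^sup>2 \<partial>lborel) \<le> 0"
proof -
  \<comment> \<open>On the support of the cutoff the distance to the selected pole is at least e
    \<delta> / 2 = 2 \<rho>, and to the other poles at least \<delta>, which is no smaller because e
    \<le> 1. Balls of radius \<rho> around the support thus keep distance \<rho> from all
    poles.\<close>
  define \<rho> where "\<rho> = e * \<delta> / 4"
  have \<rho>: "0 < \<rho>" using e delta by (simp add: \<rho>_def)
  define A where "A = {x. \<forall>n. \<rho> \<le> norm (x - a n)}"
  have "closed A" unfolding A_def by (intro closed_Collect_all closed_Collect_le continuous_intros)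
  then have A: "A \<in> sets borel" by (rule borel_closed)
  have out: "\<eta> e R (idx x) x = 0" "C e R (idx x) x = 0" if "norm x > R" for x
    using \<zeta>_bounds(4,5)[OF R that] by (simp_all add: \<eta>_def \<eta>1_def C_def)
  have supp: "ball y \<rho> \<subseteq> A" if "\<eta> e R (idx y) y \<noteq> 0" for y
  proof
    fix z assume z: "z \<in> ball y \<rho>"
    have "p e ((norm (y - a (idx y)))\<^sup>2) \<noteq> 0" using that by (auto simp: \<eta>_def)
    then have "e\<^sup>2 * \<delta>\<^sup>2 / 2 \<le> (norm (y - a (idx y)))\<^sup>2" using p_zero_near(1)[OF e(1)] by (meson not_le zero_le_power2)
    moreover have "(2 * \<rho>)\<^sup>2 \<le> e\<^sup>2 * \<delta>\<^sup>2 / 2" by (simp add: \<rho>_def power_mult_distrib power_divide)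
    ultimately have "(2 * \<rho>)\<^sup>2 \<le> (norm (y - a (idx y)))\<^sup>2" by linarith
    then have 1: "2 * \<rho> \<le> norm (y - a (idx y))" by (rule power2_le_imp_le) simp
    have "\<rho> \<le> norm (z - a n)" for n
    proof -
      have "2 * \<rho> \<le> norm (y - a n)"
      proof (cases "n = idx y")
        case False
        then have "\<delta> \<le> norm (y - a n)" using idx_unique[of y n] by force
        moreover have "e * \<delta> \<le> 1 * \<delta>" using e delta by (intro mult_right_mono) auto
        moreover have "2 * \<rho> = e * \<delta> / 2" by (simp add: \<rho>_def)
        ultimately show ?thesis using delta(1) by linarith
      qed (use 1 in simp)
      moreover have "norm (y - a n) \<le> norm (y - z) + norm (z - a n)"
        using norm_triangle_ineq[of "y - z" "z - a n"] by simp
      moreover have "norm (y - z) < \<rho>" using z by (simp add: dist_norm)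
      ultimately show ?thesis by linarith
    qed
    then show "z \<in> A" by (simp add: A_def)
  qed
  have qA: "\<bar>b - V x\<bar> \<le> \<bar>b\<bar> + \<bar>lam\<bar> / \<rho>\<^sup>2" if "x \<in> A" for x
    using V_bound[OF \<rho>, of x] that abs_triangle_ineq4[of b "V x"] by (auto simp: A_def)
  have weak: "(\<Sum>i\<in>UNIV. conv (K2 i) g' y) = conv K (\<lambda>x. (b - V x) * g' x) y"
    if mol: "mollifier e' K K1 K2" and e': "e' < \<rho>" and y: "ball y \<rho> \<subseteq> A" for K K1 K2 e' y
  proof (rule kernel_weak_equation[OF g ker h g' mol])
    show "cball y e' \<subseteq> \<Omega>"
    proof
      fix z assume "z \<in> cball y e'"
      then have "z \<in> A" using e' y by auto
      then show "z \<in> \<Omega>" using \<rho> by (auto simp: A_def) (metis norm_zero not_le right_minus_eq)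
    qed
  qed
  have "(\<integral>x. (C e R (idx x) x + (\<eta> e R (idx x) x)\<^sup>2 * (b - V x)) * (g' x)\<^sup>2 \<partial>lborel) \<le> 0"
  proof (rule weak_solution_inequality[where R = R and A = A and r = \<rho> and M = "\<bar>b\<bar> + \<bar>lam\<bar> / \<rho>\<^sup>2"
        and ?\<eta>1.0 = "\<lambda>i x. \<eta>1 e R i (idx x) x" and F = "\<lambda>i x. F i (idx x) x" and ?F1.0 = "\<lambda>i x. F1 i (idx x) x"])
    show "(\<lambda>x. b - V x) \<in> borel_measurable borel" by measurable
    show "has_pd i (\<lambda>x. (\<eta> e R (idx x) x)\<^sup>2 * F i (idx x) x)
        (2 * \<eta> e R (idx x) x * \<eta>1 e R i (idx x) x * F i (idx x) x + (\<eta> e R (idx x) x)\<^sup>2 * F1 i (idx x) x) x" for i x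
      using glued(2)[OF e(1)] unfolding D_def .
    show "continuous_on UNIV (\<lambda>x. 2 * \<eta> e R (idx x) x * \<eta>1 e R i (idx x) x * F i (idx x) x + (\<eta> e R (idx x) x)\<^sup>2 * F1 i (idx x) x)" for i
      using glued(6)[OF e(1)] unfolding D_def .
    show "C e R (idx x) x = - (\<Sum>i\<in>UNIV. (\<eta> e R (idx x) x)\<^sup>2 * ((F i (idx x) x)\<^sup>2 + F1 i (idx x) x) + (\<eta>1 e R i (idx x) x)\<^sup>2)" for x
      by (rule C_def)
  qed (fact g' A qA \<rho> supp weak glued[OF e(1)] out)+
  then show ?thesis by (simp add: G_def)
qed

text \<open>Dominated convergence turns the inequalities into one whose coefficient is positive
  almost everywhere; a nonpositive integral then forces the function to vanish.\<close>

lemma kernel_trivial_component: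
  fixes g :: "real^'n \<Rightarrow> complex" and h :: "complex \<Rightarrow> real"
  assumes g: "g \<in> L2" and ker: "\<And>u. u \<in> Cc_inf \<Omega> \<Longrightarrow> L2_inner (\<lambda>x. T u x + complex_of_real b * u x) g = 0"
    and h: "bounded_linear h" "\<And>z. \<bar>h z\<bar> \<le> norm z"
    and \<kappa>: "0 \<le> \<kappa>" and lam: "lam \<le> \<kappa>\<^sup>2 - 1" and b: "b = (4 * \<kappa> + 2 * \<kappa>\<^sup>2) / \<delta>\<^sup>2 + 1"
  shows "AE x in lebesgue. h (g x) = 0"
proof -
  have [measurable]: "g \<in> borel_measurable lebesgue" using g by (simp add: L2_def)
  have hm[measurable]: "(\<lambda>x. h (g x)) \<in> borel_measurable lebesgue"
    by (rule borel_measurable_continuous_on[OF bounded_linear.continuous_on[OF h(1) continuous_on_id]]) simp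
  obtain g' where g'm: "g' \<in> borel_measurable lborel" and "AE x in lborel. h (g x) = g' x"
    using completion_ex_borel_measurable_real[OF hm] by blast
  then have ae: "AE x in lebesgue. g' x = h (g x)" by (auto simp: AE_completion_iff eq_commute intro: AE_completion)
  have g'1[measurable]: "g' \<in> borel_measurable borel" using g'm by simp
  have "integrable lebesgue (\<lambda>x. (h (g x))\<^sup>2)"
  proof (rule Bochner_Integration.integrable_bound[OF L2_integrable_sq[OF g]])
    have "norm ((h (g x))\<^sup>2) \<le> norm ((norm (g x))\<^sup>2)" for x
      using power_mono[OF h(2)[of "g x"], of 2] by simp
    then show "AE x in lebesgue. norm ((h (g x))\<^sup>2) \<le> norm ((norm (g x))\<^sup>2)" by simp
  qed measurable
  then have "integrable lebesgue (\<lambda>x. (g' x)\<^sup>2)"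
  proof (rule integrable_cong_AE_imp)
    show "(\<lambda>x. (g' x)\<^sup>2) \<in> borel_measurable lebesgue" by (intro borel_imp_lebesgue) measurable
    show "AE x in lebesgue. (h (g x))\<^sup>2 = (g' x)\<^sup>2" using ae by eventually_elim simp
  qed
  then have g'2: "integrable lborel (\<lambda>x. (g' x)\<^sup>2)" by (simp add: lebesgue_eq_lborel)
  define e where "e k = 1 / real (k + 1)" for k :: nat
  define R where "R k = real (k + 1)" for k :: nat
  have e: "0 < e k" "e k \<le> 1" "1 \<le> R k" for k by (auto simp: e_def R_def)
  have e0: "e \<longlonglongrightarrow> 0" unfolding e_def by real_asymp
  have R0: "filterlim R at_top sequentially" unfolding R_def by real_asymp
  have nonpole: "AE x in lborel. x \<notin> range a"
    by (rule AE_not_in) (auto intro: countable_imp_null_set_lborel)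
  have [measurable]: "G b (e k) (R k) \<in> borel_measurable borel" for k
  proof -
    have [measurable]: "(\<lambda>x. C (e k) (R k) (idx x) x) \<in> borel_measurable borel" "(\<lambda>x. \<eta> (e k) (R k) (idx x) x) \<in> borel_measurable borel"
      using glued[OF e(1)] by (auto intro: borel_measurable_continuous_onI)
    show ?thesis unfolding G_def by measurable
  qed
  \<comment> \<open>\<open>Glim\<close> involves the choice function \<open>idx\<close>. Defining
    the limit through \<open>lim\<close> gives Borel measurability directly from that of the
    continuous glued functions.\<close>
  define Gl where "Gl x = lim (\<lambda>k. G b (e k) (R k) x)" for x
  have [measurable]: "Gl \<in> borel_measurable borel" unfolding Gl_def by measurable
  have lim: "AE x in lborel. (\<lambda>k. G b (e k) (R k) x * (g' x)\<^sup>2) \<longlonglongrightarrow> Gl x * (g' x)\<^sup>2" and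
    pos: "AE x in lborel. 0 < Gl x"
  proof -
    have "(\<lambda>k. G b (e k) (R k) x) \<longlonglongrightarrow> Gl x \<and> 0 < Gl x" if x: "x \<notin> range a" for x
    proof -
      have ne: "x \<noteq> a (idx x)" using x by auto
      have "Gl x = Glim b x" unfolding Gl_def by (rule limI[OF G_tendsto[OF ne e0 R0]])
      then show ?thesis using G_tendsto[OF ne e0 R0] Glim_pos[OF ne \<kappa> lam b] by simp
    qed
    then have *: "AE x in lborel. (\<lambda>k. G b (e k) (R k) x) \<longlonglongrightarrow> Gl x \<and> 0 < Gl x"
      using nonpole by (auto elim!: eventually_mono)
    show "AE x in lborel. (\<lambda>k. G b (e k) (R k) x * (g' x)\<^sup>2) \<longlonglongrightarrow> Gl x * (g' x)\<^sup>2"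
      using * by eventually_elim (auto intro!: tendsto_intros)
    show "AE x in lborel. 0 < Gl x" using * by eventually_elim simp
  qed
  let ?B = "4 * \<kappa> / \<delta>\<^sup>2 + \<bar>b\<bar> + (\<kappa>\<^sup>2 + \<bar>lam\<bar>) * (2 / \<delta>\<^sup>2) + 4 / \<delta>\<^sup>2 + 32"
  have dom: "AE x in lborel. norm (G b (e k) (R k) x * (g' x)\<^sup>2) \<le> ?B * (g' x)\<^sup>2" for k
    using G_bound[OF e(1) e(3) \<kappa>] by (auto simp: abs_mult intro!: mult_right_mono)
  have iB: "integrable lborel (\<lambda>x. ?B * (g' x)\<^sup>2)" using g'2 by simp
  have "(\<lambda>k. \<integral>x. G b (e k) (R k) x * (g' x)\<^sup>2 \<partial>lborel) \<longlonglongrightarrow> (\<integral>x. Gl x * (g' x)\<^sup>2 \<partial>lborel)"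
    by (rule integral_dominated_convergence[OF _ _ iB lim dom]) measurable
  then have le: "(\<integral>x. Gl x * (g' x)\<^sup>2 \<partial>lborel) \<le> 0"
    by (rule LIMSEQ_le_const2) (use G_integral_nonpos[OF g ker h(1) g'1 ae g'2 e] in auto)
  have int: "integrable lborel (\<lambda>x. Gl x * (g' x)\<^sup>2)"
    by (rule integrable_dominated_convergence[OF _ _ iB lim dom]) measurable
  have nn: "AE x in lborel. 0 \<le> Gl x * (g' x)\<^sup>2" using pos by eventually_elim simp
  have "(\<integral>x. Gl x * (g' x)\<^sup>2 \<partial>lborel) = 0" using le integral_nonneg_AE[OF nn] by simp
  then have "AE x in lborel. Gl x * (g' x)\<^sup>2 = 0"
    using integral_nonneg_eq_0_iff_AE[OF int nn] by simp
  then have "AE x in lborel. g' x = 0" using pos by eventually_elim simp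
  then have "AE x in lebesgue. g' x = 0" by (rule AE_completion)
  then show ?thesis using ae by eventually_elim simp
qed

lemma kernel_trivial:
  fixes g :: "real^'n \<Rightarrow> complex"
  assumes "g \<in> L2" "\<And>u. u \<in> Cc_inf \<Omega> \<Longrightarrow> L2_inner (\<lambda>x. T u x + complex_of_real b * u x) g = 0"
    and "0 \<le> \<kappa>" "lam \<le> \<kappa>\<^sup>2 - 1" "b = (4 * \<kappa> + 2 * \<kappa>\<^sup>2) / \<delta>\<^sup>2 + 1"
  shows "AE x in lebesgue. g x = 0"
proof -
  have "AE x in lebesgue. Re (g x) = 0"
    by (rule kernel_trivial_component[OF assms(1,2) bounded_linear_Re abs_Re_le_cmod assms(3-5)])
  moreover have "AE x in lebesgue. Im (g x) = 0"
    by (rule kernel_trivial_component[OF assms(1,2) bounded_linear_Im abs_Im_le_cmod assms(3-5)])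
  ultimately show ?thesis by eventually_elim (simp add: complex_eq_iff)
qed

end

section \<open>Failure of essential self-adjointness above the threshold\<close>

text \<open>The function is dominated by a sum of multiples of indicators of dyadic balls. Their
  integrals form a geometric series with ratio 2 to the power 2 \<alpha> - N, where N is the
  dimension. The base is the squared norm, to match profiles depending on |x - a 0|^2.\<close>

lemma integrable_norm_powr_unit_ball:
  fixes \<alpha> :: real
  assumes \<alpha>: "0 < \<alpha>" "2 * \<alpha> < real DIM('a::euclidean_space)"
  shows "integrable lborel (\<lambda>x::'a. indicator (ball 0 1) x * ((norm x)\<^sup>2) powr (- \<alpha>))"
proof -
  let ?g = "\<lambda>x::'a. indicator (ball 0 1) x * ((norm x)\<^sup>2) powr (- \<alpha>)"
  define f where "f k x = (2 powr (2 * \<alpha>)) ^ (k + 1) * indicator (ball 0 ((1/2) ^ k)) x" for k and x :: 'a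
  have [measurable]: "(\<lambda>x::'a. (norm x)\<^sup>2) \<in> borel_measurable borel"
    by (intro borel_measurable_continuous_onI continuous_intros)
  have p: "(\<lambda>x::'a. ((norm x)\<^sup>2) powr (- \<alpha>)) \<in> borel_measurable borel" by measurable
  have gm: "?g \<in> borel_measurable borel"
    by (intro borel_measurable_times borel_measurable_indicator p) simp
  have [measurable]: "f k \<in> borel_measurable borel" for k
    unfolding f_def by (intro borel_measurable_times borel_measurable_const borel_measurable_indicator) simp
  have le: "ennreal (?g x) \<le> (\<Sum>k. ennreal (f k x))" for x
  proof (cases "0 < norm x \<and> norm x < 1")
    case False
    then have g0: "?g x = 0" by (cases "x = 0") auto
    show ?thesis unfolding g0 by simp
  next
    case True
    have ex: "\<exists>k. (1/2) ^ k \<le> norm x" using real_arch_pow_inv[of "norm x" "1/2"] True by (auto intro: less_imp_le)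
    \<comment> \<open>The least such exponent puts x in the shell between radii 2^(-K) and 2^(-K +
      1); the term of index \<open>k = K - 1\<close> already dominates the function there.\<close>
    define K where "K = (LEAST k. (1/2) ^ k \<le> norm x)"
    have K: "(1/2) ^ K \<le> norm x" unfolding K_def by (rule LeastI_ex[OF ex])
    have "K \<noteq> 0" using K True by (cases K) auto
    then obtain k where k: "K = Suc k" by (cases K) auto
    have "norm x < (1/2) ^ k" using not_less_Least[of k "\<lambda>k. (1/2) ^ k \<le> norm x"] k by (simp add: K_def)
    have "?g x \<le> f k x"
    proof -
      have "((norm x)\<^sup>2) powr (- \<alpha>) \<le> (((1/2) ^ K)\<^sup>2) powr (- \<alpha>)"
        using K \<alpha> by (intro powr_mono2' power_mono) auto
      also have "(((1/2) ^ K)\<^sup>2) powr (- \<alpha>) = (2 powr (2 * \<alpha>)) ^ K"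
      proof -
        have A: "(1/2 :: real) ^ K = 2 powr (- real K)"
          by (simp add: powr_minus powr_realpow power_one_over inverse_eq_divide)
        have B: "(2 powr (2 * \<alpha>)) ^ K = 2 powr (2 * \<alpha> * real K)"
          using powr_realpow[of "2 powr (2 * \<alpha>)" K] by (simp add: powr_powr)
        show ?thesis unfolding A B power2_eq_square powr_add[symmetric] powr_powr by (simp add: algebra_simps)
      qed
      finally show ?thesis using \<open>norm x < (1/2) ^ k\<close> True k by (simp add: f_def)
    qed
    then have "ennreal (?g x) \<le> (\<Sum>j\<in>{k}. ennreal (f j x))" by (simp add: ennreal_leI)
    also have "\<dots> \<le> (\<Sum>k. ennreal (f k x))" by (rule sum_le_suminf) auto
    finally show ?thesis .
  qed
  \<comment> \<open>The height grows by 2 to the power 2 \<alpha> per step and the volume shrinks by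
    2 to the power of the dimension; integrability is \<open>Q < 1\<close>.\<close>
  define Q where "Q = 2 powr (2 * \<alpha> - real DIM('a))"
  have Q: "0 \<le> Q" "Q < 1" using \<alpha> by (auto simp: Q_def powr_less_one)
  let ?c = "2 powr (2 * \<alpha>) * measure lborel (ball (0::'a) 1)"
  have "(\<integral>\<^sup>+x. ennreal (?g x) \<partial>lborel) \<le> (\<integral>\<^sup>+x. (\<Sum>k. ennreal (f k x)) \<partial>lborel)"
    by (intro nn_integral_mono le)
  also have "\<dots> = (\<Sum>k. \<integral>\<^sup>+x. ennreal (f k x) \<partial>lborel)"
    by (rule nn_integral_suminf) measurable
  also have "\<dots> = (\<Sum>k. ennreal (?c * Q ^ k))"
  proof (rule suminf_cong)
    fix k
    have "(\<integral>\<^sup>+x. ennreal (f k x) \<partial>lborel) = (\<integral>\<^sup>+x. ennreal ((2 powr (2 * \<alpha>)) ^ (k + 1)) * indicator (ball 0 ((1/2) ^ k)) x \<partial>(lborel :: 'a measure))"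
      unfolding f_def by (intro nn_integral_cong) (auto simp: indicator_def)
    also have "\<dots> = ennreal ((2 powr (2 * \<alpha>)) ^ (k + 1)) * emeasure lborel (ball (0::'a) ((1/2) ^ k))"
      by (rule nn_integral_cmult_indicator) simp
    also have "emeasure lborel (ball (0::'a) ((1/2) ^ k)) = ennreal (measure lborel (ball (0::'a) ((1/2) ^ k)))"
      using emeasure_lborel_ball_finite[of "0::'a"] by (intro emeasure_eq_ennreal_measure) (auto simp: less_top)
    also have "measure lborel (ball (0::'a) ((1/2) ^ k)) = ((1/2) ^ k) ^ DIM('a) * measure lborel (ball (0::'a) 1)"
      by (rule content_ball_conv_unit_ball) simp
    also have "ennreal ((2 powr (2 * \<alpha>)) ^ (k + 1)) * ennreal (((1/2) ^ k) ^ DIM('a) * measure lborel (ball (0::'a) 1))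
       = ennreal ((2 powr (2 * \<alpha>)) ^ (k + 1) * (((1/2) ^ k) ^ DIM('a) * measure lborel (ball (0::'a) 1)))"
      by (rule ennreal_mult[symmetric]) auto
    also have "(2 powr (2 * \<alpha>)) ^ (k + 1) * (((1/2) ^ k) ^ DIM('a) * measure lborel (ball (0::'a) 1)) = ?c * Q ^ k"
    proof -
      have "Q = 2 powr (2 * \<alpha>) * (1/2) ^ DIM('a)"
        by (simp add: Q_def powr_diff powr_realpow power_one_over)
      moreover have "((1/2 :: real) ^ DIM('a)) ^ k = ((1/2) ^ k) ^ DIM('a)"
        unfolding power_mult[symmetric] by (subst mult.commute) (rule refl)
      ultimately have "Q ^ k = (2 powr (2 * \<alpha>)) ^ k * ((1/2) ^ k) ^ DIM('a)"
        by (simp only: power_mult_distrib)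
      then show ?thesis by (simp only: Suc_eq_plus1[symmetric] power_Suc mult_ac)
    qed
    finally show "(\<integral>\<^sup>+x. ennreal (f k x) \<partial>lborel) = ennreal (?c * Q ^ k)" .
  qed
  also have "\<dots> = ennreal (\<Sum>k. ?c * Q ^ k)"
    using Q by (intro suminf_ennreal2 summable_mult summable_geometric) auto
  finally have "(\<integral>\<^sup>+x. ennreal (?g x) \<partial>lborel) < \<infinity>"
    by (rule le_less_trans) simp
  then show ?thesis using gm by (intro integrableI_bounded) (auto simp: abs_mult)
qed

lemma zero_in_Cc_inf: "(\<lambda>x. 0) \<in> Cc_inf \<Omega>"
proof (rule Cc_infI[of _ "{}"])
  show "smooth_fun (\<lambda>x. 0)" by (rule smooth_funI(1)[where G = "\<lambda>is x. 0"]) (auto simp: has_pd_const)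
qed auto

context poles
begin

lemma T_essentially_self_adjoint:
  assumes pos: "\<And>f :: real^'n \<Rightarrow> real. f \<in> Cc_inf \<Omega> \<Longrightarrow> 0 \<le> (\<integral>x. grad_sq f x - V x * (f x)\<^sup>2 \<partial>lborel)"
    and \<kappa>: "0 \<le> \<kappa>" and lam: "lam \<le> \<kappa>\<^sup>2 - 1"
  shows "essentially_self_adjoint T (Cc_inf \<Omega>)"
proof (rule essentially_self_adjointI[where b = "(4 * \<kappa> + 2 * \<kappa>\<^sup>2) / \<delta>\<^sup>2 + 1"])
  show "Cc_inf \<Omega> \<noteq> ({} :: (real^'n \<Rightarrow> complex) set)" using zero_in_Cc_inf by blast
  show "0 < (4 * \<kappa> + 2 * \<kappa>\<^sup>2) / \<delta>\<^sup>2 + 1" using \<kappa> by (simp add: add_nonneg_pos)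
  show "0 \<le> Re (L2_inner (T u) u)" if "u \<in> Cc_inf \<Omega>" for u
    by (rule T_nonneg[OF pos that])
  show "AE x in lebesgue. g x = 0" if "g \<in> L2"
    "\<And>u. u \<in> Cc_inf \<Omega> \<Longrightarrow> L2_inner (\<lambda>x. T u x + complex_of_real ((4 * \<kappa> + 2 * \<kappa>\<^sup>2) / \<delta>\<^sup>2 + 1) * u x) g = 0" for g
    by (rule kernel_trivial[OF that \<kappa> lam refl])
qed (fact T_in_L2 Cc_inf_lincomb(1) T_linear T_symmetric)+

text \<open>The positive part of 1 - s / \<delta>^2 to the third power: unlike \<open>pos_sq\<close>
  it is twice continuously differentiable, as a cutoff for solutions of a second-order equation must
  be.\<close>

definition \<phi> :: "real \<Rightarrow> real" where "\<phi> s = (1 - s / \<delta>\<^sup>2) * pos_sq (1 - s / \<delta>\<^sup>2)"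
definition \<phi>1 :: "real \<Rightarrow> real" where "\<phi>1 s = - (3 * pos_sq (1 - s / \<delta>\<^sup>2) / \<delta>\<^sup>2)"
definition \<phi>2 :: "real \<Rightarrow> real" where "\<phi>2 s = 6 * max 0 (1 - s / \<delta>\<^sup>2) / (\<delta>\<^sup>2 * \<delta>\<^sup>2)"

lemma \<phi>_derivatives:
  "(\<phi> has_real_derivative \<phi>1 s) (at s)" "(\<phi>1 has_real_derivative \<phi>2 s) (at s)"
proof -
  define t where "t = 1 - s / \<delta>\<^sup>2"
  have dt: "((\<lambda>s. 1 - s / \<delta>\<^sup>2) has_real_derivative - (1 / \<delta>\<^sup>2)) (at s)"
    using \<delta>0 by (auto intro!: derivative_eq_intros simp: field_simps)
  have dp: "((\<lambda>s. pos_sq (1 - s / \<delta>\<^sup>2)) has_real_derivative 2 * max 0 t * - (1 / \<delta>\<^sup>2)) (at s)"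
    unfolding t_def by (rule DERIV_chain2[OF pos_sq_has_derivative dt])
  have d: "(\<phi> has_real_derivative - (1 / \<delta>\<^sup>2) * pos_sq t + 2 * max 0 t * - (1 / \<delta>\<^sup>2) * t) (at s)"
    using DERIV_mult[OF dt dp] unfolding \<phi>_def t_def by simp
  have mt: "max 0 t * t = pos_sq t" by (simp add: pos_sq_def max_def power2_eq_square)
  have "- (1 / \<delta>\<^sup>2) * pos_sq t + 2 * max 0 t * - (1 / \<delta>\<^sup>2) * t = - (1 / \<delta>\<^sup>2) * pos_sq t - (2 / \<delta>\<^sup>2) * (max 0 t * t)"
    by simp
  also have "\<dots> = \<phi>1 s" unfolding mt \<phi>1_def t_def[symmetric] using \<delta>0 by (simp add: field_simps)
  finally show "(\<phi> has_real_derivative \<phi>1 s) (at s)" using d by (simp only:)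
  have "(\<phi>1 has_real_derivative - (3 * (2 * max 0 t * - (1 / \<delta>\<^sup>2)) / \<delta>\<^sup>2)) (at s)"
    unfolding \<phi>1_def by (intro DERIV_minus DERIV_cdivide DERIV_cmult dp)
  then show "(\<phi>1 has_real_derivative \<phi>2 s) (at s)" by (simp add: \<phi>2_def t_def)
qed

lemma \<phi>_continuous: "isCont f x \<Longrightarrow> isCont (\<lambda>x. \<phi> (f x)) x" "isCont f x \<Longrightarrow> isCont (\<lambda>x. \<phi>1 (f x)) x" "isCont f x \<Longrightarrow> isCont (\<lambda>x. \<phi>2 (f x)) x"
  for f :: "'b::t2_space \<Rightarrow> real"
  unfolding \<phi>_def \<phi>1_def \<phi>2_def pos_sq_def using \<delta>0 by (intro continuous_intros; simp)+

lemma \<phi>_far: "\<delta>\<^sup>2 \<le> s \<Longrightarrow> \<phi> s = 0 \<and> \<phi>1 s = 0 \<and> \<phi>2 s = 0"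
proof -
  assume "\<delta>\<^sup>2 \<le> s"
  then have "1 - s / \<delta>\<^sup>2 \<le> 0" using \<delta>0 by (simp add: field_simps)
  then show ?thesis by (simp add: \<phi>_def \<phi>1_def \<phi>2_def pos_sq_def)
qed

lemma \<phi>_bounds:
  assumes "0 \<le> s"
  shows "\<bar>\<phi> s\<bar> \<le> 1" "\<bar>\<phi>1 s\<bar> \<le> 3 / \<delta>\<^sup>2" "\<bar>\<phi>2 s\<bar> \<le> 6 / (\<delta>\<^sup>2 * \<delta>\<^sup>2)"
proof -
  define t where "t = 1 - s / \<delta>\<^sup>2"
  have t: "t \<le> 1" using assms by (simp add: t_def)
  have m: "0 \<le> max 0 t" "max 0 t \<le> 1" using t by auto
  have p: "0 \<le> pos_sq t" "pos_sq t \<le> 1" using m by (auto simp: pos_sq_def power_le_one)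
  have "\<bar>t * pos_sq t\<bar> \<le> 1"
  proof (cases "0 \<le> t")
    case True
    then show ?thesis using t p mult_mono[of t 1 "pos_sq t" 1] by (simp add: abs_mult)
  qed (simp add: pos_sq_def)
  then show "\<bar>\<phi> s\<bar> \<le> 1" by (simp add: \<phi>_def t_def)
  show "\<bar>\<phi>1 s\<bar> \<le> 3 / \<delta>\<^sup>2" using p unfolding \<phi>1_def t_def[symmetric] by (simp add: divide_right_mono)
  show "\<bar>\<phi>2 s\<bar> \<le> 6 / (\<delta>\<^sup>2 * \<delta>\<^sup>2)" using m unfolding \<phi>2_def t_def[symmetric] by (simp add: abs_mult divide_right_mono)
qed

abbreviation r2 :: "real^'n \<Rightarrow> real" where "r2 x \<equiv> (norm (x - a 0))\<^sup>2"

(* h m = - (Laplacian of w m) - V * w m whenever 2 m is a root of g^2 - (N - 2) g + lam. *)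
definition w :: "real \<Rightarrow> real^'n \<Rightarrow> real" where "w m x = \<phi> (r2 x) * r2 x powr (- m)"
definition h :: "real \<Rightarrow> real^'n \<Rightarrow> real" where
  "h m x = - ((4 * r2 x * \<phi>2 (r2 x) + (2 * real CARD('n) - 8 * m) * \<phi>1 (r2 x)) * r2 x powr (- m))"
text \<open>\<open>K1\<close> and \<open>K2\<close> are the first and second derivatives in s of the
  radial profile \<open>\<phi> s * s powr (- m)\<close>.\<close>

definition K1 :: "real \<Rightarrow> real \<Rightarrow> real" where "K1 m s = (\<phi>1 s - m * \<phi> s / s) * s powr (- m)"
definition K2 :: "real \<Rightarrow> real \<Rightarrow> real" where
  "K2 m s = (\<phi>2 s - 2 * m * \<phi>1 s / s + (m + m\<^sup>2) * \<phi> s / s\<^sup>2) * s powr (- m)"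

lemma profile_derivatives:
  assumes s: "0 < s"
  shows "((\<lambda>s. \<phi> s * s powr (- m)) has_real_derivative K1 m s) (at s)" "(K1 m has_real_derivative K2 m s) (at s)"
proof -
  have dp: "((\<lambda>s. s powr (- m)) has_real_derivative - (m * (s powr (- m) / s))) (at s)"
    using has_real_derivative_powr[OF s, of "- m"] s by (simp add: powr_diff)
  have "((\<lambda>s. \<phi> s * s powr (- m)) has_real_derivative \<phi>1 s * s powr (- m) + - (m * (s powr (- m) / s)) * \<phi> s) (at s)"
    by (rule DERIV_mult[OF \<phi>_derivatives(1) dp])
  then show "((\<lambda>s. \<phi> s * s powr (- m)) has_real_derivative K1 m s) (at s)"
    by (simp add: K1_def algebra_simps)
  have dq: "((\<lambda>s. \<phi>1 s - m * \<phi> s / s) has_real_derivative \<phi>2 s - (m * \<phi>1 s * s - m * \<phi> s * 1) / (s * s)) (at s)"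
    using s by (intro DERIV_diff DERIV_divide DERIV_cmult \<phi>_derivatives DERIV_ident) auto
  have "(K1 m has_real_derivative (\<phi>2 s - (m * \<phi>1 s * s - m * \<phi> s * 1) / (s * s)) * s powr (- m) + - (m * (s powr (- m) / s)) * (\<phi>1 s - m * \<phi> s / s)) (at s)"
    unfolding K1_def by (rule DERIV_mult[OF dq dp])
  moreover have "(\<phi>2 s - (m * \<phi>1 s * s - m * \<phi> s * 1) / (s * s)) * s powr (- m) + - (m * (s powr (- m) / s)) * (\<phi>1 s - m * \<phi> s / s) = K2 m s"
    unfolding K2_def using s by (simp add: field_simps power2_eq_square)
  ultimately show "(K1 m has_real_derivative K2 m s) (at s)" by simp
qed

lemma singular_profile_has_pd:
  assumes x: "x \<noteq> a 0"
  shows "has_pd i (w m) (K1 m (r2 x) * (2 * (x - a 0) $ i)) x"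
    "has_pd i (\<lambda>x. K1 m (r2 x) * (2 * (x - a 0) $ i)) (K1 m (r2 x) * 2 + K2 m (r2 x) * (2 * (x - a 0) $ i) * (2 * (x - a 0) $ i)) x"
proof -
  have s: "0 < r2 x" using x by simp
  show "has_pd i (w m) (K1 m (r2 x) * (2 * (x - a 0) $ i)) x"
    unfolding w_def by (rule has_pd_chain[OF profile_derivatives(1)[OF s] has_pd_norm_sq])
  have px: "has_pd i (\<lambda>x. 2 * (x - a 0) $ i) 2 x"
  proof -
    have "has_pd i (\<lambda>x. 2 * (x $ i - a 0 $ i)) (2 * ((if i = i then 1 else 0) - 0) + 0 * (x $ i - a 0 $ i)) x"
      by (rule has_pd_mult[OF has_pd_const has_pd_diff[OF has_pd_nth has_pd_const]])
    then show ?thesis by simp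
  qed
  show "has_pd i (\<lambda>x. K1 m (r2 x) * (2 * (x - a 0) $ i)) (K1 m (r2 x) * 2 + K2 m (r2 x) * (2 * (x - a 0) $ i) * (2 * (x - a 0) $ i)) x"
    by (rule has_pd_mult[OF has_pd_chain[OF profile_derivatives(2)[OF s] has_pd_norm_sq] px])
qed

lemma singular_profile_continuous:
  assumes x: "x \<noteq> a 0"
  shows "isCont (w m) x" "isCont (\<lambda>x. K1 m (r2 x)) x" "isCont (\<lambda>x. K2 m (r2 x)) x"
proof -
  have s: "r2 x \<noteq> 0" using x by simp
  have c: "isCont r2 x" by (intro continuous_intros)
  show "isCont (w m) x" "isCont (\<lambda>x. K1 m (r2 x)) x" "isCont (\<lambda>x. K2 m (r2 x)) x"
    unfolding w_def K1_def K2_def using s by (intro continuous_intros c \<phi>_continuous; simp)+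
qed

text \<open>For a function f(s) of s = |x - a 0|^2 the Laplacian is 2 N f' + 4 s f''. The terms with
  \<phi> / s have coefficient - lam by the choice of \<open>m\<close> and cancel against V; those
  left contain derivatives of \<phi>, so \<open>h\<close> is no more singular than \<open>w\<close>.
  Beyond distance \<delta> the factor \<phi> vanishes along with V.\<close>

lemma singular_profile_equation:
  assumes x: "x \<noteq> a 0" and m: "4 * m\<^sup>2 + 4 * m - 2 * real CARD('n) * m + lam = 0"
  shows "(\<Sum>i\<in>UNIV. K1 m (r2 x) * 2 + K2 m (r2 x) * (2 * (x - a 0) $ i) * (2 * (x - a 0) $ i)) = - h m x - V x * w m x"
proof -
  define s where "s = r2 x"
  have s: "0 < s" using x by (simp add: s_def)
  have V: "V x * w m x = lam / s * w m x"
  proof (cases "norm (x - a 0) < \<delta>")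
    case True
    have "idx x = 0" by (rule idx_unique[OF True])
    then show ?thesis using True V_idx[of x] by (simp add: s_def)
  next
    case False
    then have "\<delta>\<^sup>2 \<le> r2 x" using delta by (intro power_mono) auto
    then show ?thesis using \<phi>_far by (simp add: w_def)
  qed
  define v where "v = x - a 0"
  have te: "K1 m s * 2 + K2 m s * (2 * v $ i) * (2 * v $ i) = 2 * K1 m s + 4 * K2 m s * (v $ i)\<^sup>2" for i
    by (simp add: power2_eq_square)
  have "(\<Sum>i\<in>UNIV. K1 m s * 2 + K2 m s * (2 * v $ i) * (2 * v $ i))
     = 2 * real CARD('n) * K1 m s + 4 * K2 m s * (\<Sum>i\<in>UNIV. (v $ i)\<^sup>2)"
    unfolding te by (simp add: sum.distrib sum_distrib_left)
  also have "(\<Sum>i\<in>UNIV. (v $ i)\<^sup>2) = s" unfolding s_def v_def by (rule sum_sq_components)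
  also have "2 * real CARD('n) * K1 m s + 4 * K2 m s * s
     = ((4 * s * \<phi>2 s + (2 * real CARD('n) - 8 * m) * \<phi>1 s) + (4 * m\<^sup>2 + 4 * m - 2 * real CARD('n) * m) * \<phi> s / s) * s powr (- m)"
    unfolding K1_def K2_def using s by (simp add: field_simps power2_eq_square)
  also have "4 * m\<^sup>2 + 4 * m - 2 * real CARD('n) * m = - lam" using m by linarith
  also have "((4 * s * \<phi>2 s + (2 * real CARD('n) - 8 * m) * \<phi>1 s) + - lam * \<phi> s / s) * s powr (- m) = - h m x - lam / s * w m x"
    unfolding h_def w_def s_def[symmetric] by (simp add: algebra_simps)
  finally show ?thesis unfolding V s_def v_def .
qed

lemma singular_measurable [measurable]: "w m \<in> borel_measurable borel" "h m \<in> borel_measurable borel"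
proof -
  have [measurable]: "(\<lambda>x. r2 x) \<in> borel_measurable borel" "\<phi> \<in> borel_measurable borel" "\<phi>1 \<in> borel_measurable borel" "\<phi>2 \<in> borel_measurable borel"
    by (auto intro!: borel_measurable_continuous_onI continuous_at_imp_continuous_on \<phi>_continuous[OF continuous_ident] continuous_intros)
  show "w m \<in> borel_measurable borel" "h m \<in> borel_measurable borel"
    unfolding w_def h_def by measurable
qed

text \<open>The square behaves like |x - a 0|^(- 4 m). The auxiliary exponent \<mu> is positive,
  whereas \<open>m\<close> may be zero or negative; inside the unit ball the larger exponent
  dominates.\<close>

lemma singular_in_L2:
  assumes f: "f \<in> borel_measurable borel" "\<And>x. \<delta>\<^sup>2 \<le> r2 x \<Longrightarrow> f x = 0" "\<And>x. \<bar>f x\<bar> \<le> B * r2 x powr (- m)"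
    and m: "m \<le> \<mu>" "0 < \<mu>" "4 * \<mu> < real CARD('n)"
  shows "(\<lambda>x. complex_of_real (f x)) \<in> L2"
proof -
  let ?d = "\<lambda>x::real^'n. indicator (ball 0 1) x * ((norm x)\<^sup>2) powr (- (2 * \<mu>))"
  have "integrable lborel ?d"
    by (rule integrable_norm_powr_unit_ball) (use m in simp_all)
  moreover have [measurable]: "?d \<in> borel_measurable borel" using calculation by simp
  ultimately have i: "integrable lborel (\<lambda>x. B\<^sup>2 * ?d (x - a 0))"
    using lborel_integral_shift(2)[of ?d "- a 0"] by simp
  have le: "(f x)\<^sup>2 \<le> B\<^sup>2 * ?d (x - a 0)" for x
  proof (cases "\<delta>\<^sup>2 \<le> r2 x \<or> x = a 0")
    case True
    then show ?thesis using f(2)[of x] f(3)[of x] by auto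
  next
    case False
    then have s: "0 < r2 x" "r2 x < \<delta>\<^sup>2" by auto
    have "norm (x - a 0) < \<delta>" using s delta by (intro power2_less_imp_less[of _ \<delta>]) auto
    then have n1: "norm (x - a 0) < 1" using delta by simp
    have s1: "r2 x \<le> 1" using n1 by (simp add: power_le_one)
    have "(f x)\<^sup>2 \<le> (B * r2 x powr (- m))\<^sup>2" using power_mono[OF f(3)[of x], of 2] by simp
    also have "\<dots> = B\<^sup>2 * r2 x powr (- (2 * m))"
      by (simp add: power_mult_distrib power2_eq_square powr_add[symmetric])
    also have "\<dots> \<le> B\<^sup>2 * r2 x powr (- (2 * \<mu>))"
      using s s1 m by (intro mult_left_mono powr_mono') auto
    finally show ?thesis using n1 by simp
  qed
  have "integrable lborel (\<lambda>x. (norm (complex_of_real (f x)))\<^sup>2)"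
    by (rule Bochner_Integration.integrable_bound[OF i]) (use f(1) le in \<open>auto intro: order_trans\<close>)
  then show ?thesis using f(1) by (simp add: L2_def borel_imp_lebesgue lebesgue_eq_lborel)
qed

lemma w_h_in_L2:
  assumes m: "m \<le> \<mu>" "0 < \<mu>" "4 * \<mu> < real CARD('n)"
  shows "(\<lambda>x. complex_of_real (w m x)) \<in> L2" "(\<lambda>x. complex_of_real (h m x)) \<in> L2"
proof -
  have far: "w m x = 0" "h m x = 0" if "\<delta>\<^sup>2 \<le> r2 x" for x
    using \<phi>_far[OF that] by (simp_all add: w_def h_def)
  show "(\<lambda>x. complex_of_real (w m x)) \<in> L2"
  proof (rule singular_in_L2[where B = 1, OF _ far(1) _ m])
    show "\<bar>w m x\<bar> \<le> 1 * r2 x powr (- m)" for x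
      unfolding w_def abs_mult using \<phi>_bounds(1)[of "r2 x"] by (intro mult_mono) auto
  qed auto
  let ?B = "4 * \<delta>\<^sup>2 * (6 / (\<delta>\<^sup>2 * \<delta>\<^sup>2)) + \<bar>2 * real CARD('n) - 8 * m\<bar> * (3 / \<delta>\<^sup>2)"
  show "(\<lambda>x. complex_of_real (h m x)) \<in> L2"
  proof (rule singular_in_L2[where B = ?B, OF _ far(2) _ m])
    show "\<bar>h m x\<bar> \<le> ?B * r2 x powr (- m)" for x
    proof (cases "\<delta>\<^sup>2 \<le> r2 x")
      case False
      have "\<bar>4 * r2 x * \<phi>2 (r2 x) + (2 * real CARD('n) - 8 * m) * \<phi>1 (r2 x)\<bar> \<le> \<bar>4 * r2 x * \<phi>2 (r2 x)\<bar> + \<bar>(2 * real CARD('n) - 8 * m) * \<phi>1 (r2 x)\<bar>"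
        by (rule abs_triangle_ineq)
      also have "\<dots> \<le> ?B"
        unfolding abs_mult using False \<phi>_bounds[of "r2 x"] by (intro add_mono mult_mono) auto
      finally show ?thesis unfolding h_def abs_minus_cancel abs_mult by (intro mult_mono) auto
    qed (simp add: far)
  qed auto
qed

text \<open>Green's identity on the complement of the single point \<open>a 0\<close>: test
  functions vanish near that pole, and the truncated solution is regular everywhere else, the other
  poles included.\<close>

lemma w_h_in_adjoint:
  assumes m: "m \<le> \<mu>" "0 < \<mu>" "4 * \<mu> < real CARD('n)" and eq: "4 * m\<^sup>2 + 4 * m - 2 * real CARD('n) * m + lam = 0"
  shows "((\<lambda>x. complex_of_real (w m x)), (\<lambda>x. complex_of_real (h m x))) \<in> graph_adjoint (op_graph T (Cc_inf \<Omega>))"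
proof -
  note L = w_h_in_L2[OF m]
  have "L2_inner (T u) (\<lambda>x. complex_of_real (w m x)) = L2_inner u (\<lambda>x. complex_of_real (h m x))" if u: "u \<in> Cc_inf \<Omega>" for u
  proof -
    let ?\<Omega> = "UNIV - {a 0}"
    have u': "u \<in> Cc_inf ?\<Omega>" using u by (auto simp: Cc_inf_def)
    have ua: "u (a 0) = 0" using Cc_inf_tsupport(4,5)[OF u] by blast
    have "a 0 \<notin> tsupport u" using Cc_inf_tsupport(4)[OF u] by auto
    then have la: "laplacian u (a 0) = 0" using iter_partial_outside_tsupport[OF u] by (simp add: laplacian_def del: iter_partial.simps)
    let ?w1 = "\<lambda>i x. complex_of_real (K1 m (r2 x) * (2 * (x - a 0) $ i))"
    let ?w2 = "\<lambda>i x. complex_of_real (K1 m (r2 x) * 2 + K2 m (r2 x) * (2 * (x - a 0) $ i) * (2 * (x - a 0) $ i))"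
    have cx: "isCont (\<lambda>x. (x - a 0) $ i) x" for i x by (intro continuous_intros)
    have green: "(\<integral>x. laplacian u x * complex_of_real (w m x) - u x * (\<Sum>i\<in>UNIV. ?w2 i x) \<partial>lborel) = 0"
    proof (rule Green_integral(2)[OF u' _, where ?w1.0 = ?w1])
      show "has_pd i (\<lambda>x. complex_of_real (w m x)) (?w1 i x) x" "has_pd i (?w1 i) (?w2 i x) x" if "x \<in> ?\<Omega>" for i x
      proof -
        have x: "x \<noteq> a 0" using that by simp
        show "has_pd i (\<lambda>x. complex_of_real (w m x)) (?w1 i x) x"
          by (rule has_pd_of_real[OF singular_profile_has_pd(1)[OF x]])
        show "has_pd i (?w1 i) (?w2 i x) x"
          by (rule has_pd_of_real[OF singular_profile_has_pd(2)[OF x]])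
      qed
      show "continuous_on ?\<Omega> (\<lambda>x. complex_of_real (w m x))"
        by (intro continuous_at_imp_continuous_on ballI continuous_intros singular_profile_continuous) auto
      show "continuous_on ?\<Omega> (?w1 i)" for i
        by (intro continuous_at_imp_continuous_on ballI continuous_intros singular_profile_continuous cx) auto
      show "continuous_on ?\<Omega> (?w2 i)" for i
        by (intro continuous_at_imp_continuous_on ballI continuous_intros singular_profile_continuous cx) auto
    qed auto
    have pt: "T u x * cnj (complex_of_real (w m x)) - u x * cnj (complex_of_real (h m x))
       = - (laplacian u x * complex_of_real (w m x) - u x * (\<Sum>i\<in>UNIV. ?w2 i x))" for x
    \<comment> \<open>The identity is used at every point. At the pole itself both sides are 0,
      because the test function and its Laplacian vanish there.\<close>
    proof (cases "x = a 0")
      case True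
      then show ?thesis using ua la by (simp add: schroedinger_op_def)
    next
      case False
      have S: "(\<Sum>i\<in>UNIV. ?w2 i x) = complex_of_real (- h m x - V x * w m x)"
        unfolding singular_profile_equation[OF False eq, symmetric] by simp
      show ?thesis unfolding S schroedinger_op_def by (simp add: algebra_simps)
    qed
    have [measurable]: "u \<in> borel_measurable borel" "laplacian u \<in> borel_measurable borel"
      using test_function_bounds[OF u] by blast+
    have "L2_inner (T u) (\<lambda>x. complex_of_real (w m x)) - L2_inner u (\<lambda>x. complex_of_real (h m x))
      = (\<integral>x. T u x * cnj (complex_of_real (w m x)) - u x * cnj (complex_of_real (h m x)) \<partial>lebesgue)"
      unfolding L2_inner_def by (intro Bochner_Integration.integral_diff[symmetric] L2_integrable_mult T_in_L2 u L)
    also have "\<dots> = (\<integral>x. T u x * cnj (complex_of_real (w m x)) - u x * cnj (complex_of_real (h m x)) \<partial>lborel)"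
      unfolding schroedinger_op_def by (intro lebesgue_eq_lborel) measurable
    also have "\<dots> = 0" unfolding pt Bochner_Integration.integral_minus green by simp
    finally show ?thesis by simp
  qed
  then show ?thesis using L by (auto simp: graph_adjoint_def op_graph_def)
qed

text \<open>Symmetry of the adjoint would make the integral of \<open>J\<close> vanish. As both
  solutions share the cutoff, the second-derivative terms drop out of \<open>J\<close>, and what is
  left is positive in the punctured ball because \<phi> is decreasing there.\<close>

lemma T_not_essentially_self_adjoint:
  assumes N: "CARD('n) \<ge> 3" and lam: "\<kappa>\<^sup>2 - 1 < lam" "lam < \<kappa>\<^sup>2"
  shows "\<not> essentially_self_adjoint T (Cc_inf \<Omega>)"
proof
  assume esa: "essentially_self_adjoint T (Cc_inf \<Omega>)"
  have card: "real CARD('n) = 2 * \<kappa> + 2" unfolding \<kappa>_def by (simp add: field_simps)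
  have \<kappa>0: "0 < \<kappa>" using N by (simp add: \<kappa>_def)
  \<comment> \<open>The two bounds on \<open>lam\<close> mean 0 < \<beta> < 1: the upper one
    separates the roots, and the lower one is 4 m < N for the larger root, that is, square
    integrability of the more singular solution.\<close>
  define \<beta> where "\<beta> = sqrt (\<kappa>\<^sup>2 - lam)"
  have \<beta>: "0 < \<beta>" "\<beta> < 1" "\<beta>\<^sup>2 = \<kappa>\<^sup>2 - lam" using lam by (auto simp: \<beta>_def)
  define m where "m = (\<kappa> + \<beta>) / 2"
  define m' where "m' = (\<kappa> - \<beta>) / 2"
  have eq: "4 * m\<^sup>2 + 4 * m - 2 * real CARD('n) * m + lam = 0" "4 * m'\<^sup>2 + 4 * m' - 2 * real CARD('n) * m' + lam = 0"
    using \<beta>(3) unfolding card m_def m'_def by (simp_all add: power2_eq_square field_simps)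
  have mm: "m \<le> m" "m' \<le> m" "0 < m" "4 * m < real CARD('n)" "m' < m"
    using \<kappa>0 \<beta> unfolding card m_def m'_def by auto
  note L = w_h_in_L2[OF mm(1,3,4)] w_h_in_L2[OF mm(2,3,4)]
  have sym: "L2_inner (\<lambda>x. complex_of_real (h m' x)) (\<lambda>x. complex_of_real (w m x))
      = L2_inner (\<lambda>x. complex_of_real (w m' x)) (\<lambda>x. complex_of_real (h m x))"
    by (rule essentially_self_adjoint_adjoint_symmetric[OF esa op_graph_T w_h_in_adjoint[OF mm(1,3,4) eq(1)] w_h_in_adjoint[OF mm(2,3,4) eq(2)]])
  define J where "J x = h m' x * w m x - w m' x * h m x" for x
  \<comment> \<open>Only the coefficient - 8 m of \<phi>1 differs between the two functions
    \<open>h\<close>, hence the factor \<open>8 * (m - m')\<close>.\<close>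
  have J: "J x = 8 * (m - m') * (- (\<phi> (r2 x) * \<phi>1 (r2 x))) * (r2 x powr (- m) * r2 x powr (- m'))" for x
    unfolding J_def h_def w_def by (simp add: algebra_simps)
  have neg: "0 \<le> - (\<phi> s * \<phi>1 s)" for s
    by (auto simp: \<phi>_def \<phi>1_def pos_sq_def max_def mult_nonneg_nonneg)
  have iJ: "integrable lebesgue (\<lambda>x. complex_of_real (h m' x) * cnj (complex_of_real (w m x)) - complex_of_real (w m' x) * cnj (complex_of_real (h m x)))"
    by (intro Bochner_Integration.integrable_diff L2_integrable_mult L)
  have Jc: "(\<lambda>x. complex_of_real (h m' x) * cnj (complex_of_real (w m x)) - complex_of_real (w m' x) * cnj (complex_of_real (h m x))) = (\<lambda>x. complex_of_real (J x))"
    by (auto simp: J_def fun_eq_iff)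
  have [measurable]: "J \<in> borel_measurable borel" unfolding J_def by measurable
  have i: "integrable lborel J"
    using iJ unfolding Jc complex_of_real_integrable_eq by (simp add: lebesgue_eq_lborel)
  have "(\<integral>x. complex_of_real (J x) \<partial>lebesgue) = 0"
    using sym L2_integrable_mult[OF L(4,1)] L2_integrable_mult[OF L(3,2)]
    unfolding Jc[symmetric] L2_inner_def by simp
  then have "integral\<^sup>L lborel J = 0"
    by (simp add: lebesgue_eq_lborel)
  moreover have "AE x in lborel. 0 \<le> J x"
    using neg mm unfolding J by (intro AE_I2 mult_nonneg_nonneg) auto
  ultimately have "AE x in lborel. J x = 0"
    using integral_nonneg_eq_0_iff_AE[OF i] by simp
  moreover have "AE x in lborel. x \<notin> {a 0}"
    by (rule AE_not_in) (auto intro: countable_imp_null_set_lborel)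
  ultimately have "AE x in lborel. x \<notin> ball (a 0) \<delta>"
  proof eventually_elim
    fix x assume x: "J x = 0" "x \<notin> {a 0}"
    show "x \<notin> ball (a 0) \<delta>"
    proof
      assume "x \<in> ball (a 0) \<delta>"
      then have "norm (x - a 0) < \<delta>" by (simp add: dist_norm norm_minus_commute)
      then have "r2 x < \<delta>\<^sup>2" by (intro power_strict_mono) auto
      then have "0 < 1 - r2 x / \<delta>\<^sup>2" using delta by simp
      then have "\<phi> (r2 x) > 0" "\<phi>1 (r2 x) < 0"
        using delta by (auto simp: \<phi>_def \<phi>1_def pos_sq_def intro!: mult_pos_pos divide_pos_pos zero_less_power)
      then have "0 < - (\<phi> (r2 x) * \<phi>1 (r2 x))" by (simp add: mult_pos_neg)
      moreover have "r2 x > 0" using x by simp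
      ultimately have "J x > 0" unfolding J using mm by (intro mult_pos_pos) auto
      then show False using x by simp
    qed
  qed
  from AE_not_in_ball[OF this] show False using delta by simp
qed

end

theorem theorem8p4:
  fixes a :: "nat \<Rightarrow> real^'n::finite" and lam \<delta> :: real
  assumes N3: "CARD('n) \<ge> 3"
    and lam: "lam < (real CARD('n) - 2)\<^sup>2 / 4"
    and a_nz: "\<forall>n. a n \<noteq> 0"
    and sum_a: "summable (\<lambda>n. inverse (norm (a n) ^ (CARD('n) - 2)))"
    and sup_a: "\<exists>M. \<forall>n. summable (\<lambda>k. inverse (norm (a (n + Suc k) - a n) ^ (CARD('n) - 2)))
                     \<and> (\<Sum>k. inverse (norm (a (n + Suc k) - a n) ^ (CARD('n) - 2))) \<le> M"
    and sep: "\<forall>n m. n \<noteq> m \<longrightarrow> norm (a n - a m) \<ge> 1"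
    and delta: "0 < \<delta>" "\<delta> < 1/2"
    and pos: "bdd_below {(\<integral>x. grad_sq u x - potential lam \<delta> a x * (u x)\<^sup>2 \<partial>lebesgue)
                          / (\<integral>x. grad_sq u x \<partial>lebesgue) | u. u \<in> Cc_inf UNIV \<and> u \<noteq> (\<lambda>x. 0)}"
             "Inf {(\<integral>x. grad_sq u x - potential lam \<delta> a x * (u x)\<^sup>2 \<partial>lebesgue)
                          / (\<integral>x. grad_sq u x \<partial>lebesgue) | u. u \<in> Cc_inf UNIV \<and> u \<noteq> (\<lambda>x. 0)} > 0"
  shows "essentially_self_adjoint (schroedinger_op (potential lam \<delta> a)) (Cc_inf (UNIV - range a))
         \<longleftrightarrow> lam \<le> (real CARD('n) - 2)\<^sup>2 / 4 - 1"
proof -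
  interpret poles a lam \<delta> by unfold_locales (use sep delta in auto)
  have \<kappa>: "\<kappa>\<^sup>2 = (real CARD('n) - 2)\<^sup>2 / 4" by (simp add: \<kappa>_def power_divide)
  have \<kappa>0: "0 \<le> \<kappa>" using N3 by (simp add: \<kappa>_def)
  have nonneg: "0 \<le> (\<integral>x. grad_sq f x - V x * (f x)\<^sup>2 \<partial>lborel)" if f: "f \<in> Cc_inf \<Omega>" for f :: "real^'n \<Rightarrow> real"
  \<comment> \<open>The zero function is excluded from the quotients in the hypothesis; for it the
    integrand vanishes.\<close>
  proof (cases "f = (\<lambda>x. 0)")
    case True
    then have "grad_sq f x = 0" for x
      using iter_partial_outside_tsupport[OF f, of x "[_]"] by (simp add: grad_sq_def tsupport_def)
    then show ?thesis using True by simp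
  next
    case False
    let ?Q = "(\<integral>x. grad_sq f x - V x * (f x)\<^sup>2 \<partial>lebesgue) / (\<integral>x. grad_sq f x \<partial>lebesgue)"
    have f': "f \<in> Cc_inf UNIV" using f by (simp add: Cc_inf_def)
    (* If V f^2 were not integrable, the Bochner integral and hence the quotient would be 0. *)
    have "0 < ?Q"
      by (rule less_le_trans[OF pos(2) cInf_lower[OF _ pos(1)]]) (use f' False in blast)
    moreover have "0 \<le> (\<integral>x. grad_sq f x \<partial>lebesgue)"
      by (intro Bochner_Integration.integral_nonneg) (simp add: grad_sq_def sum_nonneg)
    ultimately have "0 \<le> (\<integral>x. grad_sq f x - V x * (f x)\<^sup>2 \<partial>lebesgue)"
      by (auto simp: zero_less_divide_iff)
    moreover have "(\<lambda>x. grad_sq f x - V x * (f x)\<^sup>2) \<in> borel_measurable borel"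
    proof -
      have [measurable]: "f \<in> borel_measurable borel" "grad_sq f \<in> borel_measurable borel"
        using test_function_bounds[OF f] integral_grad_sq(1)[OF f] by auto
      show ?thesis by measurable
    qed
    ultimately show ?thesis by (simp add: lebesgue_eq_lborel)
  qed
  \<comment> \<open>Under the standing bound on \<open>lam\<close> the failure of the threshold
    inequality means that \<open>lam\<close> lies strictly between \<kappa>^2 - 1 and \<kappa>^2,
    where the two roots are real and distinct.\<close>
  show ?thesis
    using T_essentially_self_adjoint[OF nonneg \<kappa>0] T_not_essentially_self_adjoint[OF N3] lam \<kappa> by force
qed

end
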